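(* If $G$ is a polycyclic group, $X$ is a standard Borel space, and $G\curvearrowright X$ is any (not necessarily free) Borel action, then the orbit equivalence relation $E_G^X$ is hyperfinite.
   Context: A group $G$ is polycyclic if it admits a finite sequence $G=G_0\rhd G_1\rhd\cdots\rhd G_n=\{1_G\}$ of subgroups, each normal in $G$, such that every quotient $G_k/G_{k+1}$ is a finitely generated abelian group. $E_G^X=\{(x,y)\in X\times X:\exists g\in G\ g\cdot x=y\}$. An equivalence relation on $X$ is Borel if it is a Borel subset of $X\times X$, finite if all its classes are finite, and hyperfinite if it is the union of an increasing sequence of finite Borel equivalence relations. *)

theory Defs
  imports "HOL-Analysis.Analysis" "HOL-Algebra.Group_Action" "HOL-Algebra.Generated_Groups"
begin

definition finitely_generated_group :: "('a, 'b) monoid_scheme \<Rightarrow> bool" where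
  "finitely_generated_group G \<longleftrightarrow>
     group G \<and> (\<exists>S. finite S \<and> S \<subseteq> carrier G \<and> generate G S = carrier G)"

(* Each term of the series is normal in the whole group, not merely in its predecessor. *)
definition polycyclic_group :: "('a, 'b) monoid_scheme \<Rightarrow> bool" where
  "polycyclic_group G \<longleftrightarrow> group G \<and>
     (\<exists>(n::nat) (H :: nat \<Rightarrow> 'a set).
        H 0 = carrier G \<and> H n = {\<one>\<^bsub>G\<^esub>} \<and>
        (\<forall>k\<le>n. H k \<lhd> G) \<and>
        (\<forall>k<n. H (Suc k) \<subseteq> H k \<and>
           comm_group ((G\<lparr>carrier := H k\<rparr>) Mod H (Suc k)) \<and>
           finitely_generated_group ((G\<lparr>carrier := H k\<rparr>) Mod H (Suc k))))"

definition Polish_topology :: "'x topology \<Rightarrow> bool" where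
  "Polish_topology T \<longleftrightarrow> completely_metrizable_space T \<and> separable_space T"

(* Measurable spaces are represented by the library type of measures, of which only the
   underlying set and the sigma-algebra are used here and below; the measure itself plays no role. *)
definition standard_Borel_space :: "'x measure \<Rightarrow> bool" where
  "standard_Borel_space M \<longleftrightarrow>
     (\<exists>T. Polish_topology T \<and> topspace T = space M \<and>
          sets M = sigma_sets (space M) {U. openin T U})"

(* The acting group carries the discrete Borel structure. *)
definition Borel_action ::
  "('g, 'b) monoid_scheme \<Rightarrow> 'x measure \<Rightarrow> ('g \<Rightarrow> 'x \<Rightarrow> 'x) \<Rightarrow> bool" where
  "Borel_action G M \<phi> \<longleftrightarrow> group_action G (space M) \<phi> \<and>
     (\<lambda>(g, x). \<phi> g x) \<in> measurable (count_space (carrier G) \<Otimes>\<^sub>M M) M"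

definition orbit_equiv_rel ::
  "('g, 'b) monoid_scheme \<Rightarrow> 'x set \<Rightarrow> ('g \<Rightarrow> 'x \<Rightarrow> 'x) \<Rightarrow> ('x \<times> 'x) set" where
  "orbit_equiv_rel G X \<phi> = {(x, y). x \<in> X \<and> y \<in> X \<and> (\<exists>g\<in>carrier G. \<phi> g x = y)}"

definition Borel_equiv_rel :: "'x measure \<Rightarrow> ('x \<times> 'x) set \<Rightarrow> bool" where
  "Borel_equiv_rel M E \<longleftrightarrow> equiv (space M) E \<and> E \<in> sets (M \<Otimes>\<^sub>M M)"

definition finite_equiv_rel :: "'x set \<Rightarrow> ('x \<times> 'x) set \<Rightarrow> bool" where
  "finite_equiv_rel X E \<longleftrightarrow> equiv X E \<and> (\<forall>C \<in> X // E. finite C)"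

definition hyperfinite :: "'x measure \<Rightarrow> ('x \<times> 'x) set \<Rightarrow> bool" where
  "hyperfinite M E \<longleftrightarrow> equiv (space M) E \<and>
     (\<exists>F :: nat \<Rightarrow> ('x \<times> 'x) set.
        incseq F \<and>
        (\<forall>n. Borel_equiv_rel M (F n) \<and> finite_equiv_rel (space M) (F n)) \<and>
        E = (\<Union>n. F n))"

end

theory Submission
  imports Defs "HOL-Algebra.SndIsomorphismGrp"
begin

text \<open>
  A free action of \<open>G\<close> is hyperfinite once, for every finite window \<open>S\<close>, each point can be moved in a
  Borel way along a bounded group element to a center such that at most \<open>K\<close> centers are seen from
  each window, \<open>K\<close> being independent of \<open>S\<close>: iterating such maps gives increasing finite equivalence
  relations whose union has index at most \<open>K\<close> in the orbit relation.

  Such centers are produced by local rules depending on a proper coloring with finitely many colors,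
  by induction along the series. For an abelian normal subgroup \<open>A\<close>, take a net of large scale \<open>n\<close> in the
  \<open>A\<close>-direction and cut the orbit into cells bounded by balls around the net points. As a fixed
  \<open>g \<in> G\<close> distorts lengths in \<open>A\<close> by a bounded factor, the cells can be properly colored with a
  number of colors independent of \<open>n\<close>, so each point sees a proper coloring of \<open>G/A\<close>, to which the rule
  for \<open>G/A\<close> applies. The window and number of colors of that rule being known, the radii of the balls
  are chosen greedily such that no point is close, at the levels in the window, to more than \<open>\<delta>\<close> spheres,
  where \<open>\<delta>\<close> is the number of generators of \<open>A\<close>; hence only \<open>2 ^ \<delta>\<close> colorings of \<open>G/A\<close> are
  visible nearby.

  For arbitrary actions, all subgroups of a polycyclic group are finitely generated, so there are only
  countably many stabilizers \<open>L\<close>, and the normalizer of \<open>L\<close> modulo \<open>L\<close>, which has a series of the same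
  kind, acts freely on the points with stabilizer \<open>L\<close>.
\<close>

section \<open>Local rules\<close>

text \<open>The induction cannot run over Borel actions, because \<open>G/A\<close> does not act on
  the space. The statement that is inducted on therefore concerns colorings of the abstract group,
  and a point of an orbit consults it through a coloring of \<open>G/A\<close> read off nearby. Two
  points of a window may read different colorings; each coloring yields up to \<open>K\<close>
  centers, so their number has to be bounded independently of the window.

  The bound \<delta> comes from a count with random radii. Let each net point have \<open>m\<close>
  possible radii, spaced so that a given point is close to at most one of the resulting spheres. A
  point is then close to a given sphere with probability at most \<open>1/m\<close>, hence to
  \<delta> + 1 given spheres with probability about \<open>m\<close> to the power -(\<delta> + 1),
  whereas a neighborhood at a scale proportional to \<open>m\<close> has about
  \<open>m ^ \<delta>\<close> points. For large \<open>m\<close> the expected number of bad points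
  is below 1. The greedy choice is this argument made deterministic by conditional expectations,
  which also makes it local.\<close>

text \<open>Off the carrier \<open>shift\<close> is set to 0, so that composition of shifts holds as an equation of functions.\<close>

definition shift :: "('g, 'b) monoid_scheme \<Rightarrow> 'g \<Rightarrow> ('g \<Rightarrow> nat) \<Rightarrow> 'g \<Rightarrow> nat" where
  "shift G g \<omega> = (\<lambda>h. if h \<in> carrier G then \<omega> (h \<otimes>\<^bsub>G\<^esub> g) else 0)"

definition local_fun :: "('g, 'b) monoid_scheme \<Rightarrow> (('g \<Rightarrow> nat) \<Rightarrow> 'v) \<Rightarrow> bool" where
  "local_fun G \<Phi> \<longleftrightarrow> (\<exists>W. finite W \<and> W \<subseteq> carrier G \<and>
     (\<forall>\<omega> \<omega>'. (\<forall>h\<in>W. \<omega> h = \<omega>' h) \<longrightarrow> \<Phi> \<omega> = \<Phi> \<omega>'))"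

lemma local_funI:
  assumes "finite W" "W \<subseteq> carrier G" "\<And>\<omega> \<omega>'. (\<And>h. h \<in> W \<Longrightarrow> \<omega> h = \<omega>' h) \<Longrightarrow> \<Phi> \<omega> = \<Phi> \<omega>'"
  shows "local_fun G \<Phi>"
  using assms unfolding local_fun_def by metis

lemma local_fun_const [intro]: "local_fun G (\<lambda>\<omega>. c)"
  by (rule local_funI[of "{}"]) auto

lemma local_fun_coord [intro]: "g \<in> carrier G \<Longrightarrow> local_fun G (\<lambda>\<omega>. \<omega> g)"
  by (rule local_funI[of "{g}"]) auto

text \<open>Serves wherever a rule searches a finite ball or takes a minimum: its windows are
  united, and only the dependence has to be exhibited.\<close>

lemma local_fun_family:
  assumes "finite V" "\<And>v. v \<in> V \<Longrightarrow> local_fun G (\<Phi> v)"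
    and H: "\<And>\<omega> \<omega>'. (\<And>v. v \<in> V \<Longrightarrow> \<Phi> v \<omega> = \<Phi> v \<omega>') \<Longrightarrow> \<Psi> \<omega> = \<Psi> \<omega>'"
  shows "local_fun G \<Psi>"
proof -
  define Q where "Q v W \<longleftrightarrow> finite W \<and> W \<subseteq> carrier G \<and>
     (\<forall>\<omega> \<omega>'. (\<forall>h\<in>W. \<omega> h = \<omega>' h) \<longrightarrow> \<Phi> v \<omega> = \<Phi> v \<omega>')" for v W
  have "\<forall>v\<in>V. \<exists>W. Q v W"
    using assms(2) unfolding local_fun_def Q_def by blast
  then obtain W where W: "\<And>v. v \<in> V \<Longrightarrow> Q v (W v)"
    by metis
  show ?thesis
  proof (rule local_funI[of "\<Union>v\<in>V. W v"])
    show "finite (\<Union>v\<in>V. W v)" using assms(1) W by (auto simp: Q_def)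
    show "(\<Union>v\<in>V. W v) \<subseteq> carrier G" using W by (auto simp: Q_def)
  next
    fix \<omega> \<omega>' :: "_ \<Rightarrow> nat" assume *: "\<And>h. h \<in> (\<Union>v\<in>V. W v) \<Longrightarrow> \<omega> h = \<omega>' h"
    show "\<Psi> \<omega> = \<Psi> \<omega>'"
    proof (rule H)
      fix v assume v: "v \<in> V"
      have "\<forall>h\<in>W v. \<omega> h = \<omega>' h" using * v by auto
      then show "\<Phi> v \<omega> = \<Phi> v \<omega>'" using W[OF v] unfolding Q_def by auto
    qed
  qed
qed

lemma local_fun_app:
  assumes "local_fun G \<Phi>" "local_fun G \<Psi>"
  shows "local_fun G (\<lambda>\<omega>. (\<Phi> \<omega>) (\<Psi> \<omega>))"
proof -
  obtain W W' where "finite W \<and> W \<subseteq> carrier G \<and>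
     (\<forall>\<omega> \<omega>'. (\<forall>h\<in>W. \<omega> h = \<omega>' h) \<longrightarrow> \<Phi> \<omega> = \<Phi> \<omega>')" "finite W' \<and> W' \<subseteq> carrier G \<and>
     (\<forall>\<omega> \<omega>'. (\<forall>h\<in>W'. \<omega> h = \<omega>' h) \<longrightarrow> \<Psi> \<omega> = \<Psi> \<omega>')"
    using assms unfolding local_fun_def by blast
  then show ?thesis by (intro local_funI[of "W \<union> W'"]) (auto, metis)
qed

lemma local_fun_comp:
  assumes "local_fun G \<Phi>" shows "local_fun G (\<lambda>\<omega>. f (\<Phi> \<omega>))"
  by (rule local_fun_family[where V = "{()}" and \<Phi> = "\<lambda>_. \<Phi>"]) (simp_all add: assms)

lemma local_fun_comp2:
  assumes "local_fun G \<Phi>" "local_fun G \<Psi>"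
  shows "local_fun G (\<lambda>\<omega>. f (\<Phi> \<omega>) (\<Psi> \<omega>))"
  using local_fun_app[OF local_fun_comp[OF assms(1), of f] assms(2)] .

lemma local_fun_if:
  assumes "local_fun G P" "local_fun G \<Phi>" "local_fun G \<Psi>"
  shows "local_fun G (\<lambda>\<omega>. if P \<omega> then \<Phi> \<omega> else \<Psi> \<omega>)"
  using local_fun_app[OF local_fun_comp2[OF assms(1,2), of If] assms(3)] .

lemma local_fun_lambda:
  assumes "finite V" "\<And>v. v \<in> V \<Longrightarrow> local_fun G (\<Phi> v)"
  shows "local_fun G (\<lambda>\<omega> v. if v \<in> V then \<Phi> v \<omega> else d v)"
  by (rule local_fun_family[OF assms]) auto

context group
begin

lemma shift_shift:
  assumes "g \<in> carrier G" "h \<in> carrier G"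
  shows "shift G h (shift G g \<omega>) = shift G (h \<otimes> g) \<omega>"
  using assms by (auto simp: shift_def m_assoc fun_eq_iff)

lemma shift_apply: "h \<in> carrier G \<Longrightarrow> shift G g \<omega> h = \<omega> (h \<otimes> g)"
  by (simp add: shift_def)

lemma local_fun_shift:
  assumes "local_fun G \<Phi>" "g \<in> carrier G"
  shows "local_fun G (\<lambda>\<omega>. \<Phi> (shift G g \<omega>))"
proof -
  obtain W where W: "finite W" "W \<subseteq> carrier G"
     "\<And>\<omega> \<omega>'. (\<forall>h\<in>W. \<omega> h = \<omega>' h) \<Longrightarrow> \<Phi> \<omega> = \<Phi> \<omega>'"
    using assms unfolding local_fun_def by blast
  show ?thesis
  proof (rule local_funI[of "(\<lambda>h. h \<otimes> g) ` W"])
    fix \<omega> \<omega>' :: "'a \<Rightarrow> nat" assume "\<And>h. h \<in> (\<lambda>h. h \<otimes> g) ` W \<Longrightarrow> \<omega> h = \<omega>' h"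
    then show "\<Phi> (shift G g \<omega>) = \<Phi> (shift G g \<omega>')"
      by (intro W(3)) (auto simp: shift_def)
  qed (use W assms in auto)
qed

text \<open>Values are only requested at strictly smaller ranks, and ranks below \<open>N\<close>
  allow fewer than \<open>N\<close> such steps, so the recursion unfolds to finitely many
  coordinates. The nets, the colorings of nets and the radii below are all instances, with different
  ranks and different \<open>T\<close>.\<close>

lemma local_greedy:
  fixes r :: "('a \<Rightarrow> nat) \<Rightarrow> nat" and T :: "('a \<Rightarrow> nat) \<Rightarrow> ('a \<Rightarrow> 'v option) \<Rightarrow> 'v"
  assumes r: "local_fun G r" and T: "local_fun G T" and V: "finite V" "V \<subseteq> carrier G"
  obtains \<Phi> :: "('a \<Rightarrow> nat) \<Rightarrow> 'v" where "local_fun G \<Phi>"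
    "\<And>\<omega>. r \<omega> < N \<Longrightarrow> \<Phi> \<omega> = T \<omega> (\<lambda>v. if v \<in> V \<and> r (shift G v \<omega>) < r \<omega> then Some (\<Phi> (shift G v \<omega>)) else None)"
proof -
  define \<Psi> :: "nat \<Rightarrow> ('a \<Rightarrow> nat) \<Rightarrow> 'v" where
    "\<Psi> = rec_nat (\<lambda>\<omega>. undefined) (\<lambda>i::nat. \<lambda>\<Psi>i \<omega>. if r \<omega> = i then
       T \<omega> (\<lambda>v. if v \<in> V then if r (shift G v \<omega>) < i then Some (\<Psi>i (shift G v \<omega>)) else None else None)
       else \<Psi>i \<omega>)"
  have \<Psi>_Suc: "\<Psi> (Suc i) = (\<lambda>\<omega>. if r \<omega> = i then
       T \<omega> (\<lambda>v. if v \<in> V then if r (shift G v \<omega>) < i then Some (\<Psi> i (shift G v \<omega>)) else None else None)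
       else \<Psi> i \<omega>)" for i
    unfolding \<Psi>_def by simp
  have lc: "local_fun G (\<Psi> i)" for i
  proof (induction i)
    case 0
    then show ?case by (simp add: \<Psi>_def local_fun_const)
  next
    case (Suc i)
    show ?case unfolding \<Psi>_Suc
    proof (intro local_fun_if local_fun_app[OF T] local_fun_lambda V(1) Suc)
      show "local_fun G (\<lambda>\<omega>. r \<omega> = i)" using r by (rule local_fun_comp)
    next
      fix v assume "v \<in> V"
      then have v: "v \<in> carrier G" using V by auto
      show "local_fun G (\<lambda>\<omega>. r (shift G v \<omega>) < i)"
        by (rule local_fun_comp[OF local_fun_shift[OF r v]])
      show "local_fun G (\<lambda>\<omega>. Some (\<Psi> i (shift G v \<omega>)))"
        by (rule local_fun_comp[OF local_fun_shift[OF Suc v]])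
    qed auto
  qed
  \<comment> \<open>Stage \<open>i\<close> is final at all positions of rank below \<open>i\<close>,
    so \<open>\<Psi> N\<close> solves the recursion wherever the rank is below \<open>N\<close>;
    elsewhere it keeps the junk value of stage 0.\<close>
  have stable: "i > r \<omega> \<Longrightarrow> \<Psi> i \<omega> = \<Psi> (Suc (r \<omega>)) \<omega>" for i \<omega>
  proof (induction i)
    case (Suc i)
    then show ?case by (cases "r \<omega> = i") (auto simp: \<Psi>_Suc)
  qed simp
  have "\<Psi> N \<omega> = T \<omega> (\<lambda>v. if v \<in> V \<and> r (shift G v \<omega>) < r \<omega> then Some (\<Psi> N (shift G v \<omega>)) else None)"
    if "r \<omega> < N" for \<omega>
  proof -
    have "\<Psi> N \<omega> = \<Psi> (Suc (r \<omega>)) \<omega>" using stable that by blast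
    also have "\<dots> = T \<omega> (\<lambda>v. if v \<in> V then if r (shift G v \<omega>) < r \<omega> then Some (\<Psi> (r \<omega>) (shift G v \<omega>)) else None else None)"
      by (simp add: \<Psi>_Suc)
    also have "(\<lambda>v. if v \<in> V then if r (shift G v \<omega>) < r \<omega> then Some (\<Psi> (r \<omega>) (shift G v \<omega>)) else None else None) =
       (\<lambda>v. if v \<in> V \<and> r (shift G v \<omega>) < r \<omega> then Some (\<Psi> N (shift G v \<omega>)) else None)"
      using stable[of "shift G _ \<omega>" "r \<omega>"] stable[of "shift G _ \<omega>" N] that by (auto simp: fun_eq_iff)
    finally show ?thesis .
  qed
  then show ?thesis using lc that by blast
qed

end

text \<open>Neighbors are compared at positions in \<open>R\<close> only, because a coloring of a
  quotient read off in a larger group will be known to be proper on finite sets only. The bound on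
  the colors is demanded everywhere, which places the colorings in a compact product.\<close>

definition proper_coloring :: "('g, 'b) monoid_scheme \<Rightarrow> 'g set \<Rightarrow> 'g set \<Rightarrow> nat \<Rightarrow> ('g \<Rightarrow> nat) \<Rightarrow> bool" where
  "proper_coloring G R F N \<omega> \<longleftrightarrow> (\<forall>g\<in>carrier G. \<omega> g < N) \<and>
     (\<forall>g\<in>R. \<forall>f\<in>F. f \<noteq> \<one>\<^bsub>G\<^esub> \<longrightarrow> \<omega> (f \<otimes>\<^bsub>G\<^esub> g) \<noteq> \<omega> g)"

text \<open>A finitary, uniform form of having finite Borel asymptotic dimension: the local rule \<open>a\<close> sends
  each position \<open>g\<close> of a colored copy of \<open>G\<close> to the cell center \<open>a (shift G g \<omega>) \<otimes> g\<close>, and at most \<open>K\<close>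
  centers are seen from a window \<open>S\<close>. It is crucial that \<open>F\<close> is chosen before the number \<open>N\<close> of colors.\<close>

definition rule_bound :: "nat \<Rightarrow> ('g, 'b) monoid_scheme \<Rightarrow> bool" where
  "rule_bound K G \<longleftrightarrow> (\<forall>S. finite S \<and> S \<subseteq> carrier G \<longrightarrow>
     (\<exists>F. finite F \<and> F \<subseteq> carrier G \<and> (\<forall>N. \<exists>B a. finite B \<and> B \<subseteq> carrier G \<and>
        range a \<subseteq> B \<and> local_fun G a \<and>
        (\<forall>\<omega>. proper_coloring G (carrier G) F N \<omega> \<longrightarrow>
           card ((\<lambda>s. a (shift G s \<omega>) \<otimes>\<^bsub>G\<^esub> s) ` S) \<le> K))))"

lemma proper_coloring_mono:
  "proper_coloring G R F N \<omega> \<Longrightarrow> F' \<subseteq> F \<Longrightarrow> R' \<subseteq> R \<Longrightarrow> proper_coloring G R' F' N \<omega>"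
  unfolding proper_coloring_def by blast

context group
begin

text \<open>Compactness of the space of colorings.\<close>

lemma finite_window:
  assumes S: "finite S" "S \<subseteq> carrier G" and F: "F \<subseteq> carrier G" and a: "local_fun G a"
    and bound: "\<And>\<omega>. proper_coloring G (carrier G) F N \<omega> \<Longrightarrow> card ((\<lambda>s. a (shift G s \<omega>) \<otimes> s) ` S) \<le> K"
  obtains R where "finite R" "R \<subseteq> carrier G"
    "\<And>\<omega>. proper_coloring G R F N \<omega> \<Longrightarrow> card ((\<lambda>s. a (shift G s \<omega>) \<otimes> s) ` S) \<le> K"
proof -
  define bad where "bad \<omega> \<longleftrightarrow> \<not> card ((\<lambda>s. a (shift G s \<omega>) \<otimes> s) ` S) \<le> K" for \<omega>
  have "local_fun G bad"
    unfolding bad_def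
    by (rule local_fun_family[where \<Phi> = "\<lambda>s \<omega>. a (shift G s \<omega>)" and V = S])
      (use S a in \<open>auto intro!: arg_cong[where f = "\<lambda>A. \<not> card A \<le> K"] image_cong local_fun_shift\<close>)
  then obtain W where W: "finite W" "W \<subseteq> carrier G"
     "\<And>\<omega> \<omega>'. (\<forall>h\<in>W. \<omega> h = \<omega>' h) \<Longrightarrow> bad \<omega> = bad \<omega>'"
    unfolding local_fun_def by metis
  define C where "C g = {\<omega> :: 'a \<Rightarrow> nat. \<forall>f\<in>F. f \<noteq> \<one> \<longrightarrow> \<omega> (f \<otimes> g) \<noteq> \<omega> g}" for g
  define D where "D = (PiE UNIV (\<lambda>_::'a. {..<N}))"
  have "compact D"
    using compactin_PiE[of "\<lambda>_::'a. euclidean :: nat topology" UNIV "\<lambda>_. {..<N}"]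
    unfolding D_def compactin_euclidean_iff[symmetric] euclidean_product_topology
    using finite_imp_compact[of "{..<N}"] by simp
  have coord: "continuous_on UNIV (\<lambda>\<omega> :: 'a \<Rightarrow> nat. \<omega> g)" for g
    by (rule continuous_on_product_coordinates)
  have closedC: "closed (C g)" for g
  proof -
    have "closed {\<omega> :: 'a \<Rightarrow> nat. \<omega> h \<noteq> \<omega> g}" for h
    proof -
      have "open (\<Union>n. (\<lambda>\<omega> :: 'a \<Rightarrow> nat. \<omega> h) -` {n} \<inter> (\<lambda>\<omega>. \<omega> g) -` {n})"
        using coord by (intro open_UN open_Int ballI open_vimage) (auto simp: open_discrete)
      moreover have "- {\<omega> :: 'a \<Rightarrow> nat. \<omega> h \<noteq> \<omega> g} = (\<Union>n. (\<lambda>\<omega>. \<omega> h) -` {n} \<inter> (\<lambda>\<omega>. \<omega> g) -` {n})"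
        by auto
      ultimately show ?thesis unfolding closed_def by simp
    qed
    then have "closed (\<Inter>f\<in>F - {\<one>}. {\<omega> :: 'a \<Rightarrow> nat. \<omega> (f \<otimes> g) \<noteq> \<omega> g})" by auto
    moreover have "C g = (\<Inter>f\<in>F - {\<one>}. {\<omega>. \<omega> (f \<otimes> g) \<noteq> \<omega> g})" by (auto simp: C_def)
    ultimately show ?thesis by simp
  qed
  have closed_bad: "closed {\<omega>. bad \<omega>}"
  proof -
    have "open {\<omega>. \<not> bad \<omega>}"
    proof (subst open_subopen, intro ballI)
      fix \<omega>0 assume w0: "\<omega>0 \<in> {\<omega>. \<not> bad \<omega>}"
      have "open (\<Inter>h\<in>W. (\<lambda>\<omega> :: 'a \<Rightarrow> nat. \<omega> h) -` {\<omega>0 h})"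
        using W(1) coord by (intro open_INT ballI open_vimage) (auto simp: open_discrete)
      moreover have "(\<Inter>h\<in>W. (\<lambda>\<omega> :: 'a \<Rightarrow> nat. \<omega> h) -` {\<omega>0 h}) \<subseteq> {\<omega>. \<not> bad \<omega>}"
      proof
        fix \<omega> assume "\<omega> \<in> (\<Inter>h\<in>W. (\<lambda>\<omega> :: 'a \<Rightarrow> nat. \<omega> h) -` {\<omega>0 h})"
        then have "bad \<omega> = bad \<omega>0" by (intro W(3)) auto
        then show "\<omega> \<in> {\<omega>. \<not> bad \<omega>}" using w0 by simp
      qed
      ultimately show "\<exists>U. open U \<and> \<omega>0 \<in> U \<and> U \<subseteq> {\<omega>. \<not> bad \<omega>}" by blast
    qed
    then show ?thesis by (simp add: closed_def Collect_neg_eq)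
  qed
  have "compact (D \<inter> {\<omega>. bad \<omega>})" using \<open>compact D\<close> closed_bad by (rule compact_Int_closed)
  moreover have "(D \<inter> {\<omega>. bad \<omega>}) \<inter> (\<Inter>g\<in>carrier G. C g) = {}"
  proof -
    have False if "\<omega> \<in> D" "bad \<omega>" "\<forall>g\<in>carrier G. \<omega> \<in> C g" for \<omega>
      using bound[of \<omega>] that unfolding D_def C_def bad_def proper_coloring_def by auto
    then show ?thesis by auto
  qed
  ultimately obtain R where R: "R \<subseteq> carrier G" "finite R" "(D \<inter> {\<omega>. bad \<omega>}) \<inter> (\<Inter>g\<in>R. C g) = {}"
    using compact_imp_fip_image[of "D \<inter> {\<omega>. bad \<omega>}" "carrier G" C] closedC by metis
  show ?thesis
  proof (rule that[of R])
    fix \<omega> assume p: "proper_coloring G R F N \<omega>"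
    \<comment> \<open>\<open>D\<close> restricts the values at all elements of the type; off the
      carrier they are replaced by the value at \<open>\<one>\<close>, which \<open>bad\<close> does
      not notice.\<close>
    define \<omega>' where "\<omega>' g = (if g \<in> carrier G then \<omega> g else \<omega> \<one>)" for g
    have "\<omega>' \<in> D" using p by (auto simp: D_def \<omega>'_def proper_coloring_def)
    moreover have "\<omega>' \<in> C g" if "g \<in> R" for g
      using p that R F by (auto simp: C_def \<omega>'_def proper_coloring_def subset_iff)
    ultimately have "\<not> bad \<omega>'" using R by blast
    moreover have "bad \<omega>' = bad \<omega>" using W(2) by (intro W(3)) (auto simp: \<omega>'_def)
    ultimately show "card ((\<lambda>s. a (shift G s \<omega>) \<otimes> s) ` S) \<le> K" by (simp add: bad_def)
  qed (use R in auto)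
qed

end

section \<open>Length functions on abelian normal subgroups\<close>

primrec word :: "('g, 'b) monoid_scheme \<Rightarrow> 'g list \<Rightarrow> (nat \<Rightarrow> int) \<Rightarrow> 'g" where
  "word G [] e = \<one>\<^bsub>G\<^esub>"
| "word G (t # ts) e = t [^]\<^bsub>G\<^esub> e 0 \<otimes>\<^bsub>G\<^esub> word G ts (\<lambda>i. e (Suc i))"

text \<open>The smallest sup norm of an exponent vector, not the usual word length: balls become
  images of cubes, and the exponent in the packing bound is the number of generators, whatever
  relations hold between them.\<close>

definition word_len :: "('g, 'b) monoid_scheme \<Rightarrow> 'g list \<Rightarrow> 'g \<Rightarrow> nat" where
  "word_len G ts a = (LEAST n. \<exists>e. (\<forall>i<length ts. \<bar>e i\<bar> \<le> int n) \<and> word G ts e = a)"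

lemma int_div_eq_dist:
  fixes k a b :: int
  assumes "k > 0" "a div k = b div k"
  shows "\<bar>b - a\<bar> < k"
proof -
  have "a = k * (a div k) + a mod k" "b = k * (b div k) + b mod k" by simp_all
  moreover have "0 \<le> a mod k" "a mod k < k" "0 \<le> b mod k" "b mod k < k" using assms by simp_all
  moreover have "k * (a div k) = k * (b div k)" using assms(2) by simp
  ultimately show ?thesis by linarith
qed

context comm_group
begin

lemma word_closed [simp]: "set ts \<subseteq> carrier G \<Longrightarrow> word G ts e \<in> carrier G"
  by (induction ts arbitrary: e) auto

lemma word_cong: "(\<And>i. i < length ts \<Longrightarrow> e i = f i) \<Longrightarrow> word G ts e = word G ts f"
proof (induction ts arbitrary: e f)
  case (Cons t ts)
  have "word G ts (\<lambda>i. e (Suc i)) = word G ts (\<lambda>i. f (Suc i))"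
    by (rule Cons.IH) (use Cons.prems in auto)
  moreover have "e 0 = f 0" using Cons.prems by simp
  ultimately show ?case by simp
qed simp

lemma word_add: "set ts \<subseteq> carrier G \<Longrightarrow> word G ts (\<lambda>i. e i + f i) = word G ts e \<otimes> word G ts f"
proof (induction ts arbitrary: e f)
  case (Cons t ts)
  have c: "t \<in> carrier G" "set ts \<subseteq> carrier G" using Cons.prems by auto
  have "word G (t # ts) (\<lambda>i. e i + f i) = (t [^] e 0 \<otimes> t [^] f 0) \<otimes> (word G ts (\<lambda>i. e (Suc i)) \<otimes> word G ts (\<lambda>i. f (Suc i)))"
    using Cons.IH[OF c(2), of "\<lambda>i. e (Suc i)" "\<lambda>i. f (Suc i)"] c by (simp add: int_pow_mult)
  also have "\<dots> = (t [^] e 0 \<otimes> word G ts (\<lambda>i. e (Suc i))) \<otimes> (t [^] f 0 \<otimes> word G ts (\<lambda>i. f (Suc i)))"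
    using c by (simp add: m_ac)
  finally show ?case by simp
qed simp

lemma word_zero: "set ts \<subseteq> carrier G \<Longrightarrow> word G ts (\<lambda>i. 0) = \<one>"
  by (induction ts) auto

lemma word_scale: "set ts \<subseteq> carrier G \<Longrightarrow> word G ts (\<lambda>i. k * e i) = word G ts e [^] (k :: int)"
proof (induction ts arbitrary: e)
  case (Cons t ts)
  have c: "t \<in> carrier G" "set ts \<subseteq> carrier G" using Cons.prems by auto
  then show ?case using Cons.IH[OF c(2), of "\<lambda>i. e (Suc i)"]
    by (simp add: int_pow_distrib int_pow_pow mult.commute[of k])
qed simp

lemma word_uminus: "set ts \<subseteq> carrier G \<Longrightarrow> word G ts (\<lambda>i. - e i) = inv (word G ts e)"
  using word_scale[of ts "-1" e] by (simp add: int_pow_neg)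

lemma word_unit:
  "set ts \<subseteq> carrier G \<Longrightarrow> i < length ts \<Longrightarrow> word G ts (\<lambda>j. if j = i then 1 else 0) = ts ! i"
proof (induction ts arbitrary: i)
  case (Cons t ts)
  show ?case
  proof (cases i)
    case 0
    then show ?thesis using Cons.prems word_zero[of ts] by simp
  next
    case (Suc j)
    then show ?thesis using Cons.IH[of j] Cons.prems by (simp add: nth_mem subset_iff)
  qed
qed simp

lemma word_surj:
  assumes "set ts \<subseteq> carrier G" "x \<in> generate G (set ts)"
  shows "\<exists>e. word G ts e = x"
  using assms(2)
proof (induction rule: generate.induct)
  case one
  then show ?case using word_zero[OF assms(1)] by blast
next
  case (incl h)
  then show ?case using word_unit[OF assms(1)] by (metis in_set_conv_nth)
next
  case (inv h)
  then obtain e where "word G ts e = h" using word_unit[OF assms(1)] by (metis in_set_conv_nth)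
  then show ?case using word_uminus[OF assms(1)] by blast
next
  case (eng h1 h2)
  then show ?case using word_add[OF assms(1)] by metis
qed

lemma word_hom:
  assumes "\<phi> \<in> hom G G" "set ts \<subseteq> carrier G"
  shows "\<phi> (word G ts e) = word G (map \<phi> ts) e"
proof -
  interpret h: group_hom G G \<phi>
    using assms(1) by (simp add: group_hom_def group_hom_axioms_def)
  show ?thesis using assms(2)
  proof (induction ts arbitrary: e)
    case (Cons t ts)
    then show ?case using Cons.IH[of "\<lambda>i. e (Suc i)"] by (simp add: h.hom_int_pow)
  qed simp
qed

context
  fixes ts :: "'a list"
  assumes ts: "set ts \<subseteq> carrier G" and gen: "generate G (set ts) = carrier G"
begin

lemma word_len_le: "(\<And>i. i < length ts \<Longrightarrow> \<bar>e i\<bar> \<le> int n) \<Longrightarrow> word_len G ts (word G ts e) \<le> n"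
  unfolding word_len_def by (rule Least_le) blast

lemma word_len_rep:
  assumes "a \<in> carrier G"
  obtains e where "word G ts e = a" "\<And>i. i < length ts \<Longrightarrow> \<bar>e i\<bar> \<le> int (word_len G ts a)"
proof -
  obtain e where e: "word G ts e = a" using word_surj[OF ts] gen assms by metis
  have "\<bar>e i\<bar> \<le> int (\<Sum>j<length ts. nat \<bar>e j\<bar>)" if "i < length ts" for i
  proof -
    have "nat \<bar>e i\<bar> \<le> (\<Sum>j<length ts. nat \<bar>e j\<bar>)"
      using member_le_sum[of i "{..<length ts}" "\<lambda>j. nat \<bar>e j\<bar>"] that by simp
    then show ?thesis by linarith
  qed
  then have "\<exists>n. \<exists>e. (\<forall>i<length ts. \<bar>e i\<bar> \<le> int n) \<and> word G ts e = a" using e by blast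
  from LeastI_ex[OF this] show ?thesis using that unfolding word_len_def by blast
qed

lemma word_len_mult:
  assumes "a \<in> carrier G" "b \<in> carrier G"
  shows "word_len G ts (a \<otimes> b) \<le> word_len G ts a + word_len G ts b"
proof -
  obtain e where e: "word G ts e = a" "\<And>i. i < length ts \<Longrightarrow> \<bar>e i\<bar> \<le> int (word_len G ts a)"
    using word_len_rep[OF assms(1)] by blast
  obtain f where f: "word G ts f = b" "\<And>i. i < length ts \<Longrightarrow> \<bar>f i\<bar> \<le> int (word_len G ts b)"
    using word_len_rep[OF assms(2)] by blast
  have "word_len G ts (word G ts (\<lambda>i. e i + f i)) \<le> word_len G ts a + word_len G ts b"
    by (rule word_len_le) (use e(2) f(2) in fastforce)
  then show ?thesis using word_add[OF ts] e f by simp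
qed

lemma word_len_pow:
  assumes "a \<in> carrier G"
  shows "word_len G ts (a [^] (k::int)) \<le> nat \<bar>k\<bar> * word_len G ts a"
proof -
  obtain e where e: "word G ts e = a" "\<And>i. i < length ts \<Longrightarrow> \<bar>e i\<bar> \<le> int (word_len G ts a)"
    using word_len_rep[OF assms(1)] by blast
  have "word_len G ts (word G ts (\<lambda>i. k * e i)) \<le> nat \<bar>k\<bar> * word_len G ts a"
    by (rule word_len_le) (use e(2) in \<open>simp add: abs_mult mult_left_mono\<close>)
  then show ?thesis using word_scale[OF ts] e by simp
qed

lemma word_len_one: "word_len G ts \<one> = 0"
  using word_len_le[of "\<lambda>_. 0" 0] word_zero[OF ts] by simp

lemma word_len_inv:
  assumes "a \<in> carrier G" shows "word_len G ts (inv a) = word_len G ts a"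
proof -
  have "word_len G ts (inv b) \<le> word_len G ts b" if "b \<in> carrier G" for b
    using word_len_pow[OF that, of "-1"] that by (simp add: int_pow_neg)
  from this[of a] this[of "inv a"] show ?thesis using assms by simp
qed

lemma word_len_eq_0: "a \<in> carrier G \<Longrightarrow> word_len G ts a = 0 \<longleftrightarrow> a = \<one>"
proof
  assume a: "a \<in> carrier G" "word_len G ts a = 0"
  obtain e where e: "word G ts e = a" "\<And>i. i < length ts \<Longrightarrow> \<bar>e i\<bar> \<le> int (word_len G ts a)"
    using word_len_rep[OF a(1)] by blast
  have "word G ts e = word G ts (\<lambda>_. 0)" by (rule word_cong) (use e(2) a in auto)
  then show "a = \<one>" using e word_zero[OF ts] by simp
qed (simp add: word_len_one)

lemma word_len_word:
  assumes "set us \<subseteq> carrier G" "\<And>i. i < length us \<Longrightarrow> \<bar>e i\<bar> \<le> int n"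
  shows "word_len G ts (word G us e) \<le> n * (\<Sum>u\<leftarrow>us. word_len G ts u)"
  using assms
proof (induction us arbitrary: e)
  case Nil
  then show ?case by (simp add: word_len_one)
next
  case (Cons u us)
  have c: "u \<in> carrier G" "set us \<subseteq> carrier G" using Cons.prems by auto
  have "word_len G ts (word G (u # us) e) \<le> word_len G ts (u [^] e 0) + word_len G ts (word G us (\<lambda>i. e (Suc i)))"
    using word_len_mult c by simp
  also have "word_len G ts (u [^] e 0) \<le> n * word_len G ts u"
  proof -
    have "nat \<bar>e 0\<bar> \<le> n" using Cons.prems(2)[of 0] by simp
    then show ?thesis using word_len_pow[OF c(1), of "e 0"] mult_le_mono1 order_trans by blast
  qed
  also have "word_len G ts (word G us (\<lambda>i. e (Suc i))) \<le> n * (\<Sum>u\<leftarrow>us. word_len G ts u)"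
    by (rule Cons.IH[OF c(2)]) (use Cons.prems(2) in auto)
  finally show ?case by (simp add: algebra_simps)
qed

text \<open>A word is sent to the word with the same exponents in the images of the generators, and
  each of these images has some fixed length. Applied to conjugations, this is why the distortion is
  linear.\<close>

lemma word_len_hom:
  assumes "\<phi> \<in> hom G G"
  shows "\<exists>c. \<forall>a\<in>carrier G. word_len G ts (\<phi> a) \<le> c * word_len G ts a"
proof (intro exI ballI)
  fix a assume a: "a \<in> carrier G"
  obtain e where e: "word G ts e = a" "\<And>i. i < length ts \<Longrightarrow> \<bar>e i\<bar> \<le> int (word_len G ts a)"
    using word_len_rep[OF a] by blast
  have "set (map \<phi> ts) \<subseteq> carrier G" using assms ts by (auto simp: hom_def)
  then have "word_len G ts (word G (map \<phi> ts) e) \<le> word_len G ts a * (\<Sum>u\<leftarrow>map \<phi> ts. word_len G ts u)"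
    by (rule word_len_word) (use e in auto)
  then show "word_len G ts (\<phi> a) \<le> (\<Sum>u\<leftarrow>map \<phi> ts. word_len G ts u) * word_len G ts a"
    using word_hom[OF assms ts] e(1) by (metis mult.commute)
qed

text \<open>Pigeonhole on exponent vectors. Cut the cube of radius \<open>r\<close> into cubes of
  side \<open>Suc q\<close>; two elements with vectors in one small cube differ by a word with
  exponents at most \<open>q\<close>. With \<open>k = r div Suc q\<close>, a rounded coordinate
  takes one of the \<open>2 * k + 2\<close> values from \<open>- (k + 1)\<close> to
  \<open>k\<close>.\<close>

lemma word_len_packing:
  assumes P: "P \<subseteq> carrier G" "\<And>p. p \<in> P \<Longrightarrow> word_len G ts p \<le> r"
    and sep: "\<And>p p'. p \<in> P \<Longrightarrow> p' \<in> P \<Longrightarrow> p \<noteq> p' \<Longrightarrow> q < word_len G ts (p' \<otimes> inv p)"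
  shows "finite P \<and> card P \<le> (2 * (r div Suc q) + 2) ^ length ts"
proof -
  let ?k = "r div Suc q"
  have "\<forall>p\<in>P. \<exists>e. word G ts e = p \<and> (\<forall>i<length ts. \<bar>e i\<bar> \<le> int r)"
  proof
    fix p assume p: "p \<in> P"
    obtain e where "word G ts e = p" "\<And>i. i < length ts \<Longrightarrow> \<bar>e i\<bar> \<le> int (word_len G ts p)"
      using word_len_rep P(1) p by blast
    moreover have "int (word_len G ts p) \<le> int r" using P(2)[OF p] by simp
    ultimately show "\<exists>e. word G ts e = p \<and> (\<forall>i<length ts. \<bar>e i\<bar> \<le> int r)"
      using order_trans by blast
  qed
  then obtain e where e: "\<And>p. p \<in> P \<Longrightarrow> word G ts (e p) = p"
    "\<And>p i. p \<in> P \<Longrightarrow> i < length ts \<Longrightarrow> \<bar>e p i\<bar> \<le> int r" by metis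
  define b where "b p = (\<lambda>i\<in>{..<length ts}. e p i div int (Suc q))" for p
  have inj: "inj_on b P"
  proof (rule inj_onI, rule ccontr)
    fix p p' assume p: "p \<in> P" "p' \<in> P" "b p = b p'" "p \<noteq> p'"
    have "\<bar>e p' i + - e p i\<bar> \<le> int q" if "i < length ts" for i
    proof -
      have "b p i = b p' i" using p(3) by simp
      then have "e p i div int (Suc q) = e p' i div int (Suc q)"
        using that by (simp only: b_def restrict_apply' lessThan_iff)
      then have "\<bar>e p' i - e p i\<bar> \<le> int q"
        using int_div_eq_dist[of "int (Suc q)" "e p i" "e p' i"] by linarith
      then show ?thesis by simp
    qed
    then have "word_len G ts (word G ts (\<lambda>i. e p' i + - e p i)) \<le> q" by (rule word_len_le)
    moreover have "word G ts (\<lambda>i. e p' i + - e p i) = p' \<otimes> inv p"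
      unfolding word_add[OF ts] word_uminus[OF ts] using e(1) p by simp
    ultimately show False using sep[OF p(1,2,4)] by simp
  qed
  have sub: "b ` P \<subseteq> PiE {..<length ts} (\<lambda>_. {- int (?k + 1)..int ?k})"
  proof -
    have "- int (?k + 1) \<le> e p i div int (Suc q)" "e p i div int (Suc q) \<le> int ?k"
      if "p \<in> P" "i < length ts" for p i
    proof -
      have "e p i div int (Suc q) \<le> int r div int (Suc q)"
        using e(2)[OF that] by (intro zdiv_mono1) auto
      then show "e p i div int (Suc q) \<le> int ?k" by (simp only: zdiv_int)
      have "r < Suc q * (?k + 1)" using dividend_less_times_div[of "Suc q" r] by simp
      then have *: "int r < int (Suc q) * int (?k + 1)" by (simp only: of_nat_mult[symmetric] of_nat_less_iff)
      have **: "- int (?k + 1) * int (Suc q) = - (int (Suc q) * int (?k + 1))"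
        by (simp only: mult_minus_left mult.commute)
      have "- int (?k + 1) * int (Suc q) \<le> e p i"
        unfolding ** using e(2)[OF that] * by (simp only: abs_le_iff) linarith
      then have "(- int (?k + 1) * int (Suc q)) div int (Suc q) \<le> e p i div int (Suc q)"
        by (intro zdiv_mono1) auto
      then show "- int (?k + 1) \<le> e p i div int (Suc q)" by (simp only: nonzero_mult_div_cancel_right)
    qed
    then show ?thesis
      by (intro image_subsetI PiE_I) (simp_all only: b_def restrict_apply lessThan_iff atLeastAtMost_iff if_True if_False simp_thms)
  qed
  have fin: "finite (PiE {..<length ts} (\<lambda>_. {- int (?k + 1)..int ?k}))" by (intro finite_PiE) auto
  have "finite P" using inj sub fin finite_imageD finite_subset by blast
  have "card P = card (b ` P)" using inj by (simp add: card_image)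
  also have "\<dots> \<le> card (PiE {..<length ts} (\<lambda>_. {- int (?k + 1)..int ?k}))"
    by (rule card_mono[OF fin sub])
  also have "\<dots> = (2 * ?k + 2) ^ length ts"
  proof -
    have "card {- int (?k + 1)..int ?k} = 2 * ?k + 2" by simp
    then show ?thesis by (simp only: card_PiE finite_lessThan prod_constant card_lessThan)
  qed
  finally show ?thesis using \<open>finite P\<close> by simp
qed

end

end

text \<open>What is retained of commutativity: conjugation distorts lengths linearly, and packing
  numbers depend only on the ratio of the two radii. The second property makes the later bounds
  independent of the scale.\<close>

locale doubling_length = group G for G (structure) +
  fixes A :: "'a set" and len :: "'a \<Rightarrow> nat" and \<delta> :: nat
  assumes normal_A: "A \<lhd> G"
    and len_eq_0: "a \<in> A \<Longrightarrow> len a = 0 \<longleftrightarrow> a = \<one>"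
    and len_mult: "a \<in> A \<Longrightarrow> b \<in> A \<Longrightarrow> len (a \<otimes> b) \<le> len a + len b"
    and len_inv: "a \<in> A \<Longrightarrow> len (inv a) = len a"
    and len_conj_ex: "g \<in> carrier G \<Longrightarrow> \<exists>c. \<forall>a\<in>A. len (g \<otimes> a \<otimes> inv g) \<le> c * len a"
    and packing: "P \<subseteq> A \<Longrightarrow> (\<And>p. p \<in> P \<Longrightarrow> len p \<le> r) \<Longrightarrow>
      (\<And>p p'. p \<in> P \<Longrightarrow> p' \<in> P \<Longrightarrow> p \<noteq> p' \<Longrightarrow> q < len (p' \<otimes> inv p)) \<Longrightarrow>
      finite P \<and> card P \<le> (2 * (r div Suc q) + 2) ^ \<delta>"

lemma (in group) doubling_length_exists:
  assumes A: "A \<lhd> G" and comm: "\<And>a b. a \<in> A \<Longrightarrow> b \<in> A \<Longrightarrow> a \<otimes> b = b \<otimes> a"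
    and T: "finite T" "T \<subseteq> A" "A = generate G T"
  shows "\<exists>len \<delta>. doubling_length G A len \<delta>"
proof -
  let ?H = "G\<lparr>carrier := A\<rparr>"
  interpret A: normal A G by (rule A)
  have sub: "subgroup A G" by (rule A.subgroup_axioms)
  have inv_eq: "inv\<^bsub>?H\<^esub> a = inv a" if "a \<in> A" for a using m_inv_consistent[OF sub that] .
  interpret H: comm_group ?H
    using subgroup_imp_group[OF sub] comm by (intro group.group_comm_groupI) auto
  obtain ts where ts: "set ts = T" using finite_list[OF T(1)] by blast
  have ts1: "set ts \<subseteq> carrier ?H" using ts T by simp
  have ts2: "generate ?H (set ts) = carrier ?H"
    using generate_consistent[OF T(2) sub] ts T by simp
  let ?l = "word_len ?H ts"
  have "doubling_length G A ?l (length ts)"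
  proof (rule doubling_length.intro[OF is_group], rule doubling_length_axioms.intro)
    show "A \<lhd> G" by (rule A)
  next
    fix a assume "a \<in> A" then show "?l a = 0 \<longleftrightarrow> a = \<one>" using H.word_len_eq_0[OF ts1 ts2] by simp
  next
    fix a b assume "a \<in> A" "b \<in> A" then show "?l (a \<otimes> b) \<le> ?l a + ?l b"
      using H.word_len_mult[OF ts1 ts2] by simp
  next
    fix a assume "a \<in> A" then show "?l (inv a) = ?l a" using H.word_len_inv[OF ts1 ts2] inv_eq by simp
  next
    fix g assume g: "g \<in> carrier G"
    have "(\<lambda>a. g \<otimes> a \<otimes> inv g) \<in> hom ?H ?H"
    proof (rule homI)
      fix x assume "x \<in> carrier ?H" then show "g \<otimes> x \<otimes> inv g \<in> carrier ?H"
        using A.inv_op_closed2[OF g] by simp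
    next
      fix x y assume "x \<in> carrier ?H" "y \<in> carrier ?H"
      then have "x \<in> carrier G" "y \<in> carrier G" using A.subset by auto
      then show "g \<otimes> (x \<otimes>\<^bsub>?H\<^esub> y) \<otimes> inv g = (g \<otimes> x \<otimes> inv g) \<otimes>\<^bsub>?H\<^esub> (g \<otimes> y \<otimes> inv g)"
        using g by (simp add: m_assoc inv_solve_left)
    qed
    from H.word_len_hom[OF ts1 ts2 this] show "\<exists>c. \<forall>a\<in>A. ?l (g \<otimes> a \<otimes> inv g) \<le> c * ?l a" by simp
  next
    fix P r q assume "P \<subseteq> A" "\<And>p. p \<in> P \<Longrightarrow> ?l p \<le> r"
      "\<And>p p'. p \<in> P \<Longrightarrow> p' \<in> P \<Longrightarrow> p \<noteq> p' \<Longrightarrow> q < ?l (p' \<otimes> inv p)"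
    then show "finite P \<and> card P \<le> (2 * (r div Suc q) + 2) ^ length ts"
      using inv_eq by (intro H.word_len_packing[OF ts1 ts2]) auto
  qed
  then show ?thesis by blast
qed

section \<open>Nets and ball radii\<close>

context doubling_length
begin

sublocale A: normal A G by (rule normal_A)

text \<open>A distance in the \<open>A\<close>-direction, infinite between different cosets of
  \<open>A\<close>. Right translations are isometries for it; left translation by \<open>g\<close>
  stretches it by the factor \<open>lip g\<close>.\<close>

definition near :: "nat \<Rightarrow> 'a \<Rightarrow> 'a \<Rightarrow> bool" where
  "near k x y \<longleftrightarrow> x \<in> carrier G \<and> y \<in> carrier G \<and> y \<otimes> inv x \<in> A \<and> len (y \<otimes> inv x) \<le> k"

definition lip :: "'a \<Rightarrow> nat" where
  "lip g = (SOME c. \<forall>a\<in>A. len (g \<otimes> a \<otimes> inv g) \<le> c * len a)"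

definition len_ball :: "nat \<Rightarrow> 'a set" where
  "len_ball k = {a \<in> A. len a \<le> k}"

definition net :: "nat \<Rightarrow> 'a set \<Rightarrow> bool" where
  "net n Y \<longleftrightarrow> Y \<subseteq> carrier G \<and> (\<forall>x\<in>Y. \<forall>y\<in>Y. near n x y \<longrightarrow> x = y) \<and> (\<forall>x\<in>carrier G. \<exists>y\<in>Y. near n x y)"

lemma A_carrier [simp]: "a \<in> A \<Longrightarrow> a \<in> carrier G"
  using A.subset by auto

lemma lip: "g \<in> carrier G \<Longrightarrow> a \<in> A \<Longrightarrow> len (g \<otimes> a \<otimes> inv g) \<le> lip g * len a"
  using someI_ex[OF len_conj_ex, of g] unfolding lip_def by blast

lemma near_carrier: "near k x y \<Longrightarrow> x \<in> carrier G" "near k x y \<Longrightarrow> y \<in> carrier G"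
  by (auto simp: near_def)

lemma near_refl: "x \<in> carrier G \<Longrightarrow> near k x x"
  using len_eq_0[of \<one>] by (simp add: near_def)

lemma near_sym: "near k x y \<Longrightarrow> near k y x"
proof -
  assume n: "near k x y"
  then have "inv (y \<otimes> inv x) = x \<otimes> inv y" by (simp add: near_def inv_mult_group)
  moreover have "inv (y \<otimes> inv x) \<in> A" "len (inv (y \<otimes> inv x)) \<le> k" using n len_inv by (auto simp: near_def)
  ultimately show "near k y x" using n by (simp add: near_def)
qed

lemma near_trans: assumes "near j x y" "near k y z" shows "near (j + k) x z"
proof -
  have eq: "z \<otimes> inv x = (z \<otimes> inv y) \<otimes> (y \<otimes> inv x)"
    using assms by (simp add: near_def m_assoc inv_solve_left)
  have "z \<otimes> inv x \<in> A" unfolding eq using assms by (auto simp: near_def)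
  moreover have "len (z \<otimes> inv x) \<le> len (z \<otimes> inv y) + len (y \<otimes> inv x)"
    unfolding eq using assms by (intro len_mult) (auto simp: near_def)
  ultimately show ?thesis using assms by (auto simp: near_def)
qed

lemma near_mono: "near j x y \<Longrightarrow> j \<le> k \<Longrightarrow> near k x y"
  by (auto simp: near_def)

lemma near_translate: assumes "near k x y" "g \<in> carrier G" shows "near (lip g * k) (g \<otimes> x) (g \<otimes> y)"
proof -
  have eq: "(g \<otimes> y) \<otimes> inv (g \<otimes> x) = g \<otimes> (y \<otimes> inv x) \<otimes> inv g"
    using assms by (simp add: near_def m_assoc inv_mult_group)
  have "len (g \<otimes> (y \<otimes> inv x) \<otimes> inv g) \<le> lip g * len (y \<otimes> inv x)"
    using assms by (intro lip) (auto simp: near_def)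
  also have "\<dots> \<le> lip g * k" using assms by (auto simp: near_def)
  finally show ?thesis
    using assms A.inv_op_closed2[of g "y \<otimes> inv x"] unfolding near_def eq by auto
qed

lemma mult_inv_cancel_right:
  "x \<in> carrier G \<Longrightarrow> y \<in> carrier G \<Longrightarrow> g \<in> carrier G \<Longrightarrow> (y \<otimes> g) \<otimes> inv (x \<otimes> g) = y \<otimes> inv x"
  by (simp add: inv_mult_group m_assoc[symmetric]) (simp add: m_assoc)

lemma near_right:
  "x \<in> carrier G \<Longrightarrow> y \<in> carrier G \<Longrightarrow> g \<in> carrier G \<Longrightarrow> near k (x \<otimes> g) (y \<otimes> g) \<longleftrightarrow> near k x y"
  by (simp add: near_def mult_inv_cancel_right)

lemma near_ball: "a \<in> len_ball k \<Longrightarrow> x \<in> carrier G \<Longrightarrow> near k x (a \<otimes> x)"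
  by (simp add: near_def len_ball_def m_assoc)

lemma near_count:
  assumes x: "x \<in> carrier G" and P: "\<And>p. p \<in> P \<Longrightarrow> near r x p"
    and sep: "\<And>p p'. p \<in> P \<Longrightarrow> p' \<in> P \<Longrightarrow> near q p p' \<Longrightarrow> p = p'"
  shows "finite P \<and> card P \<le> (2 * (r div Suc q) + 2) ^ \<delta>"
proof -
  have Pc: "P \<subseteq> carrier G" using P near_carrier by blast
  have inj: "inj_on (\<lambda>p. p \<otimes> inv x) P"
  proof (rule inj_onI)
    fix p p' assume "p \<in> P" "p' \<in> P" "p \<otimes> inv x = p' \<otimes> inv x"
    then show "p = p'" using x Pc right_cancel[of "inv x" p p'] by auto
  qed
  have "finite ((\<lambda>p. p \<otimes> inv x) ` P) \<and> card ((\<lambda>p. p \<otimes> inv x) ` P) \<le> (2 * (r div Suc q) + 2) ^ \<delta>"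
  proof (rule packing)
    show "(\<lambda>p. p \<otimes> inv x) ` P \<subseteq> A" "\<And>p. p \<in> (\<lambda>p. p \<otimes> inv x) ` P \<Longrightarrow> len p \<le> r"
      using P by (auto simp: near_def)
    fix p p' assume "p \<in> (\<lambda>p. p \<otimes> inv x) ` P" "p' \<in> (\<lambda>p. p \<otimes> inv x) ` P" "p \<noteq> p'"
    then obtain y y' where y: "y \<in> P" "y' \<in> P" "p = y \<otimes> inv x" "p' = y' \<otimes> inv x" "y \<noteq> y'" by blast
    have c: "y \<in> carrier G" "y' \<in> carrier G" using y Pc by auto
    have eq: "p' \<otimes> inv p = y' \<otimes> inv y" unfolding y using c x by (intro mult_inv_cancel_right) auto
    have "near (r + r) y y'" using near_trans[OF near_sym[OF P[OF y(1)]] P[OF y(2)]] .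
    then have "y' \<otimes> inv y \<in> A" by (simp add: near_def)
    then show "q < len (p' \<otimes> inv p)"
      unfolding eq using sep[OF y(1,2)] y(5) c by (auto simp: near_def not_less[symmetric])
  qed
  then show ?thesis using inj by (simp add: card_image finite_image_iff)
qed

lemma len_ball_finite: "finite (len_ball k)"
proof -
  have "finite (len_ball k) \<and> card (len_ball k) \<le> (2 * (k div Suc 0) + 2) ^ \<delta>"
  proof (rule packing)
    fix p p' assume "p \<in> len_ball k" "p' \<in> len_ball k" "p \<noteq> p'"
    then have p: "p \<in> A" "p' \<in> A" "p \<noteq> p'" by (auto simp: len_ball_def)
    then have "p' \<otimes> inv p \<noteq> \<one>" using inv_equality[of p' "inv p"] by force
    moreover have "p' \<otimes> inv p \<in> A" using p by simp
    ultimately show "0 < len (p' \<otimes> inv p)" using len_eq_0[of "p' \<otimes> inv p"] by simp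
  qed (auto simp: len_ball_def)
  then show ?thesis by simp
qed

lemma near_finite: "x \<in> carrier G \<Longrightarrow> finite {y. near k x y}"
proof -
  assume x: "x \<in> carrier G"
  have "{y. near k x y} \<subseteq> (\<lambda>a. a \<otimes> x) ` len_ball k"
  proof
    fix y assume "y \<in> {y. near k x y}"
    then have "y \<otimes> inv x \<in> len_ball k" "y = (y \<otimes> inv x) \<otimes> x" using x by (auto simp: near_def len_ball_def m_assoc)
    then show "y \<in> (\<lambda>a. a \<otimes> x) ` len_ball k" by blast
  qed
  then show ?thesis using len_ball_finite finite_subset by blast
qed

lemma near_card: "x \<in> carrier G \<Longrightarrow> card {y. near k x y} \<le> (2 * k + 2) ^ \<delta>"
proof -
  assume x: "x \<in> carrier G"
  have "finite {y. near k x y} \<and> card {y. near k x y} \<le> (2 * (k div Suc 0) + 2) ^ \<delta>"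
  proof (rule near_count[OF x])
    fix p p' assume "near 0 p p'"
    then have "p' \<otimes> inv p = \<one>" "p \<in> carrier G" "p' \<in> carrier G" using len_eq_0 by (auto simp: near_def)
    then show "p = p'" using inv_equality[of p' "inv p"] by simp
  qed auto
  then show ?thesis by simp
qed

text \<open>Points of a net are more than \<open>n\<close> apart, so the ratio entering the packing
  bound is at most \<kappa>, and the scale cancels.\<close>

lemma net_count:
  assumes "net n Y" "x \<in> carrier G"
  shows "finite {y \<in> Y. near (\<kappa> * n) x y}" "card {y \<in> Y. near (\<kappa> * n) x y} \<le> (2 * \<kappa> + 2) ^ \<delta>"
proof -
  have "finite {y \<in> Y. near (\<kappa> * n) x y} \<and> card {y \<in> Y. near (\<kappa> * n) x y} \<le> (2 * (\<kappa> * n div Suc n) + 2) ^ \<delta>"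
    by (rule near_count[OF assms(2)]) (use assms(1) in \<open>auto simp: net_def\<close>)
  moreover have "\<kappa> * n div Suc n \<le> \<kappa>"
  proof -
    have "\<kappa> * n div Suc n \<le> \<kappa> * Suc n div Suc n" by (rule div_le_mono) simp
    then show ?thesis by (metis div_mult_self_is_m zero_less_Suc)
  qed
  then have "(2 * (\<kappa> * n div Suc n) + 2) ^ \<delta> \<le> (2 * \<kappa> + 2) ^ \<delta>" by (intro power_mono) auto
  ultimately show "finite {y \<in> Y. near (\<kappa> * n) x y}" "card {y \<in> Y. near (\<kappa> * n) x y} \<le> (2 * \<kappa> + 2) ^ \<delta>"
    by auto
qed

lemma net_count_UN:
  assumes "net n Y" "x \<in> carrier G" "finite U" "U \<subseteq> carrier G"
  shows "finite {y \<in> Y. \<exists>u\<in>U. near (\<kappa> * n) (u \<otimes> x) y}"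
    "card {y \<in> Y. \<exists>u\<in>U. near (\<kappa> * n) (u \<otimes> x) y} \<le> card U * (2 * \<kappa> + 2) ^ \<delta>"
proof -
  have eq: "{y \<in> Y. \<exists>u\<in>U. near (\<kappa> * n) (u \<otimes> x) y} = (\<Union>u\<in>U. {y \<in> Y. near (\<kappa> * n) (u \<otimes> x) y})" by auto
  show "finite {y \<in> Y. \<exists>u\<in>U. near (\<kappa> * n) (u \<otimes> x) y}"
    unfolding eq using assms net_count[OF assms(1)] by (intro finite_UN_I) auto
  have "card (\<Union>u\<in>U. {y \<in> Y. near (\<kappa> * n) (u \<otimes> x) y}) \<le> (\<Sum>u\<in>U. card {y \<in> Y. near (\<kappa> * n) (u \<otimes> x) y})"
    by (rule card_UN_le[OF assms(3)])
  also have "\<dots> \<le> (\<Sum>u\<in>U. (2 * \<kappa> + 2) ^ \<delta>)"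
    by (rule sum_mono, rule net_count[OF assms(1)]) (use assms in auto)
  finally show "card {y \<in> Y. \<exists>u\<in>U. near (\<kappa> * n) (u \<otimes> x) y} \<le> card U * (2 * \<kappa> + 2) ^ \<delta>"
    unfolding eq by simp
qed

text \<open>A greedy maximal independent set with the colors as ranks: a position joins unless a
  neighbor of smaller color has joined. Properness along \<open>len_ball n\<close> makes the ranks
  of any two neighbors different, so one of them always sees the other.\<close>

lemma net_exists:
  obtains \<Phi> where "local_fun G \<Phi>"
    "\<And>\<omega>. proper_coloring G (carrier G) (len_ball n) N \<omega> \<Longrightarrow> net n {g \<in> carrier G. \<Phi> (shift G g \<omega>)}"
proof -
  define T :: "('a \<Rightarrow> nat) \<Rightarrow> ('a \<Rightarrow> bool option) \<Rightarrow> bool"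
    where "T = (\<lambda>\<omega> u. \<forall>v\<in>len_ball n - {\<one>}. u v \<noteq> Some True)"
  have r: "local_fun G (\<lambda>\<omega>. \<omega> \<one>)" and T: "local_fun G T" unfolding T_def by auto
  have V: "finite (len_ball n)" "len_ball n \<subseteq> carrier G" using len_ball_finite by (auto simp: len_ball_def)
  obtain \<Phi> where \<Phi>: "local_fun G \<Phi>"
    "\<And>\<omega>. \<omega> \<one> < N \<Longrightarrow> \<Phi> \<omega> = T \<omega> (\<lambda>v. if v \<in> len_ball n \<and> shift G v \<omega> \<one> < \<omega> \<one> then Some (\<Phi> (shift G v \<omega>)) else None)"
    using local_greedy[OF r T V, of N] by blast
  show ?thesis
  proof (rule that[OF \<Phi>(1)])
    fix \<omega> assume p: "proper_coloring G (carrier G) (len_ball n) N \<omega>"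
    let ?Y = "{g \<in> carrier G. \<Phi> (shift G g \<omega>)}"
    have eq: "\<Phi> (shift G g \<omega>) \<longleftrightarrow> (\<forall>v\<in>len_ball n - {\<one>}. \<omega> (v \<otimes> g) < \<omega> g \<longrightarrow> \<not> \<Phi> (shift G (v \<otimes> g) \<omega>))"
      if g: "g \<in> carrier G" for g
    proof -
      have "shift G g \<omega> \<one> < N" using p g by (simp add: proper_coloring_def shift_def)
      from \<Phi>(2)[of "shift G g \<omega>", OF this] show ?thesis
        using g V by (auto simp: T_def shift_apply shift_shift subset_iff)
    qed
    have diff: "\<omega> (v \<otimes> g) \<noteq> \<omega> g" if "v \<in> len_ball n" "v \<noteq> \<one>" "g \<in> carrier G" for v g
      using p that by (auto simp: proper_coloring_def)
    have less: "\<omega> y < \<omega> x \<Longrightarrow> False" if "x \<in> ?Y" "y \<in> ?Y" "near n x y" "x \<noteq> y" for x y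
    proof -
      assume l: "\<omega> y < \<omega> x"
      have v: "y \<otimes> inv x \<in> len_ball n" "(y \<otimes> inv x) \<otimes> x = y" "y \<otimes> inv x \<noteq> \<one>"
        using that inv_equality[of y "inv x"] by (auto simp: near_def len_ball_def m_assoc)
      have "\<Phi> (shift G x \<omega>)" "\<Phi> (shift G y \<omega>)" "x \<in> carrier G" using that by auto
      then have "\<not> \<Phi> (shift G ((y \<otimes> inv x) \<otimes> x) \<omega>)" using eq[of x] v l by (metis DiffI singletonD)
      then show False using v \<open>\<Phi> (shift G y \<omega>)\<close> by simp
    qed
    show "net n ?Y" unfolding net_def
    proof (intro conjI ballI impI)
      fix x y assume xy: "x \<in> ?Y" "y \<in> ?Y" "near n x y"
      show "x = y"
      proof (rule ccontr)
        assume ne: "x \<noteq> y"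
        have v: "y \<otimes> inv x \<in> len_ball n" "(y \<otimes> inv x) \<otimes> x = y" "y \<otimes> inv x \<noteq> \<one>"
          using xy ne inv_equality[of y "inv x"] by (auto simp: near_def len_ball_def m_assoc)
        then have "\<omega> y \<noteq> \<omega> x" using diff[of "y \<otimes> inv x" x] xy by auto
        then show False using less[OF xy ne] less[OF xy(2,1) near_sym[OF xy(3)]] ne by (metis linorder_neqE_nat)
      qed
    next
      fix x assume x: "x \<in> carrier G"
      show "\<exists>y\<in>?Y. near n x y"
      proof (cases "\<Phi> (shift G x \<omega>)")
        case True
        then show ?thesis using x near_refl by blast
      next
        case False
        then obtain v where "v \<in> len_ball n" "\<Phi> (shift G (v \<otimes> x) \<omega>)" using eq[OF x] by blast
        then show ?thesis using near_ball[of v n x] x V by (intro bexI[of _ "v \<otimes> x"]) auto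
      qed
    qed auto
  qed
qed

end

section \<open>Colorings of nets with a number of colors independent of the scale\<close>

lemma Least_avoid_le_card:
  fixes B :: "nat set"
  assumes "finite B"
  shows "(LEAST k. k \<notin> B) \<notin> B" "(LEAST k. k \<notin> B) \<le> card B"
proof -
  have "\<exists>k. k \<notin> B" using ex_new_if_finite[OF infinite_UNIV_nat assms] .
  then show "(LEAST k. k \<notin> B) \<notin> B" by (rule LeastI_ex)
  have "{..<(LEAST k. k \<notin> B)} \<subseteq> B" using not_less_Least by auto
  from card_mono[OF assms this] show "(LEAST k. k \<notin> B) \<le> card B" by simp
qed

lemma card_Un_le_add:
  assumes "A \<subseteq> B \<union> C" "finite B" "finite C" "card B \<le> (b::nat)" "card C \<le> c"
  shows "finite A \<and> card A \<le> b + c"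
proof
  show "finite A" using assms(1-3) finite_subset by blast
  have "card A \<le> card (B \<union> C)" using assms by (intro card_mono) auto
  also have "\<dots> \<le> card B + card C" by (rule card_Un_le)
  finally show "card A \<le> b + c" using assms by linarith
qed

context doubling_length
begin

definition hubs :: "(('a \<Rightarrow> nat) \<Rightarrow> bool) \<Rightarrow> ('a \<Rightarrow> nat) \<Rightarrow> 'a set" where
  "hubs \<Phi> \<omega> = {g \<in> carrier G. \<Phi> (shift G g \<omega>)}"

text \<open>Hubs in different cosets of \<open>A\<close> are never \<open>near\<close> each other;
  the translations in \<open>U\<close> carry one coset to another so that distances can be
  compared.\<close>

definition hub_proper :: "'a set \<Rightarrow> nat \<Rightarrow> 'a set \<Rightarrow> ('a \<Rightarrow> nat) \<Rightarrow> bool" where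
  "hub_proper U k Y c \<longleftrightarrow> (\<forall>y\<in>Y. \<forall>y'\<in>Y. \<forall>u\<in>U. y \<noteq> y' \<and> near k (u \<otimes> y) y' \<longrightarrow> c y \<noteq> c y')"

definition hub_colorable :: "'a set \<Rightarrow> nat \<Rightarrow> nat \<Rightarrow> nat \<Rightarrow> 'a set \<Rightarrow> bool" where
  "hub_colorable U \<kappa> n D F \<longleftrightarrow> (\<forall>N \<Phi>. local_fun G \<Phi> \<longrightarrow>
    (\<exists>c. local_fun G c \<and> (\<forall>\<omega>. c \<omega> \<le> D) \<and>
      (\<forall>\<omega>. proper_coloring G (carrier G) F N \<omega> \<and> net n (hubs \<Phi> \<omega>) \<longrightarrow>
         hub_proper U (\<kappa> * n) (hubs \<Phi> \<omega>) (\<lambda>y. c (shift G y \<omega>)))))"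

lemma hub_colorableD:
  assumes "hub_colorable U \<kappa> n D F" "local_fun G \<Phi>"
  shows "\<exists>c. local_fun G c \<and> (\<forall>\<omega>. c \<omega> \<le> D) \<and>
      (\<forall>\<omega>. proper_coloring G (carrier G) F N \<omega> \<and> net n (hubs \<Phi> \<omega>) \<longrightarrow>
         hub_proper U (\<kappa> * n) (hubs \<Phi> \<omega>) (\<lambda>y. c (shift G y \<omega>)))"
  using assms(1)[unfolded hub_colorable_def, THEN spec, THEN spec, THEN mp, OF assms(2)] .

text \<open>The number of colors must not depend on the scale \<open>n\<close>: the extension step fixes it before \<open>n\<close>.\<close>

lemma hub_coloring:
  assumes U: "finite U" "U \<subseteq> carrier G"
  obtains D where "\<And>n. \<exists>F. finite F \<and> F \<subseteq> carrier G \<and> hub_colorable U \<kappa> n D F"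
proof -
  \<comment> \<open>Conflicts are directed. If \<open>y'\<close> is near
    \<open>u \<otimes> y\<close>, then from the side of \<open>y'\<close> the hub \<open>y\<close>
    is near \<open>inv u \<otimes> y'\<close>, at a distance stretched by
    \<open>lip (inv u)\<close>. The two summands of \<open>D\<close> bound the conflicts in the two
    directions.\<close>
  define \<mu> where "\<mu> = (\<Sum>u\<in>U. lip (inv u))"
  define D where "D = card U * (2 * \<kappa> + 2) ^ \<delta> + card U * (2 * (\<mu> * \<kappa>) + 2) ^ \<delta>"
  have "\<exists>F. finite F \<and> F \<subseteq> carrier G \<and> hub_colorable U \<kappa> n D F" for n
  proof -
    \<comment> \<open>The steps from a hub to the hubs it conflicts with. Closing under inverses
      lets the hub of larger rank see the other one, whichever way the conflict points.\<close>
    define V1 where "V1 = (\<Union>u\<in>U. (\<lambda>a. a \<otimes> u) ` len_ball (\<kappa> * n))"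
    define V where "V = V1 \<union> (\<lambda>v. inv v) ` V1"
    have V: "finite V" "V \<subseteq> carrier G"
      using U len_ball_finite by (auto simp: V_def V1_def len_ball_def)
    have V_inv: "inv v \<in> V" if "v \<in> V" for v
    proof (cases "v \<in> V1")
      case True
      then show ?thesis by (simp add: V_def)
    next
      case False
      then obtain v' where "v' \<in> V1" "v = inv v'" using \<open>v \<in> V\<close> by (auto simp: V_def)
      moreover have "v' \<in> carrier G" using \<open>v' \<in> V1\<close> V by (auto simp: V_def)
      ultimately show ?thesis by (simp add: V_def)
    qed
    have main: "\<exists>c. local_fun G c \<and> (\<forall>\<omega>. c \<omega> \<le> D) \<and>
      (\<forall>\<omega>. proper_coloring G (carrier G) V N \<omega> \<and> net n (hubs \<Phi> \<omega>) \<longrightarrow>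
         hub_proper U (\<kappa> * n) (hubs \<Phi> \<omega>) (\<lambda>y. c (shift G y \<omega>)))" if lcl: "local_fun G \<Phi>" for N \<Phi>
    proof -
      define T :: "('a \<Rightarrow> nat) \<Rightarrow> ('a \<Rightarrow> nat option) \<Rightarrow> nat" where
        "T = (\<lambda>\<omega> u. LEAST k. k \<notin> {k. \<exists>v\<in>V - {\<one>}. \<Phi> (shift G v \<omega>) \<and> u v = Some k})"
      have r: "local_fun G (\<lambda>\<omega>. \<omega> \<one>)" by auto
      have T: "local_fun G T"
      proof (rule local_fun_family[where V = V and \<Phi> = "\<lambda>v \<omega>. \<Phi> (shift G v \<omega>)"])
        show "T \<omega> = T \<omega>'" if "\<And>v. v \<in> V \<Longrightarrow> \<Phi> (shift G v \<omega>) = \<Phi> (shift G v \<omega>')" for \<omega> \<omega>'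
          unfolding T_def using that by (intro ext arg_cong[where f = Least]) auto
      qed (use V lcl local_fun_shift in auto)
      obtain c where c: "local_fun G c"
        "\<And>\<omega>. \<omega> \<one> < N \<Longrightarrow> c \<omega> = T \<omega> (\<lambda>v. if v \<in> V \<and> shift G v \<omega> \<one> < \<omega> \<one> then Some (c (shift G v \<omega>)) else None)"
        using local_greedy[OF r T V, of N] by blast
      \<comment> \<open>The degree bound is available only at hubs of a net in a proper coloring;
        truncation makes the bound on the colors universal and changes nothing at those
        hubs.\<close>
      define c' where "c' \<omega> = min D (c \<omega>)" for \<omega>
      have "hub_proper U (\<kappa> * n) (hubs \<Phi> \<omega>) (\<lambda>y. c' (shift G y \<omega>))"
        if p: "proper_coloring G (carrier G) V N \<omega>" and nt: "net n (hubs \<Phi> \<omega>)" for \<omega>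
      proof -
        let ?Y = "hubs \<Phi> \<omega>"
        let ?B = "\<lambda>g. {k. \<exists>v\<in>V - {\<one>}. v \<otimes> g \<in> ?Y \<and> \<omega> (v \<otimes> g) < \<omega> g \<and> c (shift G (v \<otimes> g) \<omega>) = k}"
        have eq: "c (shift G g \<omega>) = (LEAST k. k \<notin> ?B g)" if g: "g \<in> carrier G" for g
        proof -
          have "shift G g \<omega> \<one> < N" using p g by (simp add: proper_coloring_def shift_def)
          note e = c(2)[of "shift G g \<omega>", OF this]
          show ?thesis
            unfolding e T_def using g V
            by (intro arg_cong[where f = Least]) (auto simp: shift_apply shift_shift subset_iff hubs_def split: if_splits)
        qed
        have Bcard: "finite (?B g) \<and> card (?B g) \<le> D" if g: "g \<in> ?Y" for g
        proof -
          have gc: "g \<in> carrier G" using g by (simp add: hubs_def)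
          let ?N1 = "{y \<in> ?Y. \<exists>u\<in>U. near (\<kappa> * n) (u \<otimes> g) y}"
          let ?N2 = "{y \<in> ?Y. \<exists>u\<in>(\<lambda>u. inv u) ` U. near (\<mu> * \<kappa> * n) (u \<otimes> g) y}"
          have sub: "(\<lambda>v. v \<otimes> g) ` {v \<in> V. v \<otimes> g \<in> ?Y} \<subseteq> ?N1 \<union> ?N2"
          proof (rule image_subsetI)
            fix v assume v: "v \<in> {v \<in> V. v \<otimes> g \<in> ?Y}"
            have vc: "v \<in> carrier G" using v V by auto
            show "v \<otimes> g \<in> ?N1 \<union> ?N2"
            proof (cases "v \<in> V1")
              case True
              then obtain u a where u: "u \<in> U" "a \<in> len_ball (\<kappa> * n)" "v = a \<otimes> u" by (auto simp: V1_def)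
              have uc: "u \<in> carrier G" "a \<in> carrier G" using u U by (auto simp: len_ball_def)
              have "near (\<kappa> * n) (u \<otimes> g) (a \<otimes> (u \<otimes> g))" using u uc gc by (intro near_ball) auto
              then have "near (\<kappa> * n) (u \<otimes> g) (v \<otimes> g)" using u uc gc by (simp add: m_assoc)
              then show ?thesis using v u by blast
            next
              case False
              then obtain v' where v': "v' \<in> V1" "v = inv v'" using v by (auto simp: V_def)
              then obtain u a where u: "u \<in> U" "a \<in> len_ball (\<kappa> * n)" "v' = a \<otimes> u" by (auto simp: V1_def)
              have uc: "u \<in> carrier G" "a \<in> carrier G" using u U by (auto simp: len_ball_def)
              have "near (\<kappa> * n) (u \<otimes> (v \<otimes> g)) (a \<otimes> (u \<otimes> (v \<otimes> g)))"
                using u uc gc vc by (intro near_ball) auto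
              moreover have "a \<otimes> (u \<otimes> (v \<otimes> g)) = g"
              proof -
                have "a \<otimes> (u \<otimes> (v \<otimes> g)) = v' \<otimes> (inv v' \<otimes> g)" using u uc gc vc v' by (simp add: m_assoc)
                also have "\<dots> = g" using uc gc u by (simp add: inv_solve_left' m_assoc[symmetric])
                finally show ?thesis .
              qed
              ultimately have "near (\<kappa> * n) (u \<otimes> (v \<otimes> g)) g" by simp
              from near_translate[OF this, of "inv u"]
              have "near (lip (inv u) * (\<kappa> * n)) (inv u \<otimes> (u \<otimes> (v \<otimes> g))) (inv u \<otimes> g)" using uc by simp
              moreover have "inv u \<otimes> (u \<otimes> (v \<otimes> g)) = v \<otimes> g" using uc vc gc by (simp add: m_assoc[symmetric])
              ultimately have "near (lip (inv u) * (\<kappa> * n)) (inv u \<otimes> g) (v \<otimes> g)" using near_sym by simp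
              moreover have "lip (inv u) \<le> \<mu>" unfolding \<mu>_def using u U by (intro member_le_sum) auto
              ultimately have "near (\<mu> * \<kappa> * n) (inv u \<otimes> g) (v \<otimes> g)"
                by (elim near_mono) (simp add: mult.assoc mult_le_mono1)
              then show ?thesis using v u by blast
            qed
          qed
          have N1: "finite ?N1" "card ?N1 \<le> card U * (2 * \<kappa> + 2) ^ \<delta>"
            using net_count_UN[OF nt gc U] by auto
          have U': "finite ((\<lambda>u. inv u) ` U)" "(\<lambda>u. inv u) ` U \<subseteq> carrier G" using U by auto
          have N2: "finite ?N2" "card ?N2 \<le> card U * (2 * (\<mu> * \<kappa>) + 2) ^ \<delta>"
            using net_count_UN[OF nt gc U', of "\<mu> * \<kappa>"] card_image_le[OF U(1), of "\<lambda>u. inv u"]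
            by (auto intro: order_trans mult_le_mono1)
          have im: "finite ((\<lambda>v. v \<otimes> g) ` {v \<in> V. v \<otimes> g \<in> ?Y}) \<and> card ((\<lambda>v. v \<otimes> g) ` {v \<in> V. v \<otimes> g \<in> ?Y}) \<le> D"
            unfolding D_def by (rule card_Un_le_add[OF sub N1(1) N2(1) N1(2) N2(2)])
          have B: "?B g \<subseteq> (\<lambda>y. c (shift G y \<omega>)) ` ((\<lambda>v. v \<otimes> g) ` {v \<in> V. v \<otimes> g \<in> ?Y})" by auto
          then have "card (?B g) \<le> card ((\<lambda>y. c (shift G y \<omega>)) ` ((\<lambda>v. v \<otimes> g) ` {v \<in> V. v \<otimes> g \<in> ?Y}))"
            using im by (intro card_mono) auto
          also have "\<dots> \<le> card ((\<lambda>v. v \<otimes> g) ` {v \<in> V. v \<otimes> g \<in> ?Y})" using im by (intro card_image_le) auto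
          finally show ?thesis using im finite_subset[OF B finite_imageI] by linarith
        qed
        have small: "c' (shift G g \<omega>) = c (shift G g \<omega>)" if "g \<in> ?Y" for g
        proof -
          have gc: "g \<in> carrier G" using that by (simp add: hubs_def)
          have "(LEAST k. k \<notin> ?B g) \<le> D"
            using Bcard[OF that] Least_avoid_le_card(2)[of "?B g"] by linarith
          then have "c (shift G g \<omega>) \<le> D" by (simp only: eq[OF gc])
          then show ?thesis by (simp add: c'_def)
        qed
        have avoid: "c (shift G g \<omega>) \<noteq> c (shift G (v \<otimes> g) \<omega>)"
          if "g \<in> ?Y" "v \<in> V" "v \<noteq> \<one>" "v \<otimes> g \<in> ?Y" "\<omega> (v \<otimes> g) < \<omega> g" for g v
        proof -
          have gc: "g \<in> carrier G" using that by (simp add: hubs_def)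
          have "(LEAST k. k \<notin> ?B g) \<notin> ?B g"
            by (rule Least_avoid_le_card(1)) (rule Bcard[OF that(1), THEN conjunct1])
          then have "c (shift G g \<omega>) \<notin> ?B g" by (rule ssubst[OF eq[OF gc], where P = "\<lambda>k. k \<notin> ?B g"])
          moreover have "c (shift G (v \<otimes> g) \<omega>) \<in> ?B g"
            by (rule CollectI, rule bexI[of _ v]) (use that in auto)
          ultimately show ?thesis by metis
        qed
        show ?thesis unfolding hub_proper_def
        proof (intro ballI impI)
          fix y y' u assume a: "y \<in> ?Y" "y' \<in> ?Y" "u \<in> U" "y \<noteq> y' \<and> near (\<kappa> * n) (u \<otimes> y) y'"
          have cc: "y \<in> carrier G" "y' \<in> carrier G" "u \<in> carrier G" using a U by (auto simp: hubs_def)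
          define v where "v = y' \<otimes> inv y"
          have vy: "v \<otimes> y = y'" "inv v \<otimes> y' = y" "v \<in> carrier G"
            using cc by (simp_all add: v_def m_assoc inv_mult_group)
          have "v = (y' \<otimes> inv (u \<otimes> y)) \<otimes> u" using cc by (simp add: v_def inv_mult_group m_assoc)
          then have "v \<in> V1" using a unfolding V1_def by (auto simp: near_def len_ball_def)
          then have v: "v \<in> V" "inv v \<in> V" using V_inv by (auto simp: V_def)
          have v1: "v \<noteq> \<one>" "inv v \<noteq> \<one>" using vy a cc by auto
          have "\<omega> (v \<otimes> y) \<noteq> \<omega> y" using p v v1 cc by (auto simp: proper_coloring_def)
          then have "c (shift G y \<omega>) \<noteq> c (shift G y' \<omega>)"
            using avoid[of y v] avoid[of y' "inv v"] v v1 vy a by (metis linorder_neqE_nat)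
          then show "c' (shift G y \<omega>) \<noteq> c' (shift G y' \<omega>)" using small a by simp
        qed
      qed
      moreover have "local_fun G c'" unfolding c'_def by (rule local_fun_comp[OF c(1)])
      ultimately show ?thesis by (intro exI[of _ c']) (auto simp: c'_def)
    qed
    have "hub_colorable U \<kappa> n D V" unfolding hub_colorable_def by (intro allI impI main)
    then show ?thesis using V by blast
  qed
  then show ?thesis using that by blast
qed

section \<open>Radii such that few thickened spheres meet near any position\<close>

definition thick :: "nat \<Rightarrow> nat \<Rightarrow> 'a \<Rightarrow> 'a \<Rightarrow> bool" where
  "thick w r y p \<longleftrightarrow> y \<in> carrier G \<and> p \<in> carrier G \<and> p \<otimes> inv y \<in> A \<and>
     r \<le> len (p \<otimes> inv y) + w \<and> len (p \<otimes> inv y) \<le> r + w"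

text \<open>The positions from which the ball about \<open>y\<close> is visible through the window
  \<open>R\<close>, hence those whose crossings the radius of \<open>y\<close> can affect.\<close>

definition zone :: "nat \<Rightarrow> 'a set \<Rightarrow> 'a \<Rightarrow> 'a set" where
  "zone k R y = {x \<in> carrier G. \<exists>t\<in>R. near k (t \<otimes> x) y}"

definition crossings :: "'a set \<Rightarrow> nat \<Rightarrow> 'a set \<Rightarrow> ('a \<Rightarrow> nat) \<Rightarrow> 'a \<Rightarrow> ('a \<times> 'a) set" where
  "crossings R w Y \<rho> x = {(t, y). t \<in> R \<and> y \<in> Y \<and> thick w (\<rho> y) y (t \<otimes> x)}"

definition few_crossings :: "'a set \<Rightarrow> nat \<Rightarrow> 'a set \<Rightarrow> ('a \<Rightarrow> nat) \<Rightarrow> bool" where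
  "few_crossings R w Y \<rho> \<longleftrightarrow>
     (\<forall>x\<in>carrier G. finite (crossings R w Y \<rho> x) \<and> card (crossings R w Y \<rho> x) \<le> \<delta>)"

definition radii_choosable :: "'a set \<Rightarrow> nat \<Rightarrow> nat \<Rightarrow> 'a set \<Rightarrow> bool" where
  "radii_choosable R w n F \<longleftrightarrow> (\<forall>N \<Phi>. local_fun G \<Phi> \<longrightarrow>
    (\<exists>\<rho>. local_fun G \<rho> \<and> (\<forall>\<omega>. n \<le> \<rho> \<omega> \<and> \<rho> \<omega> \<le> 2 * n) \<and>
      (\<forall>\<omega>. proper_coloring G (carrier G) F N \<omega> \<and> net n (hubs \<Phi> \<omega>) \<longrightarrow>
         few_crossings R w (hubs \<Phi> \<omega>) (\<lambda>y. \<rho> (shift G y \<omega>)))))"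

lemma radii_choosableD:
  assumes "radii_choosable R w n F" "local_fun G \<Phi>"
  shows "\<exists>\<rho>. local_fun G \<rho> \<and> (\<forall>\<omega>. n \<le> \<rho> \<omega> \<and> \<rho> \<omega> \<le> 2 * n) \<and>
      (\<forall>\<omega>. proper_coloring G (carrier G) F N \<omega> \<and> net n (hubs \<Phi> \<omega>) \<longrightarrow>
         few_crossings R w (hubs \<Phi> \<omega>) (\<lambda>y. \<rho> (shift G y \<omega>)))"
  using assms(1)[unfolded radii_choosable_def, THEN spec, THEN spec, THEN mp, OF assms(2)] .

text \<open>The positions whose weight is multiplied if the hub \<open>y\<close> takes the radius
  \<open>r\<close>.\<close>

definition hit :: "nat \<Rightarrow> 'a set \<Rightarrow> nat \<Rightarrow> nat \<Rightarrow> 'a \<Rightarrow> 'a set" where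
  "hit k R w r y = {x \<in> zone k R y. \<exists>t\<in>R. thick w r y (t \<otimes> x)}"

lemma zone_finite_card:
  assumes "finite R" "R \<subseteq> carrier G" "y \<in> carrier G"
  shows "finite (zone k R y)" "card (zone k R y) \<le> card R * (2 * k + 2) ^ \<delta>"
proof -
  have sub: "zone k R y \<subseteq> (\<Union>t\<in>R. (\<lambda>p. inv t \<otimes> p) ` {p. near k y p})"
  proof
    fix x assume "x \<in> zone k R y"
    then obtain t where t: "x \<in> carrier G" "t \<in> R" "near k y (t \<otimes> x)" using near_sym by (auto simp: zone_def)
    have "x = inv t \<otimes> (t \<otimes> x)" using t assms by (simp add: m_assoc[symmetric] subset_iff)
    then show "x \<in> (\<Union>t\<in>R. (\<lambda>p. inv t \<otimes> p) ` {p. near k y p})" using t by blast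
  qed
  have fin: "finite (\<Union>t\<in>R. (\<lambda>p. inv t \<otimes> p) ` {p. near k y p})"
    using assms near_finite by auto
  show "finite (zone k R y)" using sub fin finite_subset by blast
  have "card (zone k R y) \<le> card (\<Union>t\<in>R. (\<lambda>p. inv t \<otimes> p) ` {p. near k y p})"
    by (rule card_mono[OF fin sub])
  also have "\<dots> \<le> (\<Sum>t\<in>R. card ((\<lambda>p. inv t \<otimes> p) ` {p. near k y p}))"
    by (rule card_UN_le[OF assms(1)])
  also have "\<dots> \<le> (\<Sum>t\<in>R. (2 * k + 2) ^ \<delta>)"
  proof (rule sum_mono)
    fix t assume "t \<in> R"
    have "card ((\<lambda>p. inv t \<otimes> p) ` {p. near k y p}) \<le> card {p. near k y p}"
      by (rule card_image_le[OF near_finite[OF assms(3)]])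
    then show "card ((\<lambda>p. inv t \<otimes> p) ` {p. near k y p}) \<le> (2 * k + 2) ^ \<delta>"
      using near_card[OF assms(3), of k] by linarith
  qed
  finally show "card (zone k R y) \<le> card R * (2 * k + 2) ^ \<delta>" by simp
qed

text \<open>Each new crossing multiplies the weight of a point by \<open>m\<close>, while the greedy choice keeps the
  total weight of a zone below a constant times \<open>m ^ \<delta>\<close>; hence no point has more than \<open>\<delta>\<close> crossings.\<close>

lemma crossings_bound:
  fixes c \<rho> :: "'a \<Rightarrow> nat"
  assumes Y: "net n Y" and R: "finite R" "R \<subseteq> carrier G"
    and R_dist: "\<And>t t'. t \<in> R \<Longrightarrow> t' \<in> R \<Longrightarrow> t' \<otimes> inv t \<in> A \<Longrightarrow> t = t'"
    and \<rho>: "\<And>y. y \<in> Y \<Longrightarrow> \<rho> y \<le> 2 * n" and n: "n = (2 * w + 1) * m" and "0 < m"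
    and U: "U = (\<lambda>(t, t'). t' \<otimes> inv t) ` (R \<times> R)" and \<kappa>: "\<And>u. u \<in> U \<Longrightarrow> 3 * lip u + 3 \<le> \<kappa>"
    and c: "hub_proper U (\<kappa> * n) Y c" "\<And>y. y \<in> Y \<Longrightarrow> c y < D"
    and greedy: "\<And>y. y \<in> Y \<Longrightarrow>
      m * (\<Sum>x\<in>hit (3 * n) R w (\<rho> y) y. m ^ card (crossings R w {z\<in>Y. c z < c y} \<rho> x))
        \<le> (\<Sum>x\<in>zone (3 * n) R y. m ^ card (crossings R w {z\<in>Y. c z < c y} \<rho> x))"
    and m: "card R * (8 * (2 * w + 1)) ^ \<delta> * (1 + card U * (2 * \<kappa> + 2) ^ \<delta>) ^ D < m"
    and x0: "x0 \<in> carrier G"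
  shows "finite (crossings R w Y \<rho> x0) \<and> card (crossings R w Y \<rho> x0) \<le> \<delta>"
proof -
  let ?Z = "zone (3 * n) R"
  define cr where "cr k x = crossings R w {z\<in>Y. c z < k} \<rho> x" for k x
  \<comment> \<open>\<open>E\<close> bounds the number of hubs whose zones meet a given zone;
    \<open>C0 * m ^ \<delta>\<close> bounds the size of a zone.\<close>
  define E where "E = card U * (2 * \<kappa> + 2) ^ \<delta>"
  define C0 where "C0 = card R * (8 * (2 * w + 1)) ^ \<delta>"
  have Yc: "Y \<subseteq> carrier G" using Y by (simp add: net_def)
  have "(2 * w + 1) * 1 \<le> n" unfolding n using \<open>0 < m\<close> by (intro mult_le_mono2) simp
  then have n1: "1 \<le> n" "w \<le> n" by simp_all
  have Uc: "finite U" "U \<subseteq> carrier G" using R U by auto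
  \<comment> \<open>The radius \<open>3 * n\<close> of zones comes from here: radii are at most
    \<open>2 * n\<close>, and the thickness \<open>w\<close> is at most \<open>n\<close>.\<close>
  have in_zone: "x \<in> ?Z y" if "t \<in> R" "y \<in> Y" "x \<in> carrier G" "thick w (\<rho> y) y (t \<otimes> x)" for t x y
  proof -
    have "near (3 * n) y (t \<otimes> x)" using that \<rho>[OF that(2)] n1 by (auto simp: thick_def near_def)
    then show ?thesis using that near_sym by (auto simp: zone_def)
  qed
  \<comment> \<open>A common position \<open>x\<close> has \<open>t \<otimes> x\<close> near
    \<open>y\<close> and \<open>t' \<otimes> x\<close> near \<open>y'\<close>. Translation by
    \<open>t' \<otimes> inv t\<close> stretches the first distance and leaves the second, whence
    \<open>3 * lip u + 3\<close>.\<close>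
  have conflict: "\<exists>u\<in>U. near (\<kappa> * n) (u \<otimes> y) y'" if xz: "x \<in> ?Z y" "x \<in> ?Z y'" "y \<in> carrier G" for x y y'
  proof -
    obtain t t' where t: "x \<in> carrier G" "t \<in> R" "t' \<in> R" "near (3 * n) (t \<otimes> x) y" "near (3 * n) (t' \<otimes> x) y'"
      using xz(1,2) unfolding zone_def by blast
    let ?u = "t' \<otimes> inv t"
    have tc: "t \<in> carrier G" "t' \<in> carrier G" using t R by auto
    have u: "?u \<in> U" using t U by auto
    have "near (lip ?u * (3 * n)) (?u \<otimes> (t \<otimes> x)) (?u \<otimes> y)" using near_translate[OF t(4)] tc by simp
    moreover have "?u \<otimes> (t \<otimes> x) = t' \<otimes> x" using tc t by (simp add: m_assoc) (simp add: m_assoc[symmetric])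
    ultimately have "near (lip ?u * (3 * n)) (?u \<otimes> y) (t' \<otimes> x)" using near_sym by simp
    from near_trans[OF this t(5)] have "near (lip ?u * (3 * n) + 3 * n) (?u \<otimes> y) y'" .
    moreover have "lip ?u * (3 * n) + 3 * n = (3 * lip ?u + 3) * n" by (simp add: algebra_simps)
    ultimately have "near (\<kappa> * n) (?u \<otimes> y) y'" using \<kappa>[OF u] near_mono mult_le_mono1 by metis
    then show ?thesis using u by blast
  qed
  have sep: "c y \<noteq> c y'" if "x \<in> ?Z y" "x \<in> ?Z y'" "y \<in> Y" "y' \<in> Y" "y \<noteq> y'" for x y y'
    using conflict[OF that(1,2)] that c(1) Yc unfolding hub_proper_def by blast
  have fin_cr: "finite (crossings R w Y \<rho> x)" if "x \<in> carrier G" for x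
  proof -
    have "crossings R w Y \<rho> x \<subseteq> (\<Union>t\<in>R. {t} \<times> {y. near (3 * n) (t \<otimes> x) y})"
    proof
      fix p assume "p \<in> crossings R w Y \<rho> x"
      then obtain t y where p: "p = (t, y)" "t \<in> R" "y \<in> Y" "thick w (\<rho> y) y (t \<otimes> x)" by (auto simp: crossings_def)
      then have "near (3 * n) y (t \<otimes> x)" using \<rho>[OF p(3)] n1 by (auto simp: thick_def near_def)
      then show "p \<in> (\<Union>t\<in>R. {t} \<times> {y. near (3 * n) (t \<otimes> x) y})" using p near_sym by auto
    qed
    moreover have "finite (\<Union>t\<in>R. {t} \<times> {y. near (3 * n) (t \<otimes> x) y})"
      using R that near_finite by (intro finite_UN_I finite_cartesian_product) auto
    ultimately show ?thesis by (rule finite_subset)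
  qed
  have fin_k: "finite (cr k x)" if "x \<in> carrier G" for k x
    using fin_cr[OF that] by (rule rev_finite_subset) (auto simp: cr_def crossings_def)
  \<comment> \<open>Zones of distinct hubs of one color are disjoint, and by \<open>R_dist\<close> a
    given hub is reached from \<open>x\<close> through at most one \<open>t\<close>. So each color
    adds at most one crossing at each position.\<close>
  have step: "card (cr (Suc k) x) \<le> Suc (card (cr k x))"
    "card (cr (Suc k) x) \<noteq> card (cr k x) \<Longrightarrow> \<exists>y\<in>Y. c y = k \<and> x \<in> hit (3 * n) R w (\<rho> y) y"
    if x: "x \<in> carrier G" for k x
  proof -
    let ?new = "{(t, y). t \<in> R \<and> y \<in> Y \<and> c y = k \<and> thick w (\<rho> y) y (t \<otimes> x)}"
    have un: "cr (Suc k) x = cr k x \<union> ?new" by (auto simp: cr_def crossings_def)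
    have uniq: "p = p'" if pp: "p \<in> ?new" "p' \<in> ?new" for p p'
    proof -
      obtain t y t' y' where p: "p = (t, y)" "p' = (t', y')" "t \<in> R" "t' \<in> R" "y \<in> Y" "y' \<in> Y"
        "c y = k" "c y' = k" "thick w (\<rho> y) y (t \<otimes> x)" "thick w (\<rho> y') y' (t' \<otimes> x)" using pp by blast
      have "y = y'" using sep[of x y y'] in_zone[of t y x] in_zone[of t' y' x] p x by metis
      have tc: "t \<in> carrier G" "t' \<in> carrier G" "y \<in> carrier G" using p R Yc by auto
      have "near (3 * n) y (t \<otimes> x)" "near (3 * n) y (t' \<otimes> x)"
        using p \<open>y = y'\<close> \<rho>[of y] n1 by (auto simp: thick_def near_def)
      then have "near (3 * n + 3 * n) (t \<otimes> x) (t' \<otimes> x)" using near_sym near_trans by blast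
      then have "t' \<otimes> inv t \<in> A" using tc x mult_inv_cancel_right[of t t' x] by (simp add: near_def)
      then have "t = t'" using R_dist p by blast
      then show ?thesis using p \<open>y = y'\<close> by simp
    qed
    have fin_new: "finite ?new" using fin_k[OF x, of "Suc k"] un by simp
    have "card ?new \<le> 1" using uniq fin_new by (simp add: card_le_Suc0_iff_eq)
    then show "card (cr (Suc k) x) \<le> Suc (card (cr k x))"
      unfolding un using card_Un_le[of "cr k x" ?new] by linarith
    show "\<exists>y\<in>Y. c y = k \<and> x \<in> hit (3 * n) R w (\<rho> y) y" if "card (cr (Suc k) x) \<noteq> card (cr k x)"
    proof -
      have "?new \<noteq> {}" using that un by (metis sup_bot.right_neutral)
      then obtain t y where "t \<in> R" "y \<in> Y" "c y = k" "thick w (\<rho> y) y (t \<otimes> x)" by blast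
      then show ?thesis using in_zone[of t y x] x unfolding hit_def by blast
    qed
  qed
  \<comment> \<open>At most \<open>E\<close> hubs of color \<open>k\<close> have a zone meeting that
    of \<open>z\<close>. Each of them multiplies weights by \<open>m\<close>, but only on its hit
    set, whose weight is at most \<open>1/m\<close> of that of its own zone. One color thus costs a
    factor \<open>1 + E\<close> at most.\<close>
  have pot: "(\<Sum>x\<in>?Z z. m ^ card (cr k x)) \<le> C0 * (1 + E) ^ k * m ^ \<delta>" if "z \<in> Y" for z k
    using that
  proof (induction k arbitrary: z)
    case 0
    have zc: "z \<in> carrier G" using 0 Yc by auto
    have "cr 0 x = {}" for x by (auto simp: cr_def crossings_def)
    then have "(\<Sum>x\<in>?Z z. m ^ card (cr 0 x)) = card (?Z z)" by simp
    also have "\<dots> \<le> card R * (2 * (3 * n) + 2) ^ \<delta>" by (rule zone_finite_card[OF R zc])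
    also have "\<dots> \<le> card R * (8 * n) ^ \<delta>" using n1 by (intro mult_le_mono2 power_mono) auto
    also have "\<dots> = C0 * m ^ \<delta>" unfolding C0_def n by (simp only: power_mult_distrib mult.assoc)
    finally show ?case by simp
  next
    case (Suc k)
    have zc: "z \<in> carrier G" using Suc Yc by auto
    let ?N = "{y \<in> Y. \<exists>u\<in>U. near (\<kappa> * n) (u \<otimes> z) y}"
    let ?N' = "{y \<in> ?N. c y = k}"
    have N: "finite ?N" "card ?N \<le> E" unfolding E_def using net_count_UN[OF Y zc Uc] by auto
    have "?N' \<subseteq> ?N" by auto
    then have N': "finite ?N'" "card ?N' \<le> E"
      using finite_subset[OF _ N(1)] order_trans[OF card_mono[OF N(1)] N(2)] by blast+
    have finZ: "finite (?Z y)" if "y \<in> carrier G" for y by (rule zone_finite_card[OF R that])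
    have finH: "finite (hit (3 * n) R w (\<rho> y) y)" if "y \<in> carrier G" for y
      using finZ[OF that] by (rule rev_finite_subset) (auto simp: hit_def)
    have pw: "m ^ card (cr (Suc k) x) \<le> m ^ card (cr k x) +
        (\<Sum>y\<in>?N'. if x \<in> hit (3 * n) R w (\<rho> y) y then m * m ^ card (cr k x) else 0)" if x: "x \<in> ?Z z" for x
    proof (cases "card (cr (Suc k) x) = card (cr k x)")
      case False
      have xc: "x \<in> carrier G" using x by (simp add: zone_def)
      obtain y where y: "y \<in> Y" "c y = k" "x \<in> hit (3 * n) R w (\<rho> y) y" using step(2)[OF xc False] by blast
      have "y \<in> ?N'" using conflict[of x z y] x y zc by (auto simp: hit_def)
      have "m ^ card (cr (Suc k) x) \<le> m ^ Suc (card (cr k x))"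
        using step(1)[OF xc, of k] \<open>0 < m\<close> by (intro power_increasing) auto
      also have "\<dots> = (if x \<in> hit (3 * n) R w (\<rho> y) y then m * m ^ card (cr k x) else 0)" using y by simp
      also have "\<dots> \<le> (\<Sum>y\<in>?N'. if x \<in> hit (3 * n) R w (\<rho> y) y then m * m ^ card (cr k x) else 0)"
        by (rule member_le_sum[OF \<open>y \<in> ?N'\<close>]) (use N' in auto)
      finally show ?thesis by linarith
    qed simp
    have "(\<Sum>x\<in>?Z z. m ^ card (cr (Suc k) x)) \<le> (\<Sum>x\<in>?Z z. m ^ card (cr k x)) +
        (\<Sum>x\<in>?Z z. \<Sum>y\<in>?N'. if x \<in> hit (3 * n) R w (\<rho> y) y then m * m ^ card (cr k x) else 0)"
      unfolding sum.distrib[symmetric] by (rule sum_mono) (rule pw)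
    also have "(\<Sum>x\<in>?Z z. \<Sum>y\<in>?N'. if x \<in> hit (3 * n) R w (\<rho> y) y then m * m ^ card (cr k x) else 0) =
        (\<Sum>y\<in>?N'. \<Sum>x\<in>?Z z. if x \<in> hit (3 * n) R w (\<rho> y) y then m * m ^ card (cr k x) else 0)"
      by (rule sum.swap)
    also have "\<dots> \<le> (\<Sum>y\<in>?N'. C0 * (1 + E) ^ k * m ^ \<delta>)"
    proof (rule sum_mono)
      fix y assume "y \<in> ?N'"
      then have y: "y \<in> Y" "c y = k" "y \<in> carrier G" using Yc by auto
      have "(\<Sum>x\<in>?Z z. if x \<in> hit (3 * n) R w (\<rho> y) y then m * m ^ card (cr k x) else 0) =
          (\<Sum>x\<in>?Z z \<inter> hit (3 * n) R w (\<rho> y) y. m * m ^ card (cr k x))"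
        using finZ[OF zc] by (simp add: sum.inter_restrict)
      also have "\<dots> \<le> (\<Sum>x\<in>hit (3 * n) R w (\<rho> y) y. m * m ^ card (cr k x))"
        by (rule sum_mono2[OF finH[OF y(3)]]) auto
      also have "\<dots> \<le> (\<Sum>x\<in>?Z y. m ^ card (cr k x))"
        using greedy[OF y(1)] unfolding cr_def y(2) by (simp add: sum_distrib_left)
      also have "\<dots> \<le> C0 * (1 + E) ^ k * m ^ \<delta>" using Suc.IH y by blast
      finally show "(\<Sum>x\<in>?Z z. if x \<in> hit (3 * n) R w (\<rho> y) y then m * m ^ card (cr k x) else 0)
          \<le> C0 * (1 + E) ^ k * m ^ \<delta>" .
    qed
    also have "\<dots> \<le> E * (C0 * (1 + E) ^ k * m ^ \<delta>)" using N' by simp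
    also have "(\<Sum>x\<in>?Z z. m ^ card (cr k x)) \<le> C0 * (1 + E) ^ k * m ^ \<delta>" using Suc by blast
    finally have "(\<Sum>x\<in>?Z z. m ^ card (cr (Suc k) x)) \<le> C0 * (1 + E) ^ k * m ^ \<delta> + E * (C0 * (1 + E) ^ k * m ^ \<delta>)"
      by simp
    then show ?case by (simp add: algebra_simps)
  qed
  have crD: "cr D x = crossings R w Y \<rho> x" for x
    unfolding cr_def using c(2) by (auto simp: crossings_def)
  have "card (crossings R w Y \<rho> x0) \<le> \<delta>"
  proof (rule ccontr)
    assume "\<not> card (crossings R w Y \<rho> x0) \<le> \<delta>"
    then have big: "Suc \<delta> \<le> card (cr D x0)" by (simp add: crD)
    then have "cr D x0 \<noteq> {}" by auto
    then obtain t y where ty: "t \<in> R" "y \<in> Y" "thick w (\<rho> y) y (t \<otimes> x0)" by (auto simp: crD crossings_def)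
    then have xz: "x0 \<in> ?Z y" using in_zone x0 by blast
    have yc: "y \<in> carrier G" using ty Yc by auto
    \<comment> \<open>A position with \<delta> + 1 crossings would by itself exceed the final bound
      on the weight of the zone.\<close>
    have "m * m ^ \<delta> \<le> m ^ card (cr D x0)" using power_increasing[OF big, of m] \<open>0 < m\<close> by simp
    also have "\<dots> \<le> (\<Sum>x\<in>?Z y. m ^ card (cr D x))"
      by (rule member_le_sum[OF xz]) (use zone_finite_card[OF R yc] in auto)
    also have "\<dots> \<le> C0 * (1 + E) ^ D * m ^ \<delta>" by (rule pot[OF ty(2)])
    finally have "m \<le> C0 * (1 + E) ^ D" using \<open>0 < m\<close> by simp
    then show False using m by (simp add: C0_def E_def)
  qed
  then show ?thesis using fin_cr[OF x0] by simp
qed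

end

context doubling_length
begin

lemma thick_right:
  "y \<in> carrier G \<Longrightarrow> p \<in> carrier G \<Longrightarrow> g \<in> carrier G \<Longrightarrow> thick w r (y \<otimes> g) (p \<otimes> g) \<longleftrightarrow> thick w r y p"
  by (simp add: thick_def mult_inv_cancel_right)

lemma zone_right:
  assumes "R \<subseteq> carrier G" "y \<in> carrier G"
  shows "zone k R y = (\<lambda>x. x \<otimes> y) ` zone k R \<one>"
proof (intro equalityI subsetI)
  fix x assume "x \<in> zone k R y"
  then obtain t where t: "x \<in> carrier G" "t \<in> R" "near k (t \<otimes> x) y" by (auto simp: zone_def)
  have tc: "t \<in> carrier G" using t assms by auto
  have x: "(x \<otimes> inv y) \<otimes> y = x" using t assms by (simp add: m_assoc)
  have "near k (t \<otimes> (x \<otimes> inv y)) \<one>"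
    using near_right[of "t \<otimes> (x \<otimes> inv y)" \<one> y k] t tc assms x by (simp add: m_assoc)
  then have "x \<otimes> inv y \<in> zone k R \<one>" using t assms by (auto simp: zone_def)
  then show "x \<in> (\<lambda>x. x \<otimes> y) ` zone k R \<one>" using x by (metis imageI)
next
  fix x assume "x \<in> (\<lambda>x. x \<otimes> y) ` zone k R \<one>"
  then obtain x' t where t: "x = x' \<otimes> y" "x' \<in> carrier G" "t \<in> R" "near k (t \<otimes> x') \<one>" by (auto simp: zone_def)
  have tc: "t \<in> carrier G" using t assms by auto
  have "near k (t \<otimes> x) y" using near_right[of "t \<otimes> x'" \<one> y k] t tc assms by (simp add: m_assoc)
  then show "x \<in> zone k R y" using t assms by (auto simp: zone_def)
qed

lemma hit_right:
  assumes "R \<subseteq> carrier G" "y \<in> carrier G"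
  shows "hit k R w r y = (\<lambda>x. x \<otimes> y) ` hit k R w r \<one>"
proof -
  have "thick w r y (t \<otimes> (x \<otimes> y)) \<longleftrightarrow> thick w r \<one> (t \<otimes> x)" if "t \<in> R" "x \<in> zone k R \<one>" for t x
  proof -
    have "t \<in> carrier G" "x \<in> carrier G" using that assms by (auto simp: zone_def)
    then show ?thesis using thick_right[of \<one> "t \<otimes> x" y w r] assms by (simp add: m_assoc)
  qed
  then show ?thesis unfolding hit_def zone_right[OF assms] by blast
qed

text \<open>Each hub chooses among \<open>m\<close> radii spaced \<open>2 * w + 1\<close> apart, so
  that a position is hit by at most one of them, and averaging provides a cheap one. The threshold
  \<open>m0\<close> involves the number of colors of the net; since that number does not depend on
  \<open>n\<close>, there is no circularity, and \<open>m\<close> may still be enlarged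
  later.\<close>

lemma radii_exist:
  assumes R: "finite R" "R \<subseteq> carrier G"
    and R_dist: "\<And>t t'. t \<in> R \<Longrightarrow> t' \<in> R \<Longrightarrow> t' \<otimes> inv t \<in> A \<Longrightarrow> t = t'"
  obtains m0 where "\<And>m n. m0 \<le> m \<Longrightarrow> n = (2 * w + 1) * m \<Longrightarrow> \<exists>F. finite F \<and> F \<subseteq> carrier G \<and>
    radii_choosable R w n F"
proof -
  define U where "U = (\<lambda>(t, t'). t' \<otimes> inv t) ` (R \<times> R)"
  have U: "finite U" "U \<subseteq> carrier G" using R by (auto simp: U_def)
  define \<kappa> where "\<kappa> = (\<Sum>u\<in>U. 3 * lip u + 3)"
  have \<kappa>: "3 * lip u + 3 \<le> \<kappa>" if "u \<in> U" for u
    unfolding \<kappa>_def by (rule member_le_sum[OF that]) (use U in auto)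
  obtain D where D: "\<And>n. \<exists>F. finite F \<and> F \<subseteq> carrier G \<and> hub_colorable U \<kappa> n D F"
    using hub_coloring[OF U] by blast
  \<comment> \<open>The exponent is \<open>Suc D\<close>, since the hub colors run from 0 to
    \<open>D\<close>. The outer \<open>Suc\<close> provides the strict inequality.\<close>
  define m0 where "m0 = Suc (card R * (8 * (2 * w + 1)) ^ \<delta> * (1 + card U * (2 * \<kappa> + 2) ^ \<delta>) ^ Suc D)"
  have "\<exists>F. finite F \<and> F \<subseteq> carrier G \<and>
    radii_choosable R w n F"
    if m: "m0 \<le> m" and n: "n = (2 * w + 1) * m" for m n
  proof -
    have m_pos: "0 < m" using m by (simp add: m0_def)
    have "(2 * w + 1) * 1 \<le> n" unfolding n using m_pos by (intro mult_le_mono2) simp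
    then have wn: "w \<le> n" by simp
    obtain F where F: "finite F" "F \<subseteq> carrier G" "hub_colorable U \<kappa> n D F"
      using D[of n] by blast
    have main: "\<exists>\<rho>. local_fun G \<rho> \<and> (\<forall>\<omega>. n \<le> \<rho> \<omega> \<and> \<rho> \<omega> \<le> 2 * n) \<and>
      (\<forall>\<omega>. proper_coloring G (carrier G) F N \<omega> \<and> net n (hubs \<Phi> \<omega>) \<longrightarrow>
         few_crossings R w (hubs \<Phi> \<omega>) (\<lambda>y. \<rho> (shift G y \<omega>)))"
      if lcl: "local_fun G \<Phi>" for N \<Phi>
    proof -
      obtain c where c: "local_fun G c" "\<And>\<omega>. c \<omega> \<le> D"
        "\<And>\<omega>. proper_coloring G (carrier G) F N \<omega> \<Longrightarrow> net n (hubs \<Phi> \<omega>) \<Longrightarrow>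
           hub_proper U (\<kappa> * n) (hubs \<Phi> \<omega>) (\<lambda>y. c (shift G y \<omega>))"
        using hub_colorableD[OF F(3) lcl, of N] by blast
      let ?Z = "zone (3 * n) R \<one>"
      \<comment> \<open>For \<open>i < m\<close> these radii stay below \<open>2 * n\<close>,
        because \<open>n = (2 * w + 1) * m\<close>.\<close>
      define opt where "opt i = n + (2 * w + 1) * i" for i
      \<comment> \<open>All positions of hubs whose spheres can be met from the zone of a hub at
        \<open>\<one>\<close>; the rule consults no others.\<close>
      define V where "V = (\<Union>x\<in>?Z. \<Union>t\<in>R. {v. near (3 * n) (t \<otimes> x) v})"
      have Z: "finite ?Z" "?Z \<subseteq> carrier G" using zone_finite_card[OF R] by (auto simp: zone_def)
      have V: "finite V" "V \<subseteq> carrier G"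
        using R Z near_finite by (auto simp: V_def near_def subset_iff)
      define cross where "cross \<omega> u x = {(t, v). t \<in> R \<and> v \<in> V \<and> \<Phi> (shift G v \<omega>) \<and>
         (\<exists>r. u v = Some r \<and> thick w r v (t \<otimes> x))}" for \<omega> u x
      define cost where "cost \<omega> u i = (\<Sum>x\<in>hit (3 * n) R w (opt i) \<one>. m ^ card (cross \<omega> u x))" for \<omega> u i
      define T where "T = (\<lambda>\<omega> u. opt (arg_min (cost \<omega> u) (\<lambda>i. i < m)))"
      \<comment> \<open>Hubs choose in the order of their colors. Other positions may have rank 0,
        since \<open>cross\<close> ignores their radii.\<close>
      define r where "r \<omega> = (if \<Phi> \<omega> then c \<omega> else 0)" for \<omega>
      have T: "local_fun G T"
      proof (rule local_fun_family[where V = V and \<Phi> = "\<lambda>v \<omega>. \<Phi> (shift G v \<omega>)"])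
        fix \<omega> \<omega>' assume *: "\<And>v. v \<in> V \<Longrightarrow> \<Phi> (shift G v \<omega>) = \<Phi> (shift G v \<omega>')"
        have "cross \<omega> = cross \<omega>'" unfolding cross_def using * by (intro ext) auto
        then show "T \<omega> = T \<omega>'" unfolding T_def cost_def by simp
      qed (use V lcl local_fun_shift in auto)
      have lr: "local_fun G r" unfolding r_def by (rule local_fun_if[OF lcl c(1)]) auto
      obtain \<rho> where \<rho>: "local_fun G \<rho>"
        "\<And>\<omega>. r \<omega> < Suc D \<Longrightarrow> \<rho> \<omega> = T \<omega> (\<lambda>v. if v \<in> V \<and> r (shift G v \<omega>) < r \<omega> then Some (\<rho> (shift G v \<omega>)) else None)"
        using local_greedy[OF lr T V, of "Suc D"] by blast
      define u where "u \<omega> = (\<lambda>v. if v \<in> V \<and> r (shift G v \<omega>) < r \<omega> then Some (\<rho> (shift G v \<omega>)) else None)" for \<omega>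
      define i where "i \<omega> = arg_min (cost \<omega> (u \<omega>)) (\<lambda>i. i < m)" for \<omega>
      have \<rho>_eq: "\<rho> \<omega> = opt (i \<omega>)" for \<omega>
        using \<rho>(2)[of \<omega>] c(2)[of \<omega>] unfolding T_def i_def u_def r_def by (simp add: less_Suc_eq_le)
      have i_less: "i \<omega> < m" for \<omega> unfolding i_def by (rule arg_min_natI[of _ 0]) (rule m_pos)
      have i_min: "j < m \<Longrightarrow> cost \<omega> (u \<omega>) (i \<omega>) \<le> cost \<omega> (u \<omega>) j" for j \<omega>
        unfolding i_def by (rule arg_min_nat_le)
      have opt_le: "j < m \<Longrightarrow> opt j \<le> 2 * n" for j
      proof -
        assume "j < m"
        then have "(2 * w + 1) * j \<le> (2 * w + 1) * m" by (intro mult_le_mono2) simp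
        then show ?thesis unfolding opt_def n by linarith
      qed
      have \<rho>_bd: "n \<le> \<rho> \<omega> \<and> \<rho> \<omega> \<le> 2 * n" for \<omega>
        using opt_le[OF i_less] unfolding \<rho>_eq by (simp add: opt_def)
      have "finite (crossings R w (hubs \<Phi> \<omega>) (\<lambda>y. \<rho> (shift G y \<omega>)) x) \<and>
            card (crossings R w (hubs \<Phi> \<omega>) (\<lambda>y. \<rho> (shift G y \<omega>)) x) \<le> \<delta>"
        if p: "proper_coloring G (carrier G) F N \<omega>" and nt: "net n (hubs \<Phi> \<omega>)" and x: "x \<in> carrier G" for \<omega> x
      proof -
        let ?Y = "hubs \<Phi> \<omega>"
        let ?c = "\<lambda>y. c (shift G y \<omega>)"
        let ?\<rho> = "\<lambda>y. \<rho> (shift G y \<omega>)"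
        let ?cr = "\<lambda>y. crossings R w {z\<in>?Y. ?c z < ?c y} ?\<rho>"
        have greedy: "m * (\<Sum>x\<in>hit (3 * n) R w (?\<rho> y) y. m ^ card (?cr y x)) \<le> (\<Sum>x\<in>zone (3 * n) R y. m ^ card (?cr y x))"
          if y: "y \<in> ?Y" for y
        proof -
          have yc: "y \<in> carrier G" "\<Phi> (shift G y \<omega>)" using y by (auto simp: hubs_def)
          let ?\<omega> = "shift G y \<omega>"
          let ?k = "\<lambda>x. m ^ card (cross ?\<omega> (u ?\<omega>) x)"
          \<comment> \<open>Translating \<open>y\<close> to \<open>\<one>\<close> identifies the
            crossings with hubs of smaller color with what the rule sees: those hubs, and only
            those, have already announced a radius.\<close>
          have card_eq: "card (?cr y (x \<otimes> y)) = card (cross ?\<omega> (u ?\<omega>) x)" if x: "x \<in> ?Z" for x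
          proof -
            have xc: "x \<in> carrier G" using x Z by auto
            have "?cr y (x \<otimes> y) = (\<lambda>(t, v). (t, v \<otimes> y)) ` cross ?\<omega> (u ?\<omega>) x"
            proof (intro equalityI subsetI)
              fix q assume "q \<in> ?cr y (x \<otimes> y)"
              then obtain t z where q: "q = (t, z)" "t \<in> R" "z \<in> ?Y" "?c z < ?c y" "thick w (?\<rho> z) z (t \<otimes> (x \<otimes> y))"
                by (auto simp: crossings_def)
              have zc: "z \<in> carrier G" "\<Phi> (shift G z \<omega>)" "t \<in> carrier G" using q R by (auto simp: hubs_def)
              define v where "v = z \<otimes> inv y"
              have v: "v \<in> carrier G" "v \<otimes> y = z" using zc yc by (auto simp: v_def m_assoc)
              have th: "thick w (?\<rho> z) v (t \<otimes> x)"
                using q(5) thick_right[of v "t \<otimes> x" y w "?\<rho> z"] v zc xc yc by (simp add: m_assoc)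
              then have "near (3 * n) v (t \<otimes> x)" using \<rho>_bd[of "shift G z \<omega>"] wn by (auto simp: thick_def near_def)
              from near_sym[OF this] have "v \<in> V" using x q by (auto simp: V_def)
              then have "(t, v) \<in> cross ?\<omega> (u ?\<omega>) x"
                using q th zc yc v by (auto simp: cross_def u_def r_def shift_shift)
              then show "q \<in> (\<lambda>(t, v). (t, v \<otimes> y)) ` cross ?\<omega> (u ?\<omega>) x" using q v by force
            next
              fix q assume "q \<in> (\<lambda>(t, v). (t, v \<otimes> y)) ` cross ?\<omega> (u ?\<omega>) x"
              then obtain t v where q: "q = (t, v \<otimes> y)" "(t, v) \<in> cross ?\<omega> (u ?\<omega>) x" by auto
              then have q2: "t \<in> R" "v \<in> V" "\<Phi> (shift G v ?\<omega>)" "r (shift G v ?\<omega>) < r ?\<omega>" "thick w (\<rho> (shift G v ?\<omega>)) v (t \<otimes> x)"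
                by (auto simp: cross_def u_def split: if_splits)
              have vc: "v \<in> carrier G" "t \<in> carrier G" using q2 V R by auto
              have "thick w (\<rho> (shift G (v \<otimes> y) \<omega>)) (v \<otimes> y) (t \<otimes> (x \<otimes> y))"
                using q2(5) thick_right[of v "t \<otimes> x" y w "?\<rho> (v \<otimes> y)"] vc xc yc by (simp add: m_assoc shift_shift)
              then show "q \<in> ?cr y (x \<otimes> y)"
                using q q2 vc yc by (auto simp: crossings_def hubs_def shift_shift r_def)
            qed
            moreover have "inj_on (\<lambda>(t, v). (t, v \<otimes> y)) (cross ?\<omega> (u ?\<omega>) x)"
            proof (rule inj_onI, clarsimp)
              fix t v t' v' assume "(t, v) \<in> cross ?\<omega> (u ?\<omega>) x" "(t', v') \<in> cross ?\<omega> (u ?\<omega>) x" "v \<otimes> y = v' \<otimes> y"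
              then show "v = v'" using V yc by (auto simp: cross_def subset_iff)
            qed
            ultimately show ?thesis by (simp add: card_image)
          qed
          have inj: "inj_on (\<lambda>x. x \<otimes> y) ?Z" using Z yc by (auto simp: inj_on_def subset_iff)
          have hitZ: "hit (3 * n) R w s \<one> \<subseteq> ?Z" for s by (auto simp: hit_def)
          have sum_hit: "(\<Sum>x\<in>hit (3 * n) R w s y. m ^ card (?cr y x)) = (\<Sum>x\<in>hit (3 * n) R w s \<one>. ?k x)" for s
            unfolding hit_right[OF R(2) yc(1)] using card_eq hitZ[of s]
            by (subst sum.reindex[OF inj_on_subset[OF inj hitZ]]) (auto intro!: sum.cong)
          have sum_zone: "(\<Sum>x\<in>zone (3 * n) R y. m ^ card (?cr y x)) = (\<Sum>x\<in>?Z. ?k x)"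
            unfolding zone_right[OF R(2) yc(1)] using card_eq
            by (subst sum.reindex[OF inj]) (auto intro!: sum.cong)
          \<comment> \<open>Two hits at \<open>x\<close> lie in the same coset of \<open>A\<close>,
            so \<open>R_dist\<close> forces the same \<open>t\<close>; then the two radii differ by
            at most \<open>2 * w\<close>, less than the spacing.\<close>
          have disj: "hit (3 * n) R w (opt j) \<one> \<inter> hit (3 * n) R w (opt j') \<one> = {}" if "j \<noteq> j'" for j j'
          proof (rule ccontr)
            assume "hit (3 * n) R w (opt j) \<one> \<inter> hit (3 * n) R w (opt j') \<one> \<noteq> {}"
            then obtain x t t' where x: "x \<in> ?Z" "t \<in> R" "t' \<in> R" "thick w (opt j) \<one> (t \<otimes> x)" "thick w (opt j') \<one> (t' \<otimes> x)"
              by (auto simp: hit_def)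
            have tc: "t \<in> carrier G" "t' \<in> carrier G" "x \<in> carrier G" using x R Z by auto
            have "t \<otimes> x \<in> A" "t' \<otimes> x \<in> A" using x tc by (auto simp: thick_def)
            then have "(t' \<otimes> x) \<otimes> inv (t \<otimes> x) \<in> A" by simp
            then have "t' \<otimes> inv t \<in> A" using mult_inv_cancel_right tc by simp
            then have "t = t'" using R_dist x by blast
            then have le: "opt j \<le> opt j' + 2 * w" "opt j' \<le> opt j + 2 * w" using x by (auto simp: thick_def)
            have "(2 * w + 1) * a < (2 * w + 1) * b + (2 * w + 1) \<Longrightarrow> a \<le> b" for a b :: nat
            proof -
              assume "(2 * w + 1) * a < (2 * w + 1) * b + (2 * w + 1)"
              then have "(2 * w + 1) * a < (2 * w + 1) * Suc b" by simp
              then show "a \<le> b" by (metis less_Suc_eq_le mult_less_cancel1)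
            qed
            from this[of j j'] this[of j' j] show False using le that unfolding opt_def by linarith
          qed
          \<comment> \<open>Averaging over the candidates: their hit sets are disjoint parts of the
            zone, so the cheapest candidate costs at most \<open>1/m\<close> of its weight.\<close>
          have "m * cost ?\<omega> (u ?\<omega>) (i ?\<omega>) = (\<Sum>j<m. cost ?\<omega> (u ?\<omega>) (i ?\<omega>))" by simp
          also have "\<dots> \<le> (\<Sum>j<m. cost ?\<omega> (u ?\<omega>) j)" by (rule sum_mono) (simp add: i_min)
          also have "\<dots> = (\<Sum>x\<in>(\<Union>j<m. hit (3 * n) R w (opt j) \<one>). ?k x)"
            unfolding cost_def
            by (rule sum.UNION_disjoint[symmetric]) (use finite_subset[OF hitZ Z(1)] disj in auto)
          also have "\<dots> \<le> (\<Sum>x\<in>?Z. ?k x)"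
            by (rule sum_mono2[OF Z(1)]) (use hitZ in auto)
          finally show ?thesis unfolding sum_hit sum_zone cost_def \<rho>_eq[symmetric] .
        qed
        show ?thesis
          by (rule crossings_bound[where c = ?c and D = "Suc D" and U = U and \<kappa> = \<kappa> and m = m and n = n,
                OF nt R R_dist _ n m_pos U_def \<kappa> c(3)[OF p nt] _ greedy _ x])
            (use \<rho>_bd c(2) m in \<open>auto simp: less_Suc_eq_le m0_def\<close>)
      qed
      then show ?thesis using \<rho>(1) \<rho>_bd unfolding few_crossings_def by blast
    qed
    have "radii_choosable R w n F" unfolding radii_choosable_def by (intro allI impI main)
    then show ?thesis using F(1,2) by blast
  qed
  then show ?thesis using that by blast
qed

end

section \<open>Extensions by abelian groups\<close>

lemma card_image_le_fibres:
  assumes "finite S" "\<And>q. q \<in> f ` S \<Longrightarrow> card (h ` {s \<in> S. f s = q}) \<le> b"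
  shows "card (h ` S) \<le> card (f ` S) * b"
proof -
  have "h ` S = (\<Union>q\<in>f ` S. h ` {s \<in> S. f s = q})" by auto
  then have "card (h ` S) \<le> (\<Sum>q\<in>f ` S. card (h ` {s \<in> S. f s = q}))"
    using card_UN_le[of "f ` S" "\<lambda>q. h ` {s \<in> S. f s = q}"] assms(1) by simp
  also have "\<dots> \<le> (\<Sum>q\<in>f ` S. b)" by (rule sum_mono) (rule assms(2))
  finally show ?thesis by simp
qed

context doubling_length
begin

text \<open>The coloring of \<open>D\<close> read off at \<open>s\<close> only depends, up to a shift, on the set \<open>e s\<close> of crossings
  that \<open>s\<close> lies inside of. This leaves at most \<open>2 ^ \<delta>\<close> colorings of \<open>D\<close>, each with at most \<open>K\<close> centers;
  moving from the chosen coset of \<open>A\<close> to a net in it costs the factor \<open>6 ^ \<delta>\<close>.\<close>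

theorem rule_bound_extension:
  fixes D :: "('d, 'e) monoid_scheme"
  assumes "group D" and \<pi>: "\<pi> \<in> hom G D" "\<pi> ` carrier G = carrier D"
    and ker: "\<And>g. g \<in> carrier G \<Longrightarrow> \<pi> g = \<one>\<^bsub>D\<^esub> \<longleftrightarrow> g \<in> A"
    and K: "rule_bound K D"
  shows "rule_bound (2 ^ \<delta> * K * 6 ^ \<delta>) G"
  unfolding rule_bound_def
proof (intro allI impI)
  fix S assume "finite S \<and> S \<subseteq> carrier G"
  then have S: "finite S" "S \<subseteq> carrier G" by auto
  interpret D: group D by fact
  interpret h: group_hom G D \<pi>
    using \<pi>(1) by (simp add: group_hom_def group_hom_axioms_def)
  define \<tau> where "\<tau> d = (SOME g. g \<in> carrier G \<and> \<pi> g = d)" for d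
  have \<tau>: "\<tau> d \<in> carrier G" "\<pi> (\<tau> d) = d" if "d \<in> carrier D" for d
  proof -
    have "d \<in> \<pi> ` carrier G" using that \<pi>(2) by simp
    then have "\<exists>g. g \<in> carrier G \<and> \<pi> g = d" by blast
    from someI_ex[OF this] show "\<tau> d \<in> carrier G" "\<pi> (\<tau> d) = d" unfolding \<tau>_def by auto
  qed
  have coset: "\<pi> g = \<pi> g' \<longleftrightarrow> g \<otimes> inv g' \<in> A" if "g \<in> carrier G" "g' \<in> carrier G" for g g'
  proof -
    have "\<pi> (g \<otimes> inv g') = \<pi> g \<otimes>\<^bsub>D\<^esub> inv\<^bsub>D\<^esub> \<pi> g'" using that by simp
    moreover have "\<pi> g \<otimes>\<^bsub>D\<^esub> inv\<^bsub>D\<^esub> \<pi> g' = \<one>\<^bsub>D\<^esub> \<longleftrightarrow> \<pi> g = \<pi> g'"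
      using that by (metis D.inv_equality D.inv_inv D.r_inv h.hom_closed D.inv_closed)
    ultimately show ?thesis using ker[of "g \<otimes> inv g'"] that by auto
  qed
  define S' where "S' = \<pi> ` S"
  have S': "finite S'" "S' \<subseteq> carrier D" using S by (auto simp: S'_def)
  obtain F' where F'_all: "finite F' \<and> F' \<subseteq> carrier D \<and> (\<forall>N. \<exists>B a. finite B \<and> B \<subseteq> carrier D \<and>
        range a \<subseteq> B \<and> local_fun D a \<and>
        (\<forall>\<omega>. proper_coloring D (carrier D) F' N \<omega> \<longrightarrow>
           card ((\<lambda>s. a (shift D s \<omega>) \<otimes>\<^bsub>D\<^esub> s) ` S') \<le> K))"
    using K[unfolded rule_bound_def, THEN spec, THEN mp, OF conjI[OF S']] by (elim exE)
  note F' = F'_all[THEN conjunct1] F'_all[THEN conjunct2, THEN conjunct1]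
    F'_all[THEN conjunct2, THEN conjunct2, THEN spec]
  define U where "U = \<tau> ` (F' - {\<one>\<^bsub>D\<^esub>})"
  have U: "finite U" "U \<subseteq> carrier G" using F'(1,2) \<tau>(1) by (auto simp: U_def)
  \<comment> \<open>The sum of the distances between hubs that color adjacent cosets:
    \<open>2 * n\<close> from a hub to the reading position, stretched by \<open>lip u\<close>, then
    \<open>n\<close> for the defect of the section \<tau>, then \<open>2 * n\<close> to the other
    hub.\<close>
  define \<kappa> where "\<kappa> = (\<Sum>u\<in>U. 2 * lip u) + 3"
  have \<kappa>: "2 * lip u + 3 \<le> \<kappa>" if "u \<in> U" for u
    unfolding \<kappa>_def using member_le_sum[OF that, of "\<lambda>u. 2 * lip u"] U(1) by linarith
  obtain C where C: "\<And>n. \<exists>F. finite F \<and> F \<subseteq> carrier G \<and> hub_colorable U \<kappa> n C F"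
    using hub_coloring[OF U] by blast
  obtain B' a' where a'_all: "finite B' \<and> B' \<subseteq> carrier D \<and> range a' \<subseteq> B' \<and> local_fun D a' \<and>
     (\<forall>\<omega>. proper_coloring D (carrier D) F' (Suc C) \<omega> \<longrightarrow>
           card ((\<lambda>s. a' (shift D s \<omega>) \<otimes>\<^bsub>D\<^esub> s) ` S') \<le> K)"
    using F'(3)[of "Suc C"] by (elim exE)
  then have a': "finite B'" "B' \<subseteq> carrier D" "range a' \<subseteq> B'" "local_fun D a'"
    by auto
  note a'_bound = a'_all[THEN conjunct2, THEN conjunct2, THEN conjunct2, THEN conjunct2, THEN spec, THEN mp]
  \<comment> \<open>Properness of the coloring of \<open>D\<close> will require the defect of \<tau>
    to be at most \<open>n\<close>, which can be arranged for finitely many positions only; hence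
    the passage to a finite \<open>R'\<close>.\<close>
  obtain R' where R': "finite R'" "R' \<subseteq> carrier D"
    "\<And>\<omega>. proper_coloring D R' F' (Suc C) \<omega> \<Longrightarrow> card ((\<lambda>s. a' (shift D s \<omega>) \<otimes>\<^bsub>D\<^esub> s) ` S') \<le> K"
    proof (rule D.finite_window[OF S' F'(2) a'(4) a'_bound])
    fix R assume R: "finite R" "R \<subseteq> carrier D"
      "\<And>\<omega>. proper_coloring D R F' (Suc C) \<omega> \<Longrightarrow> card ((\<lambda>s. a' (shift D s \<omega>) \<otimes>\<^bsub>D\<^esub> s) ` S') \<le> K"
    show thesis by (rule that[OF R])
  qed
  obtain W' where W': "finite W'" "W' \<subseteq> carrier D"
    "\<And>\<omega> \<omega>'. (\<forall>h\<in>W'. \<omega> h = \<omega>' h) \<Longrightarrow> a' \<omega> = a' \<omega>'"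
    using a'(4) unfolding local_fun_def by metis
  \<comment> \<open>A coloring read from \<open>s0\<close> is recentered by the inverse of
    \<open>\<pi> s0\<close> before the rule for \<open>D\<close> is applied; the right factors
    account for this.\<close>
  define R2 where "R2 = (\<lambda>(d, s). d \<otimes>\<^bsub>D\<^esub> inv\<^bsub>D\<^esub> s) ` (R' \<times> S')"
  have R2: "finite R2" "R2 \<subseteq> carrier D" using R'(1,2) S' by (auto simp: R2_def subset_iff)
  \<comment> \<open>One representative of each coset of \<open>A\<close> that the rule for
    \<open>D\<close> consults from some \<open>s \<in> S\<close>.\<close>
  define T where "T = \<tau> ` ((\<lambda>(d, s). d \<otimes>\<^bsub>D\<^esub> s) ` (W' \<times> S'))"
  have T: "finite T" "T \<subseteq> carrier G" using W'(1,2) S' \<tau>(1) by (auto simp: T_def subset_iff)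
  have T_dist: "t = t'" if tt: "t \<in> T" "t' \<in> T" "t' \<otimes> inv t \<in> A" for t t'
  proof -
    obtain d d' where d: "t = \<tau> d" "t' = \<tau> d'" "d \<in> carrier D" "d' \<in> carrier D"
      using tt W'(1,2) S' by (auto simp: T_def subset_iff)
    have "\<pi> t' = \<pi> t" using coset[of t' t] tt d \<tau> by auto
    then show ?thesis using d \<tau> by simp
  qed
  \<comment> \<open>The position in the coset of \<open>t\<close> at which an observer at
    \<open>s\<close> reads its color. It varies with \<open>s\<close>, but stays within
    \<open>w\<close> of \<open>t\<close>.\<close>
  define pp where "pp t s = \<tau> (\<pi> t \<otimes>\<^bsub>D\<^esub> inv\<^bsub>D\<^esub> (\<pi> s)) \<otimes> s" for t s
  have pp: "pp t s \<in> carrier G" "pp t s \<otimes> inv t \<in> A" if "t \<in> carrier G" "s \<in> carrier G" for t s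
  proof -
    have \<tau>c: "\<tau> (\<pi> t \<otimes>\<^bsub>D\<^esub> inv\<^bsub>D\<^esub> (\<pi> s)) \<in> carrier G" using that by (intro \<tau>) auto
    then show c: "pp t s \<in> carrier G" unfolding pp_def using that by simp
    have "\<pi> (pp t s) = \<pi> t" unfolding pp_def using that \<tau>c \<tau> by (simp add: D.m_assoc)
    then show "pp t s \<otimes> inv t \<in> A" using coset[OF c that(1)] by simp
  qed
  define w where "w = (\<Sum>(t, s)\<in>T \<times> S. len (pp t s \<otimes> inv t))"
  have w: "len (pp t s \<otimes> inv t) \<le> w" if "t \<in> T" "s \<in> S" for t s
    unfolding w_def using member_le_sum[of "(t, s)" "T \<times> S" "\<lambda>(t, s). len (pp t s \<otimes> inv t)"] that T S by simp
  \<comment> \<open>The defect of multiplicativity of the section \<tau>. It moves the reading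
    position inside a coset of \<open>A\<close>.\<close>
  define bb where "bb d f = \<tau> (f \<otimes>\<^bsub>D\<^esub> d) \<otimes> inv (\<tau> f \<otimes> \<tau> d)" for d f
  have bb: "bb d f \<in> A" "bb d f \<otimes> (\<tau> f \<otimes> \<tau> d) = \<tau> (f \<otimes>\<^bsub>D\<^esub> d)" if "d \<in> carrier D" "f \<in> carrier D" for d f
  proof -
    have "\<tau> (f \<otimes>\<^bsub>D\<^esub> d) \<in> carrier G" "\<tau> f \<otimes> \<tau> d \<in> carrier G" using that \<tau> by auto
    moreover have "\<pi> (\<tau> (f \<otimes>\<^bsub>D\<^esub> d)) = \<pi> (\<tau> f \<otimes> \<tau> d)" using that \<tau> by simp
    ultimately show "bb d f \<in> A" "bb d f \<otimes> (\<tau> f \<otimes> \<tau> d) = \<tau> (f \<otimes>\<^bsub>D\<^esub> d)"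
      using coset by (auto simp: bb_def m_assoc)
  qed
  define \<beta> where "\<beta> = (\<Sum>(d, f)\<in>R2 \<times> F'. len (bb d f))"
  have \<beta>: "len (bb d f) \<le> \<beta>" if "d \<in> R2" "f \<in> F'" for d f
    unfolding \<beta>_def using member_le_sum[of "(d, f)" "R2 \<times> F'" "\<lambda>(d, f). len (bb d f)"] that R2 F'(1,2) by simp
  obtain m0 where m0: "\<And>m n. m0 \<le> m \<Longrightarrow> n = (2 * w + 1) * m \<Longrightarrow>
      \<exists>F. finite F \<and> F \<subseteq> carrier G \<and> radii_choosable T w n F"
    by (rule radii_exist[OF T T_dist, of w]) blast+
  \<comment> \<open>\<open>m0\<close> is for the radii; \<beta> ensures that the defects of \<tau>
    are at most \<open>n\<close>.\<close>
  define m where "m = max m0 \<beta>"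
  define n where "n = (2 * w + 1) * m"
  have "1 * \<beta> \<le> n" unfolding n_def by (rule mult_le_mono) (auto simp: m_def)
  then have \<beta>n: "\<beta> \<le> n" by simp
  obtain F1 where F1: "finite F1" "F1 \<subseteq> carrier G" "hub_colorable U \<kappa> n C F1"
    using C[of n] by blast
  have "m0 \<le> m" by (simp add: m_def)
  then obtain F2 where F2: "finite F2" "F2 \<subseteq> carrier G" "radii_choosable T w n F2"
    using m0 n_def by blast
  \<comment> \<open>All possible positions of the points that the rule for \<open>D\<close> selects.
    Those lying in one coset of \<open>A\<close> are at distance at most \<open>n2\<close>, the
    scale of the second net.\<close>
  define P where "P = (\<lambda>(b, s). b \<otimes> s) ` (\<tau> ` B' \<times> S)"
  have P: "finite P" "P \<subseteq> carrier G" using a'(1,2) S \<tau>(1) by (auto simp: P_def subset_iff)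
  define n2 where "n2 = (\<Sum>(u, v)\<in>P \<times> P. len (u \<otimes> inv v))"
  have n2: "len (u \<otimes> inv v) \<le> n2" if "u \<in> P" "v \<in> P" for u v
    unfolding n2_def using member_le_sum[of "(u, v)" "P \<times> P" "\<lambda>(u, v). len (u \<otimes> inv v)"] that P by simp
  \<comment> \<open>Each of the four sets is fixed before the number \<open>N\<close> of colors, as
    \<open>rule_bound\<close> demands; the local rules obtained below may depend on
    \<open>N\<close>.\<close>
  define F where "F = len_ball n \<union> F1 \<union> F2 \<union> len_ball n2"
  have F: "finite F" "F \<subseteq> carrier G" using len_ball_finite F1(1,2) F2(1,2) by (auto simp: F_def len_ball_def)
  have main: "\<exists>B a. finite B \<and> B \<subseteq> carrier G \<and> range a \<subseteq> B \<and> local_fun G a \<and>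
        (\<forall>\<omega>. proper_coloring G (carrier G) F N \<omega> \<longrightarrow>
           card ((\<lambda>s. a (shift G s \<omega>) \<otimes> s) ` S) \<le> 2 ^ \<delta> * K * 6 ^ \<delta>)" for N
  proof -
    obtain \<Phi> where \<Phi>: "local_fun G \<Phi>"
      "\<And>\<omega>. proper_coloring G (carrier G) (len_ball n) N \<omega> \<Longrightarrow> net n (hubs \<Phi> \<omega>)"
      using net_exists[of n N] unfolding hubs_def by blast
    obtain \<Phi>2 where \<Phi>2: "local_fun G \<Phi>2"
      "\<And>\<omega>. proper_coloring G (carrier G) (len_ball n2) N \<omega> \<Longrightarrow> net n2 (hubs \<Phi>2 \<omega>)"
      using net_exists[of n2 N] unfolding hubs_def by blast
    obtain c where c: "local_fun G c" "\<And>\<omega>. c \<omega> \<le> C"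
      "\<And>\<omega>. proper_coloring G (carrier G) F1 N \<omega> \<Longrightarrow> net n (hubs \<Phi> \<omega>) \<Longrightarrow>
         hub_proper U (\<kappa> * n) (hubs \<Phi> \<omega>) (\<lambda>y. c (shift G y \<omega>))"
      using hub_colorableD[OF F1(3) \<Phi>(1), of N] by blast
    obtain \<rho> where \<rho>: "local_fun G \<rho>" "\<And>\<omega>. n \<le> \<rho> \<omega>" "\<And>\<omega>. \<rho> \<omega> \<le> 2 * n"
      "\<And>\<omega>. proper_coloring G (carrier G) F2 N \<omega> \<Longrightarrow> net n (hubs \<Phi> \<omega>) \<Longrightarrow>
          few_crossings T w (hubs \<Phi> \<omega>) (\<lambda>y. \<rho> (shift G y \<omega>))"
      using radii_choosableD[OF F2(3) \<Phi>(1), of N] by blast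
    \<comment> \<open>Among the balls containing the position \<open>\<one>\<close>, the one of
      least color decides. Radii are at most \<open>2 * n\<close>, so the search is finite.\<close>
    define col where "col \<omega> = Min {c (shift G v \<omega>) | v. v \<in> len_ball (2 * n) \<and> \<Phi> (shift G v \<omega>) \<and> len v \<le> \<rho> (shift G v \<omega>)}" for \<omega>
    define cfg where "cfg \<omega> d = (if d \<in> carrier D then col (shift G (\<tau> d) \<omega>) else 0)" for \<omega> d
    define \<theta> where "\<theta> \<omega> = \<tau> (a' (cfg \<omega>))" for \<omega>
    define pick where "pick b \<omega> = (if \<exists>v\<in>len_ball n2. \<Phi>2 (shift G (v \<otimes> b) \<omega>)
      then (SOME v. v \<in> len_ball n2 \<and> \<Phi>2 (shift G (v \<otimes> b) \<omega>)) \<otimes> b else \<one>)" for b \<omega>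
    \<comment> \<open>The case distinction presents \<open>a\<close> as a finite family of local
      functions \<open>pick b\<close>, evaluated at the local index \<theta>.\<close>
    define a where "a \<omega> = (if \<theta> \<omega> \<in> \<tau> ` B' then pick (\<theta> \<omega>) \<omega> else \<one>)" for \<omega>
    define B where "B = insert \<one> ((\<lambda>(v, b). v \<otimes> b) ` (len_ball n2 \<times> \<tau> ` B'))"
    have \<tau>B: "\<tau> ` B' \<subseteq> carrier G" using a'(2) \<tau>(1) by auto
    have lb: "len_ball k \<subseteq> carrier G" for k by (auto simp: len_ball_def)
    have B: "finite B" "B \<subseteq> carrier G" using len_ball_finite a'(1) \<tau>B lb by (auto simp: B_def subset_iff)
    have pick_B: "pick b \<omega> \<in> B" if b: "b \<in> \<tau> ` B'" for b \<omega>
    proof (cases "\<exists>v\<in>len_ball n2. \<Phi>2 (shift G (v \<otimes> b) \<omega>)")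
      case True
      then have "(SOME v. v \<in> len_ball n2 \<and> \<Phi>2 (shift G (v \<otimes> b) \<omega>)) \<in> len_ball n2"
        using someI_ex[of "\<lambda>v. v \<in> len_ball n2 \<and> \<Phi>2 (shift G (v \<otimes> b) \<omega>)"] by blast
      then show ?thesis using True b by (auto simp: pick_def B_def)
    next
      case False then show ?thesis unfolding pick_def B_def by simp
    qed
    have "range a \<subseteq> B" using pick_B by (auto simp: a_def B_def)
    have col_local: "local_fun G col"
    proof (rule local_fun_family[where V = "len_ball (2 * n)" and \<Phi> = "\<lambda>v \<omega>. (\<Phi> (shift G v \<omega>), c (shift G v \<omega>), \<rho> (shift G v \<omega>))"])
      fix v assume "v \<in> len_ball (2 * n)"
      then have v: "v \<in> carrier G" using lb by auto
      show "local_fun G (\<lambda>\<omega>. (\<Phi> (shift G v \<omega>), c (shift G v \<omega>), \<rho> (shift G v \<omega>)))"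
        by (rule local_fun_comp2[OF local_fun_shift[OF \<Phi>(1) v] local_fun_comp2[OF local_fun_shift[OF c(1) v] local_fun_shift[OF \<rho>(1) v]]])
    next
      fix \<omega> \<omega>' assume "\<And>v. v \<in> len_ball (2 * n) \<Longrightarrow> (\<Phi> (shift G v \<omega>), c (shift G v \<omega>), \<rho> (shift G v \<omega>)) =
        (\<Phi> (shift G v \<omega>'), c (shift G v \<omega>'), \<rho> (shift G v \<omega>'))"
      then show "col \<omega> = col \<omega>'" unfolding col_def by (intro arg_cong[where f = Min]) force
    qed (rule len_ball_finite)
    have \<theta>_local: "local_fun G \<theta>"
    proof (rule local_fun_family[where V = W' and \<Phi> = "\<lambda>d \<omega>. col (shift G (\<tau> d) \<omega>)"])
      fix d assume "d \<in> W'"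
      then show "local_fun G (\<lambda>\<omega>. col (shift G (\<tau> d) \<omega>))" using W'(2) \<tau>(1) by (intro local_fun_shift[OF col_local]) auto
    next
      fix \<omega> \<omega>' assume *: "\<And>d. d \<in> W' \<Longrightarrow> col (shift G (\<tau> d) \<omega>) = col (shift G (\<tau> d) \<omega>')"
      have "a' (cfg \<omega>) = a' (cfg \<omega>')" by (rule W'(3)) (use * in \<open>auto simp: cfg_def\<close>)
      then show "\<theta> \<omega> = \<theta> \<omega>'" by (simp add: \<theta>_def)
    qed (rule W'(1))
    have pick_local: "local_fun G (pick b)" if b: "b \<in> \<tau> ` B'" for b
    proof (rule local_fun_family[where V = "len_ball n2" and \<Phi> = "\<lambda>v \<omega>. \<Phi>2 (shift G (v \<otimes> b) \<omega>)"])
      fix v assume "v \<in> len_ball n2"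
      then have "v \<otimes> b \<in> carrier G" using lb \<tau>B b by (intro m_closed) (auto simp: subset_iff)
      then show "local_fun G (\<lambda>\<omega>. \<Phi>2 (shift G (v \<otimes> b) \<omega>))" by (rule local_fun_shift[OF \<Phi>2(1)])
    next
      fix \<omega> \<omega>' assume *: "\<And>v. v \<in> len_ball n2 \<Longrightarrow> \<Phi>2 (shift G (v \<otimes> b) \<omega>) = \<Phi>2 (shift G (v \<otimes> b) \<omega>')"
      then have "(\<lambda>v. v \<in> len_ball n2 \<and> \<Phi>2 (shift G (v \<otimes> b) \<omega>)) = (\<lambda>v. v \<in> len_ball n2 \<and> \<Phi>2 (shift G (v \<otimes> b) \<omega>'))" by auto
      then show "pick b \<omega> = pick b \<omega>'" unfolding pick_def using * by simp
    qed (rule len_ball_finite)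
    have a_local: "local_fun G a"
    proof -
      have "local_fun G (\<lambda>\<omega>. (\<lambda>b. if b \<in> \<tau> ` B' then pick b \<omega> else \<one>) (\<theta> \<omega>))"
        by (rule local_fun_app[OF local_fun_lambda \<theta>_local]) (use a'(1) pick_local in auto)
      moreover have "a = (\<lambda>\<omega>. (\<lambda>b. if b \<in> \<tau> ` B' then pick b \<omega> else \<one>) (\<theta> \<omega>))"
        unfolding a_def by (rule refl)
      ultimately show ?thesis by simp
    qed
    have "card ((\<lambda>s. a (shift G s \<omega>) \<otimes> s) ` S) \<le> 2 ^ \<delta> * K * 6 ^ \<delta>"
      if p: "proper_coloring G (carrier G) F N \<omega>" for \<omega>
    proof -
      let ?Y = "hubs \<Phi> \<omega>"
      let ?Y2 = "hubs \<Phi>2 \<omega>"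
      let ?c = "\<lambda>y. c (shift G y \<omega>)"
      let ?\<rho> = "\<lambda>y. \<rho> (shift G y \<omega>)"
      have Y: "net n ?Y" by (rule \<Phi>(2)[OF proper_coloring_mono[OF p]]) (auto simp: F_def)
      have Y2: "net n2 ?Y2" by (rule \<Phi>2(2)[OF proper_coloring_mono[OF p]]) (auto simp: F_def)
      have hp: "hub_proper U (\<kappa> * n) ?Y ?c"
        by (rule c(3)[OF proper_coloring_mono[OF p] Y]) (auto simp: F_def)
      have cross: "finite (crossings T w ?Y ?\<rho> \<one>)" "card (crossings T w ?Y ?\<rho> \<one>) \<le> \<delta>"
        using \<rho>(4)[OF proper_coloring_mono[OF p] Y] one_closed by (auto simp: F_def few_crossings_def)
      define I where "I g = {y \<in> ?Y. near (?\<rho> y) y g}" for g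
      define clr where "clr g = Min (?c ` I g)" for g
      have col_clr: "col (shift G g \<omega>) = clr g" if g: "g \<in> carrier G" for g
      proof -
        have "{c (shift G v (shift G g \<omega>)) | v. v \<in> len_ball (2 * n) \<and> \<Phi> (shift G v (shift G g \<omega>)) \<and> len v \<le> \<rho> (shift G v (shift G g \<omega>))}
           = ?c ` I g"
        proof (intro equalityI subsetI)
          fix k assume "k \<in> {c (shift G v (shift G g \<omega>)) | v. v \<in> len_ball (2 * n) \<and> \<Phi> (shift G v (shift G g \<omega>)) \<and> len v \<le> \<rho> (shift G v (shift G g \<omega>))}"
          then obtain v where v: "v \<in> A" "\<Phi> (shift G v (shift G g \<omega>))" "len v \<le> \<rho> (shift G v (shift G g \<omega>))" "k = c (shift G v (shift G g \<omega>))"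
            by (auto simp: len_ball_def)
          have "near (?\<rho> (v \<otimes> g)) g (v \<otimes> g)" using v g by (simp add: near_def m_assoc shift_shift)
          then have "v \<otimes> g \<in> I g" using v g near_sym by (auto simp: I_def hubs_def shift_shift)
          then show "k \<in> ?c ` I g" using v g by (auto simp: shift_shift)
        next
          fix k assume "k \<in> ?c ` I g"
          then obtain y where y: "y \<in> carrier G" "\<Phi> (shift G y \<omega>)" "near (?\<rho> y) g y" "k = ?c y"
            using near_sym by (auto simp: I_def hubs_def)
          have v: "(y \<otimes> inv g) \<otimes> g = y" "y \<otimes> inv g \<in> carrier G" using y g by (simp_all add: m_assoc)
          have "y \<otimes> inv g \<in> len_ball (2 * n)" "len (y \<otimes> inv g) \<le> ?\<rho> y"
            using y \<rho>(3)[of "shift G y \<omega>"] by (auto simp: near_def len_ball_def)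
          then show "k \<in> {c (shift G v (shift G g \<omega>)) | v. v \<in> len_ball (2 * n) \<and> \<Phi> (shift G v (shift G g \<omega>)) \<and> len v \<le> \<rho> (shift G v (shift G g \<omega>))}"
            using v y g by (intro CollectI exI[of _ "y \<otimes> inv g"]) (simp add: shift_shift)
        qed
        then show ?thesis unfolding col_def clr_def by simp
      qed
      have Yc: "?Y \<subseteq> carrier G" by (auto simp: hubs_def)
      have attain: "\<exists>y\<in>?Y. near (2 * n) y g \<and> ?c y = clr g" if g: "g \<in> carrier G" for g
      proof -
        have sub: "I g \<subseteq> {y. near (2 * n) g y}"
          using near_mono[OF _ \<rho>(3)] near_sym by (auto simp: I_def)
        have fin: "finite (I g)" by (rule finite_subset[OF sub near_finite[OF g]])
        obtain y where "y \<in> ?Y" "near n g y" using Y g by (auto simp: net_def)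
        then have "y \<in> I g" using near_mono[OF _ \<rho>(2)] near_sym by (auto simp: I_def)
        then have "clr g \<in> ?c ` I g" unfolding clr_def using fin by (intro Min_in) auto
        then obtain y' where "y' \<in> I g" "?c y' = clr g" by auto
        moreover have "near (2 * n) g y'" using sub \<open>y' \<in> I g\<close> by blast
        ultimately show ?thesis using near_sym by (auto simp: I_def)
      qed
      have cfg_eq: "cfg (shift G s \<omega>) d = clr (\<tau> d \<otimes> s)" if "s \<in> carrier G" "d \<in> carrier D" for s d
        using that \<tau> col_clr by (simp add: cfg_def shift_shift)
      have cfg_less: "cfg (shift G s \<omega>) d < Suc C" if sd: "s \<in> carrier G" "d \<in> carrier D" for s d
        using attain[of "\<tau> d \<otimes> s"] c(2) cfg_eq[OF sd] \<tau> sd by (metis less_Suc_eq_le m_closed)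
      \<comment> \<open>The two colors are those of hubs in the two cosets, and these hubs conflict:
        all distances on the way add up to at most \<open>\<kappa> * n\<close>.\<close>
      have cfg_proper: "cfg (shift G s \<omega>) (f \<otimes>\<^bsub>D\<^esub> d) \<noteq> cfg (shift G s \<omega>) d"
        if s: "s \<in> carrier G" and d: "d \<in> R2" and f: "f \<in> F'" "f \<noteq> \<one>\<^bsub>D\<^esub>" for s d f
      proof -
        have dc: "d \<in> carrier D" "f \<in> carrier D" using d f R2 F'(2) by auto
        let ?g = "\<tau> d \<otimes> s" and ?g' = "\<tau> (f \<otimes>\<^bsub>D\<^esub> d) \<otimes> s"
        have gc: "?g \<in> carrier G" "?g' \<in> carrier G" "\<tau> f \<in> carrier G" "\<tau> d \<in> carrier G" using dc s \<tau> by auto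
        have u: "\<tau> f \<in> U" using f by (auto simp: U_def)
        obtain y where y: "y \<in> ?Y" "near (2 * n) y ?g" "?c y = clr ?g" using attain[OF gc(1)] by blast
        obtain y' where y': "y' \<in> ?Y" "near (2 * n) y' ?g'" "?c y' = clr ?g'" using attain[OF gc(2)] by blast
        have "near (lip (\<tau> f) * (2 * n)) (\<tau> f \<otimes> y) (\<tau> f \<otimes> ?g)" using near_translate[OF y(2) gc(3)] .
        moreover have "near n (\<tau> f \<otimes> ?g) ?g'"
        proof -
          have "bb d f \<in> len_ball n" using bb[OF dc] \<beta>[OF d f(1)] \<beta>n by (simp add: len_ball_def)
          then have "near n (\<tau> f \<otimes> ?g) (bb d f \<otimes> (\<tau> f \<otimes> ?g))" using gc by (intro near_ball) auto
          moreover have "bb d f \<otimes> (\<tau> f \<otimes> ?g) = ?g'"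
            using bb[OF dc] gc s by (metis A_carrier m_assoc m_closed)
          ultimately show ?thesis by simp
        qed
        ultimately have "near (lip (\<tau> f) * (2 * n) + n + 2 * n) (\<tau> f \<otimes> y) y'"
          using near_trans near_sym[OF y'(2)] by blast
        moreover have "lip (\<tau> f) * (2 * n) + n + 2 * n = (2 * lip (\<tau> f) + 3) * n" by (simp add: algebra_simps)
        ultimately have nr: "near (\<kappa> * n) (\<tau> f \<otimes> y) y'" using \<kappa>[OF u] near_mono mult_le_mono1 by metis
        have "y \<noteq> y'"
        proof
          assume "y = y'"
          then have yc: "y \<in> carrier G" and "y \<otimes> inv (\<tau> f \<otimes> y) \<in> A" using nr y Yc by (auto simp: near_def)
          then have "inv (\<tau> f) \<in> A" using gc by (simp add: inv_mult_group m_assoc[symmetric])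
          then have "inv (inv (\<tau> f)) \<in> A" by (rule A.m_inv_closed)
          then show False using ker[of "\<tau> f"] gc f \<tau> dc by simp
        qed
        then have "?c y \<noteq> ?c y'" using hp y y' u nr unfolding hub_proper_def by blast
        then show ?thesis using cfg_eq s dc y y' by simp
      qed
      define Cr where "Cr = crossings T w ?Y ?\<rho> \<one>"
      define e where "e s = {(t, y) \<in> Cr. near (?\<rho> y) y (pp t s)}" for s
      have card_e: "card (e ` S) \<le> 2 ^ \<delta>"
      proof -
        have "card (e ` S) \<le> card (Pow Cr)" using cross by (intro card_mono) (auto simp: e_def Cr_def)
        also have "\<dots> = 2 ^ card Cr" using cross by (simp add: card_Pow Cr_def)
        also have "\<dots> \<le> 2 ^ \<delta>" using cross by (intro power_increasing) (auto simp: Cr_def)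
        finally show ?thesis .
      qed
      \<comment> \<open>Since \<open>t\<close> and \<open>pp t s\<close> are at distance at most
        \<open>w\<close>, a sphere separating them passes within \<open>w\<close> of
        \<open>t\<close> and is recorded in \<open>Cr\<close>.\<close>
      have I_pp: "near (?\<rho> y) y (pp t s) \<longleftrightarrow> near (?\<rho> y) y t"
        if y: "y \<in> ?Y" "t \<in> T" "s \<in> S" "(t, y) \<notin> Cr" for y t s
      proof -
        have cc: "y \<in> carrier G" "t \<in> carrier G" "s \<in> carrier G" using y T S Yc by auto
        note cc = cc pp[OF cc(2,3)]
        have nw: "near w t (pp t s)" "near w (pp t s) t"
          using w[OF y(2,3)] cc near_sym[of w t "pp t s"] by (auto simp: near_def)
        have nth: "\<not> thick w (?\<rho> y) y t" using y cc by (auto simp: Cr_def crossings_def)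
        show ?thesis
        proof
          assume n1: "near (?\<rho> y) y (pp t s)"
          have "near (?\<rho> y + w) y t" by (rule near_trans[OF n1 nw(2)])
          then show "near (?\<rho> y) y t" using nth by (auto simp: near_def thick_def)
        next
          assume n1: "near (?\<rho> y) y t"
          then have "near (?\<rho> y - w) y t" using nth by (auto simp: near_def thick_def)
          from near_trans[OF this nw(1)] have n2: "near (?\<rho> y - w + w) y (pp t s)" .
          show "near (?\<rho> y) y (pp t s)"
          \<comment> \<open>The subtraction is truncated. If \<open>w\<close> exceeds the radius,
            every point inside the ball is within \<open>w\<close> of its sphere, which
            \<open>nth\<close> excludes.\<close>
          proof (cases "w \<le> ?\<rho> y")
            case True
            then show ?thesis using n2 by simp
          next
            case False
            then show ?thesis using n1 nth by (auto simp: near_def thick_def)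
          qed
        qed
      qed
      \<comment> \<open>The index \<open>d\<close> seen from \<open>s\<close> and the displayed
        index seen from \<open>s0\<close> denote the same coset, that of some
        \<open>t \<in> T\<close>; it is read at \<open>pp t s\<close> and at \<open>pp t s0\<close>,
        which lie in the same balls.\<close>
      have cfg_same: "cfg (shift G s \<omega>) d = cfg (shift G s0 \<omega>) (d \<otimes>\<^bsub>D\<^esub> \<pi> s \<otimes>\<^bsub>D\<^esub> inv\<^bsub>D\<^esub> \<pi> s0)"
        if ss: "s \<in> S" "s0 \<in> S" "e s = e s0" and d: "d \<in> W'" for s s0 d
      proof -
        have cc: "s \<in> carrier G" "s0 \<in> carrier G" "d \<in> carrier D" using ss d S W'(2) by auto
        let ?t = "\<tau> (d \<otimes>\<^bsub>D\<^esub> \<pi> s)"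
        have t: "?t \<in> T" "\<pi> ?t = d \<otimes>\<^bsub>D\<^esub> \<pi> s" using d ss cc \<tau> by (auto simp: T_def S'_def)
        have "\<pi> ?t \<otimes>\<^bsub>D\<^esub> inv\<^bsub>D\<^esub> \<pi> s = d" using t cc by (simp add: D.m_assoc)
        then have pps: "pp ?t s = \<tau> d \<otimes> s" "pp ?t s0 = \<tau> (d \<otimes>\<^bsub>D\<^esub> \<pi> s \<otimes>\<^bsub>D\<^esub> inv\<^bsub>D\<^esub> \<pi> s0) \<otimes> s0"
          using t by (simp_all add: pp_def)
        have "near (?\<rho> y) y (pp ?t s) \<longleftrightarrow> near (?\<rho> y) y (pp ?t s0)" if y: "y \<in> ?Y" for y
        proof (cases "(?t, y) \<in> Cr")
          case True
          then show ?thesis using ss(3) unfolding e_def by blast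
        next
          case False
          then show ?thesis using I_pp[OF y t(1)] ss by simp
        qed
        then have "I (pp ?t s) = I (pp ?t s0)" by (auto simp: I_def)
        then have "clr (pp ?t s) = clr (pp ?t s0)" by (simp add: clr_def)
        then show ?thesis using cfg_eq cc unfolding pps by simp
      qed
      define pt where "pt s = \<theta> (shift G s \<omega>) \<otimes> s" for s
      have a'c: "a' \<eta> \<in> carrier D" "a' \<eta> \<in> B'" for \<eta> using a'(2,3) by auto
      have pt: "pt s \<in> P" "\<pi> (pt s) = a' (cfg (shift G s \<omega>)) \<otimes>\<^bsub>D\<^esub> \<pi> s" if "s \<in> S" for s
        using that S a'c \<tau>[OF a'c(1)] by (auto simp: pt_def \<theta>_def P_def)
      have class_card: "card ((\<lambda>s. \<pi> (pt s)) ` {s \<in> S. e s = q}) \<le> K" if q: "q \<in> e ` S" for q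
      proof -
        obtain s0 where s0: "s0 \<in> S" "q = e s0" using q by blast
        have s0c: "s0 \<in> carrier G" using s0 S by auto
        \<comment> \<open>The coloring of \<open>D\<close> common to the class, in coordinates
          independent of the observer: \<open>s\<close> sees it shifted by \<open>\<pi> s\<close>,
          as far as the window \<open>W'\<close> reaches.\<close>
        define \<eta> where "\<eta> = shift D (inv\<^bsub>D\<^esub> \<pi> s0) (cfg (shift G s0 \<omega>))"
        have \<eta>: "\<eta> d = cfg (shift G s0 \<omega>) (d \<otimes>\<^bsub>D\<^esub> inv\<^bsub>D\<^esub> \<pi> s0)" if "d \<in> carrier D" for d
          using that by (simp add: \<eta>_def shift_def)
        have "proper_coloring D R' F' (Suc C) \<eta>"
          unfolding proper_coloring_def
        proof (intro conjI ballI impI)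
          fix d assume "d \<in> carrier D"
          then show "\<eta> d < Suc C" using \<eta> cfg_less[OF s0c] s0c by simp
        next
          fix d f assume df: "d \<in> R'" "f \<in> F'" "f \<noteq> \<one>\<^bsub>D\<^esub>"
          have dc: "d \<in> carrier D" "f \<in> carrier D" using df R'(2) F'(2) by auto
          have "d \<otimes>\<^bsub>D\<^esub> inv\<^bsub>D\<^esub> \<pi> s0 \<in> R2" using df s0 by (auto simp: R2_def S'_def)
          from cfg_proper[OF s0c this df(2,3)] show "\<eta> (f \<otimes>\<^bsub>D\<^esub> d) \<noteq> \<eta> d"
            using \<eta> dc s0c by (simp add: D.m_assoc)
        qed
        then have bd: "card ((\<lambda>s. a' (shift D s \<eta>) \<otimes>\<^bsub>D\<^esub> s) ` S') \<le> K" by (rule R'(3))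
        have "\<pi> (pt s) \<in> (\<lambda>s. a' (shift D s \<eta>) \<otimes>\<^bsub>D\<^esub> s) ` S'" if s: "s \<in> S" "e s = q" for s
        proof -
          have sc: "s \<in> carrier G" using s S by auto
          have "a' (cfg (shift G s \<omega>)) = a' (shift D (\<pi> s) \<eta>)"
          proof (rule W'(3), intro ballI)
            fix d assume d: "d \<in> W'"
            then have dc: "d \<in> carrier D" using W'(2) by auto
            show "cfg (shift G s \<omega>) d = shift D (\<pi> s) \<eta> d"
              using cfg_same[OF s(1) s0(1) _ d] s s0 \<eta> dc sc by (simp add: D.shift_apply)
          qed
          then show ?thesis using pt[OF s(1)] s by (auto simp: S'_def)
        qed
        then have "(\<lambda>s. \<pi> (pt s)) ` {s \<in> S. e s = q} \<subseteq> (\<lambda>s. a' (shift D s \<eta>) \<otimes>\<^bsub>D\<^esub> s) ` S'" by auto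
        then have "card ((\<lambda>s. \<pi> (pt s)) ` {s \<in> S. e s = q}) \<le> card ((\<lambda>s. a' (shift D s \<eta>) \<otimes>\<^bsub>D\<^esub> s) ` S')"
          using S' by (intro card_mono) auto
        then show ?thesis using bd by linarith
      qed
      have "card ((\<lambda>s. \<pi> (pt s)) ` S) \<le> card (e ` S) * K"
        by (rule card_image_le_fibres[OF S(1) class_card])
      also have "\<dots> \<le> 2 ^ \<delta> * K" using card_e by (rule mult_le_mono1)
      finally have card_pt: "card ((\<lambda>s. \<pi> (pt s)) ` S) \<le> 2 ^ \<delta> * K" .
      have hub: "a (shift G s \<omega>) \<otimes> s \<in> ?Y2" "near n2 (pt s) (a (shift G s \<omega>) \<otimes> s)" if s: "s \<in> S" for s
      proof -
        let ?b = "\<theta> (shift G s \<omega>)"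
        have sc: "s \<in> carrier G" using s S by auto
        have b: "?b \<in> \<tau> ` B'" "?b \<in> carrier G" using a'c \<tau> by (auto simp: \<theta>_def)
        have pc: "pt s \<in> carrier G" using b sc by (simp add: pt_def)
        obtain y where y: "y \<in> ?Y2" "near n2 (pt s) y" using Y2 pc by (auto simp: net_def)
        have yc: "y \<in> carrier G" using y by (simp add: hubs_def)
        let ?v = "y \<otimes> inv (pt s)"
        have vb: "?v \<otimes> ?b \<otimes> s = y" using yc pc b sc by (simp add: pt_def[symmetric] m_assoc)
        have "?v \<in> len_ball n2" using y by (auto simp: near_def len_ball_def)
        moreover have "\<Phi>2 (shift G (?v \<otimes> ?b) (shift G s \<omega>))"
          using y vb yc pc b sc by (simp add: shift_shift hubs_def)
        ultimately have ex: "\<exists>v. v \<in> len_ball n2 \<and> \<Phi>2 (shift G (v \<otimes> ?b) (shift G s \<omega>))" by blast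
        define v where "v = (SOME v. v \<in> len_ball n2 \<and> \<Phi>2 (shift G (v \<otimes> ?b) (shift G s \<omega>)))"
        have v: "v \<in> len_ball n2" "\<Phi>2 (shift G (v \<otimes> ?b) (shift G s \<omega>))"
          using someI_ex[OF ex] unfolding v_def by auto
        have vc: "v \<in> carrier G" using v lb by auto
        have av: "a (shift G s \<omega>) = v \<otimes> ?b" using b ex unfolding a_def pick_def v_def by auto
        show "a (shift G s \<omega>) \<otimes> s \<in> ?Y2" unfolding av using v vc b sc by (simp add: hubs_def shift_shift)
        have "near n2 (pt s) (v \<otimes> pt s)" by (rule near_ball[OF v(1) pc])
        then show "near n2 (pt s) (a (shift G s \<omega>) \<otimes> s)" unfolding av using vc b sc by (simp add: pt_def m_assoc)
      qed
      have "card ((\<lambda>s. a (shift G s \<omega>) \<otimes> s) ` S) \<le> card ((\<lambda>s. \<pi> (pt s)) ` S) * 6 ^ \<delta>"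
      proof (rule card_image_le_fibres[OF S(1)])
        fix q assume "q \<in> (\<lambda>s. \<pi> (pt s)) ` S"
        then obtain s0 where s0: "s0 \<in> S" "q = \<pi> (pt s0)" by blast
        have p0: "pt s0 \<in> carrier G" using pt[OF s0(1)] P by auto
        have "(\<lambda>s. a (shift G s \<omega>) \<otimes> s) ` {s \<in> S. \<pi> (pt s) = q} \<subseteq> {y \<in> ?Y2. near (2 * n2) (pt s0) y}"
        proof (rule image_subsetI)
          fix s assume s: "s \<in> {s \<in> S. \<pi> (pt s) = q}"
          then have ps: "pt s \<in> P" "pt s0 \<in> P" "pt s \<in> carrier G" using pt s0 P by auto
          have "near n2 (pt s0) (pt s)" using coset[OF ps(3) p0] s s0 n2[OF ps(1,2)] ps p0 by (auto simp: near_def)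
          from near_trans[OF this hub(2)] have "near (n2 + n2) (pt s0) (a (shift G s \<omega>) \<otimes> s)" using s by auto
          then show "a (shift G s \<omega>) \<otimes> s \<in> {y \<in> ?Y2. near (2 * n2) (pt s0) y}"
            using hub(1) s by (simp add: mult_2)
        qed
        then have "card ((\<lambda>s. a (shift G s \<omega>) \<otimes> s) ` {s \<in> S. \<pi> (pt s) = q}) \<le> card {y \<in> ?Y2. near (2 * n2) (pt s0) y}"
          using net_count(1)[OF Y2 p0] by (rule card_mono[rotated])
        \<comment> \<open>Selected points of one coset are at most \<open>n2\<close> apart and move
          by at most \<open>n2\<close> to the net, so the net is counted at ratio 2, with base
          \<open>2 * 2 + 2\<close>.\<close>
        also have "\<dots> \<le> 6 ^ \<delta>" using net_count(2)[OF Y2 p0, of 2] by simp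
        finally show "card ((\<lambda>s. a (shift G s \<omega>) \<otimes> s) ` {s \<in> S. \<pi> (pt s) = q}) \<le> 6 ^ \<delta>" .
      qed
      also have "\<dots> \<le> 2 ^ \<delta> * K * 6 ^ \<delta>" using card_pt by (rule mult_le_mono1)
      finally show ?thesis .
    qed
    then show ?thesis using B \<open>range a \<subseteq> B\<close> a_local by blast
  qed
  show "\<exists>F. finite F \<and> F \<subseteq> carrier G \<and> (\<forall>N. \<exists>B a. finite B \<and> B \<subseteq> carrier G \<and>
        range a \<subseteq> B \<and> local_fun G a \<and>
        (\<forall>\<omega>. proper_coloring G (carrier G) F N \<omega> \<longrightarrow>
           card ((\<lambda>s. a (shift G s \<omega>) \<otimes> s) ` S) \<le> 2 ^ \<delta> * K * 6 ^ \<delta>))"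
    using F main by blast
qed

end

section \<open>Polycyclic series\<close>

text \<open>A finitely generated abelian factor, expressed inside \<open>G\<close> by cosets and
  relative generators, so that it can be intersected and multiplied with subgroups directly.\<close>

definition abelian_step :: "('g, 'b) monoid_scheme \<Rightarrow> 'g set \<Rightarrow> 'g set \<Rightarrow> bool" where
  "abelian_step G A M \<longleftrightarrow> M \<subseteq> A \<and> A \<lhd> G \<and> M \<lhd> G \<and>
     (\<forall>a\<in>A. \<forall>b\<in>A. M #>\<^bsub>G\<^esub> (a \<otimes>\<^bsub>G\<^esub> b) = M #>\<^bsub>G\<^esub> (b \<otimes>\<^bsub>G\<^esub> a)) \<and>
     (\<exists>T. finite T \<and> T \<subseteq> A \<and> A = generate G (T \<union> M))"

definition noetherian :: "('g, 'b) monoid_scheme \<Rightarrow> 'g set \<Rightarrow> bool" where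
  "noetherian G A \<longleftrightarrow> (\<forall>H. subgroup H G \<and> H \<subseteq> A \<longrightarrow> (\<exists>T. finite T \<and> T \<subseteq> H \<and> H = generate G T))"

lemma rule_bound_trivial:
  fixes G (structure)
  assumes "group G" "carrier G = {\<one>\<^bsub>G\<^esub>}"
  shows "rule_bound 1 G"
proof -
  interpret group G by fact
  have "card ((\<lambda>s. \<one> \<otimes> s) ` S) \<le> 1" if "S \<subseteq> carrier G" for S
  proof -
    have "(\<lambda>s. \<one> \<otimes> s) ` S \<subseteq> {\<one>}" using that assms(2) by auto
    then show ?thesis using card_mono[of "{\<one>}"] by fastforce
  qed
  then have "\<forall>N. \<exists>B a. finite B \<and> B \<subseteq> carrier G \<and> range a \<subseteq> B \<and> local_fun G a \<and>
        (\<forall>\<omega>. proper_coloring G (carrier G) {} N \<omega> \<longrightarrow> card ((\<lambda>s. a (shift G s \<omega>) \<otimes> s) ` S) \<le> 1)"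
    if "S \<subseteq> carrier G" for S
    using that by (intro allI exI[of _ "{\<one>}"] exI[of _ "\<lambda>_. \<one>"]) (auto intro: local_fun_const)
  then show ?thesis unfolding rule_bound_def by (intro allI impI exI[of _ "{}"]) auto
qed

section \<open>Induction along an abelian series\<close>

context group
begin

lemma rcos_eq_iff:
  assumes "subgroup M G" "x \<in> carrier G" "y \<in> carrier G"
  shows "M #> x = M #> y \<longleftrightarrow> x \<otimes> inv y \<in> M"
proof
  assume "M #> x = M #> y"
  then have "M #> (x \<otimes> inv y) = M" using coset_mult_inv2 assms subgroup.subset by blast
  then show "x \<otimes> inv y \<in> M" using coset_join1 assms by blast
next
  assume "x \<otimes> inv y \<in> M"
  then have "(x \<otimes> inv y) \<otimes> y \<in> M #> y" using assms subgroup.subset by (intro rcosI) auto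
  then have "x \<in> M #> y" using assms by (simp add: m_assoc)
  then show "M #> x = M #> y" using repr_independence assms by metis
qed

lemma rcos_absorb:
  assumes "M \<lhd> G" "m \<in> M" "x \<in> carrier G"
  shows "M #> (m \<otimes> x) = M #> x" "M #> (x \<otimes> m) = M #> x"
proof -
  interpret M: normal M G by fact
  have mc: "m \<in> carrier G" using assms M.subset by auto
  have "M #> m = M" using coset_join2[OF mc M.subgroup_axioms assms(2)] .
  moreover have "M #> x \<in> rcosets M" using assms M.subset by (intro rcosetsI) auto
  ultimately show "M #> (m \<otimes> x) = M #> x"
    using M.rcos_sum[OF mc assms(3)] M.rcosets_mult_eq by simp
  have "(x \<otimes> m) \<otimes> inv x \<in> M" using M.inv_op_closed2 assms by simp
  then show "M #> (x \<otimes> m) = M #> x" using rcos_eq_iff[OF M.subgroup_axioms] assms mc by simp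
qed

text \<open>In \<open>G Mod M\<close> the image of \<open>A\<close> is a finitely generated abelian
  normal subgroup with quotient \<open>G Mod A\<close>, which is the situation of the extension
  theorem.\<close>

lemma rule_bound_step:
  assumes step: "abelian_step G A M" and K: "rule_bound K (G Mod A)"
  shows "\<exists>K'. rule_bound K' (G Mod M)"
proof -
  have MA: "M \<subseteq> A" and A: "A \<lhd> G" and M: "M \<lhd> G"
    and comm: "\<And>a b. a \<in> A \<Longrightarrow> b \<in> A \<Longrightarrow> M #> (a \<otimes> b) = M #> (b \<otimes> a)"
    using step by (auto simp: abelian_step_def)
  obtain T where T: "finite T" "T \<subseteq> A" "A = generate G (T \<union> M)"
    using step by (auto simp: abelian_step_def)
  interpret A: normal A G by (rule A)
  interpret M: normal M G by (rule M)
  let ?\<Gamma> = "G Mod M" and ?D = "G Mod A"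
  interpret \<Gamma>: group ?\<Gamma> by (rule M.factorgroup_is_group)
  interpret D: group ?D by (rule A.factorgroup_is_group)
  \<comment> \<open>For a coset \<open>Z\<close> of \<open>M\<close> this product is the coset of
    \<open>A\<close> that contains it.\<close>
  define \<pi> where "\<pi> Z = A <#> Z" for Z
  have \<pi>: "\<pi> (M #> x) = A #> x" if "x \<in> carrier G" for x
  proof -
    have "A <#> (M #> x) = (A <#> M) #> x"
      using setmult_rcos_assoc[OF A.subset M.subset that] .
    moreover have "A <#> M = A"
    proof
      show "A <#> M \<subseteq> A" using MA by (auto simp: set_mult_def)
      show "A \<subseteq> A <#> M"
      proof
        fix a assume a: "a \<in> A"
        then have "a = a \<otimes> \<one>" using A.subset by auto
        then show "a \<in> A <#> M" using a M.one_closed unfolding set_mult_def by blast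
      qed
    qed
    ultimately show ?thesis by (simp add: \<pi>_def)
  qed
  have car\<Gamma>: "carrier ?\<Gamma> = (\<lambda>x. M #> x) ` carrier G" and carD: "carrier ?D = (\<lambda>x. A #> x) ` carrier G"
    by (simp_all add: carrier_FactGroup)
  have \<pi>_hom: "\<pi> \<in> hom ?\<Gamma> ?D"
    unfolding car\<Gamma> hom_def carD using \<pi> by (auto simp: M.rcos_sum A.rcos_sum)
  have \<pi>_surj: "\<pi> ` carrier ?\<Gamma> = carrier ?D"
    unfolding car\<Gamma> carD image_image using \<pi> by (intro image_cong) auto
  define A' where "A' = (\<lambda>a. M #> a) ` A"
  have ker: "\<pi> Z = \<one>\<^bsub>?D\<^esub> \<longleftrightarrow> Z \<in> A'" if "Z \<in> carrier ?\<Gamma>" for Z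
  proof -
    obtain x where x: "x \<in> carrier G" "Z = M #> x" using \<open>Z \<in> carrier ?\<Gamma>\<close> car\<Gamma> by auto
    have "A #> x = A \<longleftrightarrow> x \<in> A" using coset_join1 coset_join2 x A.subgroup_axioms by blast
    moreover have "M #> x \<in> A' \<longleftrightarrow> x \<in> A"
    proof
      assume "M #> x \<in> A'"
      then obtain a where a: "a \<in> A" "M #> x = M #> a" by (auto simp: A'_def)
      then have "x \<otimes> inv a \<in> A" using rcos_eq_iff[OF M.subgroup_axioms x(1)] A.subset MA by blast
      then have "(x \<otimes> inv a) \<otimes> a \<in> A" using a by blast
      moreover have "a \<in> carrier G" using a A.subset by auto
      ultimately show "x \<in> A" using x by (simp add: m_assoc)
    qed (auto simp: A'_def)
    ultimately show ?thesis using x \<pi> by simp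
  qed
  have "A' = kernel ?\<Gamma> ?D \<pi>" unfolding kernel_def using ker A.subset by (auto simp: A'_def car\<Gamma>)
  moreover have "group_hom ?\<Gamma> ?D \<pi>"
    using \<pi>_hom by (simp add: group_hom_def group_hom_axioms_def \<Gamma>.is_group D.is_group)
  ultimately have A'n: "A' \<lhd> ?\<Gamma>" using group_hom.normal_kernel by metis
  have A'c: "Z \<otimes>\<^bsub>?\<Gamma>\<^esub> Z' = Z' \<otimes>\<^bsub>?\<Gamma>\<^esub> Z" if "Z \<in> A'" "Z' \<in> A'" for Z Z'
    using that comm A.subset by (auto simp: A'_def M.rcos_sum subset_iff)
  define T' where "T' = (\<lambda>a. M #> a) ` T"
  have T': "finite T'" "T' \<subseteq> A'" using T by (auto simp: T'_def A'_def)
  have "A' = generate ?\<Gamma> T'"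
  proof
    show "generate ?\<Gamma> T' \<subseteq> A'"
      by (rule \<Gamma>.generate_subgroup_incl[OF T'(2)]) (rule normal_imp_subgroup[OF A'n])
    have TM: "T \<union> M \<subseteq> carrier G" using T A.subset M.subset by auto
    have "M #> a \<in> generate ?\<Gamma> T'" if "a \<in> generate G (T \<union> M)" for a
      using that
    proof (induction rule: generate.induct)
      case one
      have "M #> \<one> = \<one>\<^bsub>?\<Gamma>\<^esub>" using coset_mult_one[OF M.subset] by simp
      then show ?case using generate.one[of ?\<Gamma> T'] by simp
    next
      case (incl h)
      then show ?case
      proof
        assume "h \<in> M"
        then have "M #> h = \<one>\<^bsub>?\<Gamma>\<^esub>" using coset_join2 M.subgroup_axioms M.subset by auto
        then show ?thesis using generate.one[of ?\<Gamma> T'] by simp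
      qed (auto simp: T'_def intro: generate.incl)
    next
      case (inv h)
      have hc: "h \<in> carrier G" using inv TM by auto
      have "M #> inv h = inv\<^bsub>?\<Gamma>\<^esub> (M #> h)"
        using M.inv_FactGroup[of "M #> h"] M.rcos_inv[OF hc] hc car\<Gamma> by simp
      moreover from inv have "inv\<^bsub>?\<Gamma>\<^esub> (M #> h) \<in> generate ?\<Gamma> T'"
      proof
        assume "h \<in> M"
        then have "M #> h = \<one>\<^bsub>?\<Gamma>\<^esub>" using coset_join2 M.subgroup_axioms M.subset by auto
        then show ?thesis using generate.one[of ?\<Gamma> T'] \<Gamma>.inv_one by simp
      qed (auto simp: T'_def intro: generate.inv)
      ultimately show ?case by simp
    next
      case (eng h1 h2)
      have "h1 \<in> carrier G" "h2 \<in> carrier G" using eng generate_in_carrier[OF TM] by auto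
      then have "M #> (h1 \<otimes> h2) = (M #> h1) \<otimes>\<^bsub>?\<Gamma>\<^esub> (M #> h2)" by (simp add: M.rcos_sum)
      then show ?case using generate.eng[OF eng.IH] by simp
    qed
    then show "A' \<subseteq> generate ?\<Gamma> T'" using T(3) by (auto simp: A'_def)
  qed
  then obtain len \<delta> where "doubling_length ?\<Gamma> A' len \<delta>"
    using \<Gamma>.doubling_length_exists[OF A'n A'c T'] by blast
  from doubling_length.rule_bound_extension[OF this D.is_group \<pi>_hom \<pi>_surj ker K]
  show ?thesis by blast
qed

lemma rule_bound_series:
  assumes "H 0 = carrier G" "\<And>k. k < n \<Longrightarrow> abelian_step G (H k) (H (Suc k))"
  shows "\<exists>K. rule_bound K (G Mod (H n))"
  using assms(2)
proof (induction n)
  case 0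
  have C: "carrier G \<lhd> G" by (rule normal_invI[OF subgroup_self]) auto
  have "carrier (G Mod carrier G) = {carrier G}"
    using coset_join2[OF _ subgroup_self] by (auto simp: carrier_FactGroup)
  then have "rule_bound 1 (G Mod carrier G)"
    by (intro rule_bound_trivial normal.factorgroup_is_group[OF C]) simp
  then show ?case using assms(1) by auto
next
  case (Suc n)
  then show ?case using rule_bound_step by (metis less_Suc_eq)
qed

section \<open>Finite generation of subgroups\<close>

lemma generate_Un_subset:
  "subgroup A G \<Longrightarrow> T \<subseteq> A \<Longrightarrow> M \<subseteq> A \<Longrightarrow> generate G (T \<union> M) \<subseteq> A"
  by (rule generate_subgroup_incl) auto

text \<open>\<open>H\<close> is generated by \<open>H \<inter> A\<close> and an element \<open>h0 = t ^ d \<otimes> a0\<close> with \<open>d > 0\<close> minimal.\<close>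

lemma noetherian_cyclic_extension:
  assumes A: "subgroup A G" "noetherian G A" and t: "t \<in> carrier G"
    and norm: "\<And>a (e::int). a \<in> A \<Longrightarrow> t [^] e \<otimes> a \<otimes> t [^] (- e) \<in> A"
    and B: "\<And>b. b \<in> B \<Longrightarrow> \<exists>(e::int). \<exists>a\<in>A. b = t [^] e \<otimes> a"
  shows "noetherian G B"
  unfolding noetherian_def
proof (intro allI impI)
  fix H assume "subgroup H G \<and> H \<subseteq> B"
  then have H: "subgroup H G" "H \<subseteq> B" by auto
  have Ac: "A \<subseteq> carrier G" and Hc: "H \<subseteq> carrier G" using A H subgroup.subset by auto
  have "subgroup (H \<inter> A) G" using H A subgroups_Inter_pair by blast
  then obtain T where T: "finite T" "T \<subseteq> H \<inter> A" "H \<inter> A = generate G T"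
    using A(2) unfolding noetherian_def by (metis inf_le2)
  \<comment> \<open>Exponents need not be unique, since powers of \<open>t\<close> may lie in
    \<open>A\<close>. All exponents that occur are collected; \<open>quot\<close> shows that they
    can be subtracted.\<close>
  define I where "I = {e::int. \<exists>h\<in>H. \<exists>a\<in>A. h = t [^] e \<otimes> a}"
  have quot: "e \<in> I \<Longrightarrow> h \<in> H \<Longrightarrow> a \<in> A \<Longrightarrow> h = t [^] e \<otimes> a \<Longrightarrow> h' \<in> H \<Longrightarrow> a' \<in> A \<Longrightarrow> h' = t [^] e' \<otimes> a' \<Longrightarrow>
    \<exists>a2\<in>A. h \<otimes> inv h' = t [^] (e - e') \<otimes> a2" for e e' h h' a a'
  proof -
    assume as: "h \<in> H" "a \<in> A" "h = t [^] e \<otimes> a" "h' \<in> H" "a' \<in> A" "h' = t [^] e' \<otimes> a'"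
    let ?a2 = "t [^] e' \<otimes> (a \<otimes> inv a') \<otimes> t [^] (- e')"
    have ac: "a \<in> carrier G" "a' \<in> carrier G" using as Ac by auto
    have "a \<otimes> inv a' \<in> A" using as A(1) by (simp add: subgroup.m_closed subgroup.m_inv_closed)
    then have a2: "?a2 \<in> A" by (rule norm)
    have "t [^] (e - e') \<otimes> ?a2 = (t [^] (e - e') \<otimes> t [^] e') \<otimes> (a \<otimes> inv a') \<otimes> t [^] (- e')"
      using t ac by (simp add: m_assoc)
    also have "t [^] (e - e') \<otimes> t [^] e' = t [^] e" using int_pow_mult[OF t, of "e - e'" e'] by simp
    also have "t [^] e \<otimes> (a \<otimes> inv a') \<otimes> t [^] (- e') = h \<otimes> inv h'"
      using as t ac by (simp add: m_assoc inv_mult_group int_pow_neg)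
    finally show ?thesis using a2 by metis
  qed
  show "\<exists>T. finite T \<and> T \<subseteq> H \<and> H = generate G T"
  proof (cases "\<exists>e\<in>I. 0 < e")
    \<comment> \<open>Subtracting from the exponent 0 of \<open>\<one>\<close> shows that
      \<open>I\<close> is closed under negation, so without positive elements it contains only
      0.\<close>
    case False
    have "H \<subseteq> A"
    proof
      fix h assume h: "h \<in> H"
      obtain e a where e: "a \<in> A" "h = t [^] (e::int) \<otimes> a" using B H h by blast
      have ac: "a \<in> carrier G" using e Ac by auto
      have one: "\<one> \<in> H" "\<one> \<in> A" using H A subgroup.one_closed by auto
      have "e \<in> I" "0 \<in> I" using e h one unfolding I_def by force+
      have "\<exists>a2\<in>A. \<one> \<otimes> inv h = t [^] (0 - e) \<otimes> a2"
        by (rule quot[OF \<open>0 \<in> I\<close> one(1) one(2) _ h e(1,2)]) simp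
      moreover have "\<one> \<otimes> inv h \<in> H" using h H by (simp add: subgroup.m_inv_closed subgroup.mem_carrier)
      ultimately have "- e \<in> I" unfolding I_def by auto
      then have "e = 0" using False \<open>e \<in> I\<close> by (metis linorder_neqE neg_0_less_iff_less)
      then show "h \<in> A" using e ac by simp
    qed
    then show ?thesis using T by (intro exI[of _ T]) auto
  next
    case True
    define d where "d = (LEAST n. int n \<in> I \<and> 0 < n)"
    have ex: "\<exists>n. int n \<in> I \<and> 0 < n"
    proof -
      obtain e where "e \<in> I" "0 < e" using True by blast
      then show ?thesis by (intro exI[of _ "nat e"]) auto
    qed
    have d: "int d \<in> I" "0 < d" using LeastI_ex[OF ex] by (auto simp: d_def)
    obtain h0 a0 where h0: "h0 \<in> H" "a0 \<in> A" "h0 = t [^] int d \<otimes> a0" using d by (auto simp: I_def)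
    have pow: "\<exists>a\<in>A. h0 [^] k = t [^] (int d * k) \<otimes> a" if "0 \<le> k" for k :: int
      using that
    proof (induction k rule: int_ge_induct)
      case base
      then show ?case using t subgroup.one_closed[OF A(1)] by (intro bexI[of _ \<one>]) auto
    next
      case (step k)
      then obtain a where a: "a \<in> A" "h0 [^] k = t [^] (int d * k) \<otimes> a" by blast
      have ac: "a \<in> carrier G" "a0 \<in> carrier G" "h0 \<in> carrier G" using a h0 Ac Hc by auto
      let ?b = "t [^] (- int d) \<otimes> a \<otimes> t [^] (- (- int d))"
      have b: "?b \<otimes> a0 \<in> A" by (rule subgroup.m_closed[OF A(1) norm[OF a(1)] h0(2)])
      have "t [^] (int d * (k + 1)) \<otimes> (?b \<otimes> a0) = (t [^] (int d * (k + 1)) \<otimes> t [^] (- int d)) \<otimes> a \<otimes> (t [^] int d \<otimes> a0)"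
        using t ac by (simp add: m_assoc)
      also have "t [^] (int d * (k + 1)) \<otimes> t [^] (- int d) = t [^] (int d * k)"
        using int_pow_mult[OF t, of "int d * (k + 1)" "- int d"] by (simp add: algebra_simps)
      also have "t [^] (int d * k) \<otimes> a \<otimes> (t [^] int d \<otimes> a0) = h0 [^] k \<otimes> h0" using a h0 by simp
      also have "\<dots> = h0 [^] (k + 1)" using int_pow_mult[OF ac(3), of k 1] ac by simp
      finally show ?case using b by metis
    qed
    have "H \<subseteq> generate G (insert h0 T)"
    proof
      fix h assume h: "h \<in> H"
      obtain e a where e: "a \<in> A" "h = t [^] (e::int) \<otimes> a" using B H h by blast
      have eI: "e \<in> I" using e h by (auto simp: I_def)
      \<comment> \<open>Division with remainder: \<open>r\<close> is an exponent of
        \<open>h \<otimes> inv (h0 [^] q)\<close>, so minimality of \<open>d\<close> forces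
        \<open>r = 0\<close> and this quotient lies in \<open>H \<inter> A\<close>.\<close>
      obtain q r where qr: "e = int d * q + r" "0 \<le> r" "r < int d"
      proof
        show "e = int d * (e div int d) + e mod int d" by simp
      qed (use d in auto)
      obtain b where b: "b \<in> A" "h0 [^] q = t [^] (int d * q) \<otimes> b"
      proof (cases "0 \<le> q")
        case True
        then show ?thesis using pow that by blast
      next
        case False
        then obtain a1 where a1: "a1 \<in> A" "h0 [^] (- q) = t [^] (int d * (- q)) \<otimes> a1" using pow[of "- q"] by auto
        have one: "\<one> \<in> H" "\<one> \<in> A" using H A subgroup.one_closed by auto
        have "0 \<in> I" using one unfolding I_def by force
        have hq: "h0 [^] (- q) \<in> H" using subgroup_int_pow_closed[OF H(1) h0(1)] .
        have "\<exists>a2\<in>A. \<one> \<otimes> inv (h0 [^] (- q)) = t [^] (0 - int d * (- q)) \<otimes> a2"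
          by (rule quot[OF \<open>0 \<in> I\<close> one(1) one(2) _ hq a1]) simp
        moreover have "\<one> \<otimes> inv (h0 [^] (- q)) = h0 [^] q"
          using h0 Hc int_pow_neg[of h0 "- q"] by auto
        ultimately show ?thesis using that by auto
      qed
      have hq: "h0 [^] q \<in> H" using subgroup_int_pow_closed[OF H(1) h0(1)] .
      obtain a2 where a2: "a2 \<in> A" "h \<otimes> inv (h0 [^] q) = t [^] r \<otimes> a2"
        using quot[OF eI h e hq b] qr by auto
      have hh: "h \<otimes> inv (h0 [^] q) \<in> H" using h hq H(1) by (simp add: subgroup.m_closed subgroup.m_inv_closed)
      then have "r \<in> I" using a2 by (auto simp: I_def)
      have "r = 0"
      proof (rule ccontr)
        assume "r \<noteq> 0"
        then have "d \<le> nat r" unfolding d_def using \<open>r \<in> I\<close> qr by (intro Least_le) auto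
        then show False using qr by linarith
      qed
      then have "h \<otimes> inv (h0 [^] q) \<in> H \<inter> A" using a2 hh Ac by auto
      then have 1: "h \<otimes> inv (h0 [^] q) \<in> generate G (insert h0 T)"
        using T(3) mono_generate[of T "insert h0 T"] by blast
      have sub: "subgroup (generate G (insert h0 T)) G" using h0 T Hc by (intro generate_is_subgroup) auto
      have "h0 [^] q \<in> generate G (insert h0 T)"
        by (rule subgroup_int_pow_closed[OF sub]) (simp add: generate.incl)
      with 1 have "(h \<otimes> inv (h0 [^] q)) \<otimes> h0 [^] q \<in> generate G (insert h0 T)" by (rule generate.eng)
      then show "h \<in> generate G (insert h0 T)" using h hq Hc by (simp add: m_assoc subset_iff)
    qed
    moreover have "generate G (insert h0 T) \<subseteq> H"
      by (rule generate_subgroup_incl[OF _ H(1)]) (use h0 T in auto)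
    ultimately show ?thesis using h0 T by (intro exI[of _ "insert h0 T"]) auto
  qed
qed

text \<open>The generators of \<open>A\<close> over \<open>M\<close> are adjoined one at a time,
  each time extending by powers of a single element that normalizes the group reached so
  far.\<close>

lemma noetherian_step:
  assumes step: "abelian_step G A M" and M_noeth: "noetherian G M"
  shows "noetherian G A"
proof -
  have MA: "M \<subseteq> A" and A: "A \<lhd> G" and M: "M \<lhd> G"
    and comm: "\<And>a b. a \<in> A \<Longrightarrow> b \<in> A \<Longrightarrow> M #> (a \<otimes> b) = M #> (b \<otimes> a)"
    using step by (auto simp: abelian_step_def)
  obtain T where T: "finite T" "T \<subseteq> A" "A = generate G (T \<union> M)"
    using step by (auto simp: abelian_step_def)
  interpret A: normal A G by (rule A)
  interpret M: normal M G by (rule M)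
  have "T \<subseteq> A \<Longrightarrow> noetherian G (generate G (T \<union> M))" using T(1)
  proof (induction rule: finite_induct)
    case empty
    have "generate G M \<subseteq> M" by (rule generate_subgroup_incl[OF _ M.subgroup_axioms]) simp
    then show ?case using M_noeth unfolding noetherian_def by (auto dest: subset_trans)
  next
    case (insert t T)
    let ?A = "generate G (T \<union> M)"
    have TM: "T \<union> M \<subseteq> carrier G" using insert A.subset M.subset by auto
    have sub: "subgroup ?A G" by (rule generate_is_subgroup[OF TM])
    have tA: "t \<in> A" "t \<in> carrier G" using insert A.subset by auto
    have AA: "?A \<subseteq> A" using insert MA by (intro generate_Un_subset A.subgroup_axioms) auto
    have M_in: "M \<subseteq> ?A" by (auto intro: generate.incl)
    \<comment> \<open>Conjugation multiplies by a commutator of elements of \<open>A\<close>, which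
      lies in \<open>M\<close>; so every group between \<open>M\<close> and \<open>A\<close> is
      normalized by \<open>A\<close>.\<close>
    have norm: "x \<otimes> a \<otimes> inv x \<in> ?A" if x: "x \<in> A" and a: "a \<in> ?A" for x a
    proof -
      have c: "x \<in> carrier G" "a \<in> carrier G" "a \<in> A" using x a AA A.subset by auto
      have "(x \<otimes> a) \<otimes> inv (a \<otimes> x) \<in> M"
        using comm[OF x c(3)] rcos_eq_iff[OF M.subgroup_axioms] c by simp
      then have "((x \<otimes> a) \<otimes> inv (a \<otimes> x)) \<otimes> a \<in> ?A"
        by (rule generate.eng[OF subsetD[OF M_in] a])
      then show ?thesis using c by (simp add: inv_mult_group m_assoc)
    qed
    have normt: "t [^] e \<otimes> a \<otimes> t [^] (- e) \<in> ?A" if "a \<in> ?A" for a and e :: int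
      unfolding int_pow_neg[OF tA(2)]
      by (rule norm[OF subgroup_int_pow_closed[OF A.subgroup_axioms tA(1), of e] that])
    show ?case
    proof (rule noetherian_cyclic_extension[OF sub _ tA(2) normt])
      show "noetherian G ?A" using insert by auto
      fix b assume "b \<in> generate G (insert t T \<union> M)"
      then show "\<exists>(e::int). \<exists>a\<in>?A. b = t [^] e \<otimes> a"
      proof (induction rule: generate.induct)
        case one
        then show ?case using generate.one tA by (intro exI[of _ 0] bexI[of _ \<one>]) (auto intro: generate.one)
      next
        case (incl h)
        show ?case
        proof (cases "h = t")
          case True
          then show ?thesis using tA by (intro exI[of _ 1] bexI[of _ \<one>]) (auto intro: generate.one)
        next
          case False
          then have "h \<in> ?A" "h \<in> carrier G" using incl TM by (auto intro: generate.incl)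
          then show ?thesis using tA by (intro exI[of _ 0] bexI[of _ h]) auto
        qed
      next
        case (inv h)
        show ?case
        proof (cases "h = t")
          case True
          then show ?thesis using tA
            by (intro exI[of _ "-1"] bexI[of _ \<one>]) (auto intro: generate.one simp: int_pow_neg)
        next
          case False
          then have "inv h \<in> ?A" "inv h \<in> carrier G" using inv TM by (auto intro: generate.inv)
          then show ?thesis using tA by (intro exI[of _ 0] bexI[of _ "inv h"]) auto
        qed
      next
        case (eng h1 h2)
        obtain e1 a1 where 1: "a1 \<in> ?A" "h1 = t [^] (e1::int) \<otimes> a1" using eng by blast
        obtain e2 a2 where 2: "a2 \<in> ?A" "h2 = t [^] (e2::int) \<otimes> a2" using eng by blast
        have c: "a1 \<in> carrier G" "a2 \<in> carrier G" using 1 2 AA A.subset by auto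
        let ?a = "t [^] (- e2) \<otimes> a1 \<otimes> t [^] (- (- e2)) \<otimes> a2"
        have "?a \<in> ?A" using normt[OF 1(1), of "- e2"] 2(1) by (rule generate.eng)
        moreover have "h1 \<otimes> h2 = t [^] (e1 + e2) \<otimes> ?a"
        proof -
          have "t [^] (e1 + e2) \<otimes> ?a = (t [^] (e1 + e2) \<otimes> t [^] (- e2)) \<otimes> a1 \<otimes> (t [^] e2 \<otimes> a2)"
            using c tA by (simp add: m_assoc)
          also have "t [^] (e1 + e2) \<otimes> t [^] (- e2) = t [^] e1" using tA int_pow_mult[of t "e1 + e2" "- e2"] by simp
          finally show ?thesis using 1 2 by simp
        qed
        ultimately show ?case by blast
      qed
    qed
  qed
  then show ?thesis using T by simp
qed

end

context group
begin

lemma abelian_step_Mod: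
  assumes MA: "M \<subseteq> A" and A: "A \<lhd> G" and M: "M \<lhd> G"
    and comm: "comm_group ((G\<lparr>carrier := A\<rparr>) Mod M)"
    and fg: "finitely_generated_group ((G\<lparr>carrier := A\<rparr>) Mod M)"
  shows "abelian_step G A M"
proof -
  let ?H = "G\<lparr>carrier := A\<rparr>"
  let ?Q = "?H Mod M"
  interpret A: normal A G by (rule A)
  interpret M: normal M G by (rule M)
  interpret H: group ?H by (rule subgroup_imp_group[OF A.subgroup_axioms])
  interpret MH: normal M ?H by (rule normal_restrict_supergroup[OF A.subgroup_axioms M MA])
  interpret Q: comm_group ?Q by (rule comm)
  have rc: "M #>\<^bsub>?H\<^esub> x = M #> x" for x by (simp add: r_coset_def)
  have carQ: "carrier ?Q = (\<lambda>x. M #> x) ` A" by (simp add: carrier_FactGroup rc)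
  have multQ: "(M #> x) \<otimes>\<^bsub>?Q\<^esub> (M #> y) = M #> (x \<otimes> y)" if "x \<in> A" "y \<in> A" for x y
    using MH.rcos_sum[of x y] that by (simp add: rc)
  have c: "M #> (a \<otimes> b) = M #> (b \<otimes> a)" if "a \<in> A" "b \<in> A" for a b
  proof -
    have "(M #> a) \<otimes>\<^bsub>?Q\<^esub> (M #> b) = (M #> b) \<otimes>\<^bsub>?Q\<^esub> (M #> a)"
      by (rule Q.m_comm) (use that carQ in auto)
    then show ?thesis using multQ that by metis
  qed
  obtain S where S: "finite S" "S \<subseteq> carrier ?Q" "generate ?Q S = carrier ?Q"
    using fg by (auto simp: finitely_generated_group_def)
  have "\<forall>Z\<in>S. \<exists>t. t \<in> A \<and> Z = M #> t" using S(2) carQ by auto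
  then obtain t where t: "\<And>Z. Z \<in> S \<Longrightarrow> t Z \<in> A \<and> Z = M #> t Z" by metis
  define T where "T = t ` S"
  have T: "finite T" "T \<subseteq> A" using S t by (auto simp: T_def)
  have TM: "T \<union> M \<subseteq> A" "T \<union> M \<subseteq> carrier G" using T MA A.subset by auto
  have gA: "generate G (T \<union> M) \<subseteq> A" by (rule generate_subgroup_incl[OF TM(1) A.subgroup_axioms])
  have ex: "\<exists>x\<in>generate G (T \<union> M). Z = M #> x" if "Z \<in> generate ?Q S" for Z
    using that
  proof (induction rule: generate.induct)
    case one
    then show ?case using coset_mult_one[OF M.subset] generate.one[of G "T \<union> M"] by force
  next
    case (incl Z)
    then show ?case using t[OF incl] by (intro bexI[of _ "t Z"]) (auto simp: T_def intro: generate.incl)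
  next
    case (inv Z)
    have tZ: "t Z \<in> A" "Z = M #> t Z" using t[OF inv] by auto
    have "inv\<^bsub>?Q\<^esub> Z = M #> inv (t Z)"
    proof (rule Q.inv_equality)
      show "(M #> inv (t Z)) \<otimes>\<^bsub>?Q\<^esub> Z = \<one>\<^bsub>?Q\<^esub>"
        using multQ[of "inv (t Z)" "t Z"] tZ A.subset coset_mult_one[OF M.subset] by auto
    qed (use tZ carQ in auto)
    then show ?case using inv by (intro bexI[of _ "inv (t Z)"]) (auto simp: T_def intro: generate.inv)
  next
    case (eng Z1 Z2)
    then obtain x1 x2 where x: "x1 \<in> generate G (T \<union> M)" "Z1 = M #> x1" "x2 \<in> generate G (T \<union> M)" "Z2 = M #> x2"
      by blast
    then show ?case using multQ[of x1 x2] gA by (intro bexI[of _ "x1 \<otimes> x2"]) (auto intro: generate.eng)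
  qed
  have "A \<subseteq> generate G (T \<union> M)"
  proof
    fix a assume a: "a \<in> A"
    then have "M #> a \<in> generate ?Q S" using S(3) carQ by auto
    from ex[OF this] obtain x where x: "x \<in> generate G (T \<union> M)" "M #> a = M #> x" by blast
    have xc: "x \<in> carrier G" "a \<in> carrier G" using x gA a A.subset by auto
    have "a \<otimes> inv x \<in> M" using rcos_eq_iff[OF M.subgroup_axioms xc(2,1)] x by simp
    then have "(a \<otimes> inv x) \<otimes> x \<in> generate G (T \<union> M)"
      using x by (intro generate.eng[OF generate.incl]) auto
    then show "a \<in> generate G (T \<union> M)" using xc by (simp add: m_assoc)
  qed
  then show ?thesis unfolding abelian_step_def using MA A M c T gA by blast
qed

lemma countable_generate:
  assumes "countable T" "T \<subseteq> carrier G"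
  shows "countable (generate G T)"
proof -
  let ?U = "T \<union> (\<lambda>x. inv x) ` T"
  let ?P = "\<lambda>xs. foldr (\<otimes>) xs \<one>"
  have cl: "set xs \<subseteq> carrier G \<Longrightarrow> ?P xs \<in> carrier G" for xs by (induction xs) auto
  have app: "set xs \<subseteq> carrier G \<Longrightarrow> set ys \<subseteq> carrier G \<Longrightarrow> ?P (xs @ ys) = ?P xs \<otimes> ?P ys" for xs ys
    by (induction xs) (use cl in \<open>auto simp: m_assoc\<close>)
  have Uc: "?U \<subseteq> carrier G" using assms(2) by auto
  have "generate G T \<subseteq> ?P ` lists ?U"
  proof
    fix x assume "x \<in> generate G T"
    then show "x \<in> ?P ` lists ?U"
    proof (induction rule: generate.induct)
      case one
      then show ?case by (intro image_eqI[of _ _ "[]"]) auto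
    next
      case (incl h)
      then show ?case using assms(2) by (intro image_eqI[of _ _ "[h]"]) auto
    next
      case (inv h)
      then show ?case using assms(2) by (intro image_eqI[of _ _ "[inv h]"]) auto
    next
      case (eng h1 h2)
      then obtain xs ys where xy: "xs \<in> lists ?U" "h1 = ?P xs" "ys \<in> lists ?U" "h2 = ?P ys" by blast
      then have "set xs \<subseteq> carrier G" "set ys \<subseteq> carrier G" using Uc by (auto simp: in_lists_conv_set)
      then have "h1 \<otimes> h2 = ?P (xs @ ys)" using app xy by metis
      then show ?case using xy by (intro image_eqI[of _ _ "xs @ ys"]) auto
    qed
  qed
  moreover have "countable (?P ` lists ?U)" using assms(1) by (intro countable_image countable_lists) auto
  ultimately show ?thesis by (rule countable_subset)
qed

text \<open>The group is finitely generated, hence countable; its subgroups are then parametrized by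
  finite generating subsets, of which there are countably many.\<close>

lemma noetherian_countable_subgroups:
  assumes "noetherian G (carrier G)"
  shows "countable (carrier G)" "countable {L. subgroup L G}"
proof -
  obtain T where T: "finite T" "T \<subseteq> carrier G" "carrier G = generate G T"
    using assms subgroup_self unfolding noetherian_def by blast
  show c: "countable (carrier G)"
    unfolding T(3) by (rule countable_generate[OF countable_finite[OF T(1)] T(2)])
  have "{L. subgroup L G} \<subseteq> generate G ` {T. finite T \<and> T \<subseteq> carrier G}"
  proof
    fix L assume "L \<in> {L. subgroup L G}"
    then have L: "subgroup L G" "L \<subseteq> carrier G" using subgroup.subset by auto
    then obtain T where "finite T" "T \<subseteq> L" "L = generate G T"
      using assms unfolding noetherian_def by blast
    then show "L \<in> generate G ` {T. finite T \<and> T \<subseteq> carrier G}" using L by blast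
  qed
  moreover have "countable {T. finite T \<and> T \<subseteq> carrier G}" by (rule countable_Collect_finite_subset[OF c])
  ultimately show "countable {L. subgroup L G}" using countable_image countable_subset by blast
qed

end

section \<open>Subgroups and subquotients of polycyclic groups\<close>

lemma polycyclic_series:
  assumes "polycyclic_group G"
  shows "\<exists>n H. group G \<and> H (0::nat) = carrier G \<and> H n = {\<one>\<^bsub>G\<^esub>} \<and>
    (\<forall>k<n. abelian_step G (H k) (H (Suc k)))"
proof -
  obtain n H where H: "group G" "H (0::nat) = carrier G" "H n = {\<one>\<^bsub>G\<^esub>}" "\<forall>k\<le>n. H k \<lhd> G"
     "\<forall>k<n. H (Suc k) \<subseteq> H k \<and> comm_group ((G\<lparr>carrier := H k\<rparr>) Mod H (Suc k)) \<and>
           finitely_generated_group ((G\<lparr>carrier := H k\<rparr>) Mod H (Suc k))"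
    using assms unfolding polycyclic_group_def by (elim conjE exE) blast
  have "abelian_step G (H k) (H (Suc k))" if "k < n" for k
    by (rule group.abelian_step_Mod[OF H(1)]) (use H(4,5) that in auto)
  then show ?thesis using H(1-3) by (intro exI[of _ n] exI[of _ H]) simp
qed

lemma polycyclic_noetherian:
  fixes G (structure)
  assumes "polycyclic_group G"
  shows "noetherian G (carrier G)"
proof -
  obtain n H where H_all: "group G \<and> H (0::nat) = carrier G \<and> H n = {\<one>\<^bsub>G\<^esub>} \<and>
    (\<forall>k<n. abelian_step G (H k) (H (Suc k)))"
    using polycyclic_series[OF assms] by (elim exE)
  then have H: "group G" "H (0::nat) = carrier G" "H n = {\<one>\<^bsub>G\<^esub>}"
    "\<And>k. k < n \<Longrightarrow> abelian_step G (H k) (H (Suc k))" by simp_all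
  interpret group G by (rule H(1))
  have "noetherian G (H k)" if "k \<le> n" for k
    using that
  proof (induction k rule: inc_induct)
    case base
    have "L = generate G {}" if "subgroup L G" "L \<subseteq> {\<one>}" for L
      using that subgroup.one_closed[OF that(1)] generate_empty by auto
    then show ?case unfolding H(3) noetherian_def by (intro allI impI exI[of _ "{}"]) auto
  next
    case (step k)
    then show ?case using noetherian_step H(4) by blast
  qed
  then show ?thesis using H(2) by force
qed

text \<open>Intersecting the series with \<open>N\<close> and multiplying by \<open>L\<close> gives
  the series \<open>C\<close>, which ends at \<open>L\<close>. Commutativity of the factors is
  inherited; their finite generation is not formal and comes from finite generation of all subgroups
  of \<open>G\<close>.\<close>

lemma polycyclic_subquotient_rule_bound:
  fixes G (structure)
  assumes G: "polycyclic_group G" and N: "subgroup N G" and L: "L \<lhd> G\<lparr>carrier := N\<rparr>"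
  shows "\<exists>K. rule_bound K ((G\<lparr>carrier := N\<rparr>) Mod L)"
proof -
  obtain n H where H_all: "group G \<and> H (0::nat) = carrier G \<and> H n = {\<one>\<^bsub>G\<^esub>} \<and>
    (\<forall>k<n. abelian_step G (H k) (H (Suc k)))"
    using polycyclic_series[OF G] by (elim exE)
  then have H: "group G" "H (0::nat) = carrier G" "H n = {\<one>\<^bsub>G\<^esub>}"
    "\<And>k. k < n \<Longrightarrow> abelian_step G (H k) (H (Suc k))" by simp_all
  interpret group G by (rule H(1))
  let ?\<Lambda> = "G\<lparr>carrier := N\<rparr>"
  interpret \<Lambda>: group ?\<Lambda> by (rule subgroup_imp_group[OF N])
  interpret L: normal L ?\<Lambda> by (rule L)
  have Nc: "N \<subseteq> carrier G" using N subgroup.subset by blast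
  have LN: "L \<subseteq> N" using L.subset by simp
  have inv\<Lambda>: "x \<in> N \<Longrightarrow> inv\<^bsub>?\<Lambda>\<^esub> x = inv x" for x using m_inv_consistent[OF N] .
  have H_normal: "H k \<lhd> G" if "k \<le> n" for k
  proof (cases "k < n")
    case True
    then show ?thesis using H(4) by (auto simp: abelian_step_def)
  next
    case False
    then show ?thesis using that H(3) one_is_normal by simp
  qed
  define B where "B k = H k \<inter> N" for k
  define C where "C k = B k <#>\<^bsub>?\<Lambda>\<^esub> L" for k
  have B: "B k \<lhd> ?\<Lambda>" if "k \<le> n" for k
    unfolding B_def using normal_Int_subgroup[OF N H_normal[OF that]] .
  have C: "C k \<lhd> ?\<Lambda>" if "k \<le> n" for k
    unfolding C_def by (rule \<Lambda>.normal_subgroup_set_mult_closed[OF B[OF that] L])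
  have C_iff: "x \<in> C k \<longleftrightarrow> (\<exists>h\<in>B k. \<exists>l\<in>L. x = h \<otimes> l)" for x k
    by (auto simp: C_def set_mult_def)
  have BN: "B k \<subseteq> N" for k by (auto simp: B_def)
  have BC: "B k \<subseteq> C k" for k
  proof
    fix h assume h: "h \<in> B k"
    then have "h \<in> carrier G" using BN Nc by blast
    then have "h = h \<otimes> \<one>" by simp
    then show "h \<in> C k" using h L.one_closed C_iff by auto
  qed
  have LC: "L \<subseteq> C k" if "k \<le> n" for k
  proof
    fix l assume l: "l \<in> L"
    have "\<one> \<in> B k" using normal_imp_subgroup[OF B[OF that]] subgroup.one_closed by fastforce
    moreover have "l = \<one> \<otimes> l" using l LN Nc by auto
    ultimately show "l \<in> C k" using l C_iff by auto
  qed
  have "C 0 = carrier ?\<Lambda>"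
  proof
    show "C 0 \<subseteq> carrier ?\<Lambda>" using subgroup.subset[OF normal_imp_subgroup[OF C[of 0]]] by simp
    show "carrier ?\<Lambda> \<subseteq> C 0" using BC[of 0] H(2) Nc by (auto simp: B_def)
  qed
  moreover have "C n = L"
  proof
    show "C n \<subseteq> L"
    proof
      fix x assume "x \<in> C n"
      then obtain l where l: "l \<in> L" "x = \<one> \<otimes> l" using C_iff H(3) by (auto simp: B_def)
      then have "l \<in> carrier G" using LN Nc by blast
      then show "x \<in> L" using l by simp
    qed
    show "L \<subseteq> C n" by (rule LC) simp
  qed
  moreover have "abelian_step ?\<Lambda> (C k) (C (Suc k))" if k: "k < n" for k
  proof -
    note st = H(4)[OF k, unfolded abelian_step_def]
    let ?M = "C (Suc k)"
    have Mn: "?M \<lhd> ?\<Lambda>" and Cn: "C k \<lhd> ?\<Lambda>" using C k by auto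
    interpret M: normal ?M ?\<Lambda> by (rule Mn)
    have "B (Suc k) \<subseteq> B k" using st by (auto simp: B_def)
    then have sub: "?M \<subseteq> C k" using C_iff by blast
    have LM: "L \<subseteq> ?M" using LC[of "Suc k"] k by simp
    \<comment> \<open>Factors from \<open>L\<close> are absorbed by the coset, and the commutator of
      the remaining elements of \<open>B k\<close> lies in
      \<open>H (Suc k) \<inter> N\<close>.\<close>
    have comm: "?M #>\<^bsub>?\<Lambda>\<^esub> (x \<otimes>\<^bsub>?\<Lambda>\<^esub> y) = ?M #>\<^bsub>?\<Lambda>\<^esub> (y \<otimes>\<^bsub>?\<Lambda>\<^esub> x)" if xy: "x \<in> C k" "y \<in> C k" for x y
    proof -
      obtain h l where h: "h \<in> B k" "l \<in> L" "x = h \<otimes> l" using xy C_iff by blast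
      obtain h' l' where h': "h' \<in> B k" "l' \<in> L" "y = h' \<otimes> l'" using xy C_iff by blast
      have hN: "h \<in> N" "h' \<in> N" "l \<in> N" "l' \<in> N" using h h' BN LN by auto
      have c: "x \<in> N" "y \<in> N" using h h' hN subgroup.m_closed[OF N] by auto
      have 1: "?M #>\<^bsub>?\<Lambda>\<^esub> x = ?M #>\<^bsub>?\<Lambda>\<^esub> h" "?M #>\<^bsub>?\<Lambda>\<^esub> y = ?M #>\<^bsub>?\<Lambda>\<^esub> h'"
        using \<Lambda>.rcos_absorb(2)[OF Mn, of l h] \<Lambda>.rcos_absorb(2)[OF Mn, of l' h'] h h' hN LM by auto
      have "H (Suc k) #> (h \<otimes> h') = H (Suc k) #> (h' \<otimes> h)" using st h h' by (auto simp: B_def)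
      then have "(h \<otimes> h') \<otimes> inv (h' \<otimes> h) \<in> H (Suc k)"
        using rcos_eq_iff[of "H (Suc k)"] st normal_imp_subgroup hN Nc by (metis m_closed subsetD)
      moreover have hh: "h \<otimes> h' \<in> N" "h' \<otimes> h \<in> N" using hN subgroup.m_closed[OF N] by auto
      ultimately have "(h \<otimes> h') \<otimes> inv (h' \<otimes> h) \<in> ?M"
        using BC[of "Suc k"] subgroup.m_closed[OF N] subgroup.m_inv_closed[OF N] by (auto simp: B_def)
      then have 2: "?M #>\<^bsub>?\<Lambda>\<^esub> (h \<otimes>\<^bsub>?\<Lambda>\<^esub> h') = ?M #>\<^bsub>?\<Lambda>\<^esub> (h' \<otimes>\<^bsub>?\<Lambda>\<^esub> h)"
        using \<Lambda>.rcos_eq_iff[OF M.subgroup_axioms, of "h \<otimes> h'" "h' \<otimes> h"] hh inv\<Lambda> by simp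
      have "?M #>\<^bsub>?\<Lambda>\<^esub> (x \<otimes>\<^bsub>?\<Lambda>\<^esub> y) = ?M #>\<^bsub>?\<Lambda>\<^esub> (h \<otimes>\<^bsub>?\<Lambda>\<^esub> h')"
        using M.rcos_sum[of x y] M.rcos_sum[of h h'] 1 c hN by simp
      moreover have "?M #>\<^bsub>?\<Lambda>\<^esub> (y \<otimes>\<^bsub>?\<Lambda>\<^esub> x) = ?M #>\<^bsub>?\<Lambda>\<^esub> (h' \<otimes>\<^bsub>?\<Lambda>\<^esub> h)"
        using M.rcos_sum[of y x] M.rcos_sum[of h' h] 1 c hN by simp
      ultimately show ?thesis using 2 by simp
    qed
    have Bk: "subgroup (B k) G" "B k \<subseteq> carrier G"
      unfolding B_def
      using subgroups_Inter_pair[OF normal_imp_subgroup[OF H_normal[of k]] N] k Nc by auto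
    obtain T where T_all: "finite T \<and> T \<subseteq> B k \<and> B k = generate G T"
      using polycyclic_noetherian[OF G, unfolded noetherian_def, THEN spec, THEN mp, OF conjI[OF Bk]]
      by (elim exE)
    note T = T_all[THEN conjunct1] T_all[THEN conjunct2, THEN conjunct1] T_all[THEN conjunct2, THEN conjunct2]
    have TC: "T \<union> ?M \<subseteq> C k" using T BC sub by blast
    have TN: "T \<union> ?M \<subseteq> N" using TC subgroup.subset[OF normal_imp_subgroup[OF Cn]] by auto
    have gen: "C k = generate ?\<Lambda> (T \<union> ?M)"
    proof
      show "generate ?\<Lambda> (T \<union> ?M) \<subseteq> C k"
        by (rule \<Lambda>.generate_subgroup_incl[OF TC normal_imp_subgroup[OF Cn]])
      show "C k \<subseteq> generate ?\<Lambda> (T \<union> ?M)"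
      proof
        fix x assume "x \<in> C k"
        then obtain h l where h: "h \<in> B k" "l \<in> L" "x = h \<otimes> l" using C_iff by blast
        have "h \<in> generate G (T \<union> ?M)" using h T(3) mono_generate[of T "T \<union> ?M"] by blast
        moreover have "l \<in> generate G (T \<union> ?M)" using h LM by (auto intro: generate.incl)
        ultimately have "x \<in> generate G (T \<union> ?M)" unfolding h(3) by (rule generate.eng)
        then show "x \<in> generate ?\<Lambda> (T \<union> ?M)" using generate_consistent[OF TN N] by simp
      qed
    qed
    show ?thesis unfolding abelian_step_def
      by (intro conjI ballI exI[of _ T] sub Cn Mn comm gen) (use T(1) TC in auto)
  qed
  ultimately show ?thesis using \<Lambda>.rule_bound_series[of C n] by simp
qed

section \<open>Free actions\<close>

text \<open>The form in which the Borel structure enters: such a sequence makes equality of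
  measurable maps a measurable condition, and it restricts to measurable subsets.\<close>

definition separating :: "'x measure \<Rightarrow> (nat \<Rightarrow> 'x set) \<Rightarrow> bool" where
  "separating M U \<longleftrightarrow> (\<forall>i. U i \<in> sets M) \<and>
     (\<forall>x\<in>space M. \<forall>y\<in>space M. x \<noteq> y \<longrightarrow> (\<exists>i. (x \<in> U i) \<noteq> (y \<in> U i)))"

lemma standard_Borel_separating:
  assumes "standard_Borel_space M"
  shows "\<exists>U. separating M U"
proof -
  obtain T where T: "completely_metrizable_space T" "separable_space T" "topspace T = space M"
    "sets M = sigma_sets (space M) {U. openin T U}"
    using assms by (auto simp: standard_Borel_space_def Polish_topology_def)
  obtain X d where X: "Metric_space X d" "T = Metric_space.mtopology X d"
    using T(1) unfolding completely_metrizable_space_def by blast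
  interpret Metric_space X d by (rule X(1))
  have XM: "X = space M" using T(3) X(2) by simp
  obtain C where C: "countable C" "C \<subseteq> X" "mtopology closure_of C = X"
    using T(2) X(2) unfolding separable_space_def by auto
  \<comment> \<open>Balls about a countable dense set separate points. The empty set keeps the
    family nonempty for the enumeration even if the space is empty.\<close>
  define \<U> where "\<U> = insert {} ((\<lambda>(c, n::nat). mball c (inverse (real (Suc n)))) ` (C \<times> UNIV))"
  have \<U>c: "countable \<U>" using C(1) by (auto simp: \<U>_def)
  have \<U>M: "A \<in> sets M" if "A \<in> \<U>" for A
  proof -
    have "openin T A" using that X(2) by (auto simp: \<U>_def)
    then show ?thesis unfolding T(4) by (intro sigma_sets.Basic) simp
  qed
  have sep: "\<exists>A\<in>\<U>. (x \<in> A) \<noteq> (y \<in> A)" if xy: "x \<in> space M" "y \<in> space M" "x \<noteq> y" for x y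
  proof -
    have xX: "x \<in> X" "y \<in> X" using xy XM by auto
    then have "0 < d x y" using xy(3) by simp
    then obtain n where n: "inverse (real (Suc n)) < d x y / 2" using reals_Archimedean[of "d x y / 2"] by auto
    have "x \<in> mtopology closure_of C" using C(3) xX by simp
    then have "\<forall>r>0. \<exists>c\<in>C. c \<in> mball x r" unfolding metric_closure_of by simp
    moreover have "0 < inverse (real (Suc n))" by simp
    ultimately obtain c where c: "c \<in> C" "c \<in> mball x (inverse (real (Suc n)))" by blast
    have dc: "d x c < inverse (real (Suc n))" "c \<in> X" using c by auto
    have "x \<in> mball c (inverse (real (Suc n)))" using dc xX by (simp add: commute)
    moreover have "y \<notin> mball c (inverse (real (Suc n)))"
      using triangle[of x c y] dc xX n by auto
    moreover have "mball c (inverse (real (Suc n))) \<in> \<U>" using c(1) by (auto simp: \<U>_def)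
    ultimately show ?thesis by blast
  qed
  have ne: "\<U> \<noteq> {}" by (simp add: \<U>_def)
  have "separating M (from_nat_into \<U>)"
    unfolding separating_def using \<U>M from_nat_into[OF ne] sep from_nat_into_surj[OF \<U>c] by metis
  then show ?thesis by blast
qed

lemma separating_eq_measurable:
  assumes U: "separating M U" and f: "f \<in> measurable N M" and g: "g \<in> measurable N M"
  shows "Measurable.pred N (\<lambda>x. f x = g x)"
proof -
  have Ui: "U i \<in> sets M" for i using U by (simp add: separating_def)
  have "Measurable.pred N (\<lambda>x. \<forall>i. (f x \<in> U i) = (g x \<in> U i))"
    using Ui f g by measurable
  then show ?thesis
  proof (rule measurable_cong[THEN iffD1, rotated])
    fix x assume "x \<in> space N"
    then have "f x \<in> space M" "g x \<in> space M" using f g by (auto dest: measurable_space)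
    then show "(\<forall>i. (f x \<in> U i) = (g x \<in> U i)) = (f x = g x)" using U unfolding separating_def by metis
  qed
qed

lemma measurable_map_list:
  fixes d :: "'i \<Rightarrow> 'x \<Rightarrow> 'v::countable"
  assumes "\<And>i. i \<in> set is \<Longrightarrow> d i \<in> measurable M (count_space UNIV)"
  shows "(\<lambda>x. map (\<lambda>i. d i x) is) \<in> measurable M (count_space UNIV)"
  using assms
proof (induction "is")
  case (Cons i "is")
  have "(\<lambda>x. d i x # map (\<lambda>i. d i x) is) \<in> measurable M (count_space UNIV)"
  proof (rule measurable_compose_countable[where g = "\<lambda>x. map (\<lambda>i. d i x) is" and f = "\<lambda>l x. d i x # l"])
    show "(\<lambda>x. d i x # l) \<in> measurable M (count_space UNIV)" for l
      by (rule measurable_compose[of "d i"]) (use Cons.prems in auto)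
  qed (use Cons in auto)
  then show ?case by simp
qed simp

locale measurable_action = group G for G (structure) +
  fixes M :: "'x measure" and act :: "'a \<Rightarrow> 'x \<Rightarrow> 'x" and U :: "nat \<Rightarrow> 'x set"
  assumes countable_G: "countable (carrier G)"
    and act_measurable: "g \<in> carrier G \<Longrightarrow> act g \<in> measurable M M"
    and act_one: "x \<in> space M \<Longrightarrow> act \<one> x = x"
    and act_mult: "g \<in> carrier G \<Longrightarrow> h \<in> carrier G \<Longrightarrow> x \<in> space M \<Longrightarrow> act (g \<otimes> h) x = act g (act h x)"
    and sep: "separating M U"
begin

lemma act_space: "g \<in> carrier G \<Longrightarrow> x \<in> space M \<Longrightarrow> act g x \<in> space M"
  using act_measurable measurable_space by metis

lemma act_inv: "g \<in> carrier G \<Longrightarrow> x \<in> space M \<Longrightarrow> act (inv g) (act g x) = x"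
  using act_mult[of "inv g" g x] act_one by simp

lemma orbit_equiv: "equiv (space M) {(x, y). x \<in> space M \<and> y \<in> space M \<and> (\<exists>g\<in>carrier G. act g x = y)}"
  (is "equiv _ ?E")
proof (rule equivI)
  show "refl_on (space M) ?E" using act_one one_closed by (auto simp: refl_on_def)
  show "sym ?E"
  proof (rule symI)
    fix x y assume "(x, y) \<in> ?E"
    then obtain g where "x \<in> space M" "y \<in> space M" "g \<in> carrier G" "act g x = y" by blast
    then show "(y, x) \<in> ?E" using act_inv[of g x] by auto
  qed
  show "trans ?E"
  proof (rule transI)
    fix x y z assume "(x, y) \<in> ?E" "(y, z) \<in> ?E"
    then obtain g h where "x \<in> space M" "z \<in> space M" "g \<in> carrier G" "act g x = y" "h \<in> carrier G" "act h y = z" by blast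
    then show "(x, z) \<in> ?E" using act_mult[of h g x] by auto
  qed
qed auto

end

locale free_action = measurable_action G M act U
  for G (structure) and M :: "'x measure" and act :: "'a \<Rightarrow> 'x \<Rightarrow> 'x" and U +
  assumes act_free: "g \<in> carrier G \<Longrightarrow> x \<in> space M \<Longrightarrow> act g x = x \<Longrightarrow> g = \<one>"
begin

text \<open>The color of \<open>x\<close> records, for each nontrivial \<open>f \<in> F\<close>, the
  first set that separates \<open>x\<close> from \<open>act f x\<close>, and the side on which
  \<open>x\<close> lies. If \<open>act f x\<close> had the same record, both points would lie on the
  same side of a set that separates them; freeness provides the set.\<close>

lemma countable_proper_coloring:
  assumes F: "finite F" "F \<subseteq> carrier G"
  obtains k :: "'x \<Rightarrow> nat" where "k \<in> measurable M (count_space UNIV)"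
    "\<And>x f. x \<in> space M \<Longrightarrow> f \<in> F \<Longrightarrow> f \<noteq> \<one> \<Longrightarrow> k (act f x) \<noteq> k x"
proof -
  obtain fs where fs: "set fs = F - {\<one>}" using F finite_list[of "F - {\<one>}"] by blast
  define i where "i f x = (LEAST i. (x \<in> U i) \<noteq> (act f x \<in> U i))" for f x
  define d where "d f x = (i f x, x \<in> U (i f x))" for f x
  have Ui: "U i \<in> sets M" for i using sep by (simp add: separating_def)
  have d_meas: "d f \<in> measurable M (count_space UNIV)" if "f \<in> set fs" for f
  proof -
    have a: "act f \<in> measurable M M" using that fs F act_measurable by auto
    have "(\<lambda>x. LEAST i. (x \<in> U i) \<noteq> (act f x \<in> U i)) \<in> measurable M (count_space UNIV)"
      by (rule measurable_Least) (use Ui a in measurable)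
    then have im: "i f \<in> measurable M (count_space UNIV)" unfolding i_def .
    have "(\<lambda>x. (\<lambda>j x. (j, x \<in> U j)) (i f x) x) \<in> measurable M (count_space UNIV)"
    proof (rule measurable_compose_countable[OF _ im])
      fix j
      have P: "Measurable.pred M (\<lambda>x. x \<in> U j)" using Ui by measurable
      show "(\<lambda>x. (j, x \<in> U j)) \<in> measurable M (count_space UNIV)"
        by (rule measurable_compose[OF P]) simp
    qed
    then show ?thesis unfolding d_def by simp
  qed
  define k where "k x = to_nat (map (\<lambda>f. d f x) fs)" for x
  have "k \<in> measurable M (count_space UNIV)"
    unfolding k_def by (rule measurable_compose[OF measurable_map_list[OF d_meas]]) auto
  moreover have "k (act f x) \<noteq> k x" if x: "x \<in> space M" and f: "f \<in> F" "f \<noteq> \<one>" for x f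
  proof
    assume "k (act f x) = k x"
    then have "map (\<lambda>f. d f (act f' x)) fs = map (\<lambda>f. d f x) fs" if "f' = f" for f'
      using that unfolding k_def by simp
    then have eq: "d f (act f x) = d f x" using fs f by (auto simp: map_eq_conv)
    have fc: "f \<in> carrier G" using f F by auto
    have "act f x \<noteq> x" using act_free[OF fc x] f by blast
    then have "\<exists>i. (x \<in> U i) \<noteq> (act f x \<in> U i)"
      using sep x act_space[OF fc x] unfolding separating_def by metis
    then have "(x \<in> U (i f x)) \<noteq> (act f x \<in> U (i f x))" unfolding i_def by (rule LeastI_ex)
    then show False using eq by (auto simp: d_def)
  qed
  ultimately show ?thesis using that by blast
qed

text \<open>Greedy recoloring, one class of the countable coloring after the other. A point avoids
  the new colors of its at most \<open>card V\<close> neighbors, where \<open>V\<close> is symmetric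
  so that neighbors see each other.\<close>

lemma finite_proper_coloring:
  assumes F: "finite F" "F \<subseteq> carrier G"
  obtains c :: "'x \<Rightarrow> nat" and N where "c \<in> measurable M (count_space UNIV)"
    "\<And>x. x \<in> space M \<Longrightarrow> c x < N"
    "\<And>x f. x \<in> space M \<Longrightarrow> f \<in> F \<Longrightarrow> f \<noteq> \<one> \<Longrightarrow> c (act f x) \<noteq> c x"
proof -
  define V where "V = (F \<union> (\<lambda>f. inv f) ` F) - {\<one>}"
  have V: "finite V" "V \<subseteq> carrier G" using F by (auto simp: V_def)
  obtain k :: "'x \<Rightarrow> nat" where k: "k \<in> measurable M (count_space UNIV)"
    "\<And>x f. x \<in> space M \<Longrightarrow> f \<in> V \<Longrightarrow> f \<noteq> \<one> \<Longrightarrow> k (act f x) \<noteq> k x"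
    using countable_proper_coloring[OF V] by blast
  define \<Psi> :: "nat \<Rightarrow> 'x \<Rightarrow> nat" where
    "\<Psi> = rec_nat (\<lambda>x. 0) (\<lambda>i::nat. \<lambda>\<Psi>i x. if k x = i
       then LEAST n. \<forall>f\<in>V. k (act f x) < i \<longrightarrow> \<Psi>i (act f x) \<noteq> n else \<Psi>i x)"
  have \<Psi>_Suc: "\<Psi> (Suc i) = (\<lambda>x. if k x = i
       then LEAST n. \<forall>f\<in>V. k (act f x) < i \<longrightarrow> \<Psi> i (act f x) \<noteq> n else \<Psi> i x)" for i
    unfolding \<Psi>_def by simp
  have \<Psi>_meas: "\<Psi> i \<in> measurable M (count_space UNIV)" for i
  proof (induction i)
    case 0
    then show ?case by (simp add: \<Psi>_def)
  next
    case (Suc i)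
    have Pm: "Measurable.pred M (\<lambda>x. \<forall>f\<in>V. k (act f x) < i \<longrightarrow> \<Psi> i (act f x) \<noteq> n)" for n
    proof (rule pred_intros_finite(3)[OF V(1)])
      fix f assume "f \<in> V"
      then have "act f \<in> measurable M M" using V act_measurable by auto
      then have [measurable]: "(\<lambda>x. k (act f x)) \<in> measurable M (count_space UNIV)"
        "(\<lambda>x. \<Psi> i (act f x)) \<in> measurable M (count_space UNIV)"
        using measurable_compose[OF _ k(1)] measurable_compose[OF _ Suc] by auto
      show "Measurable.pred M (\<lambda>x. k (act f x) < i \<longrightarrow> \<Psi> i (act f x) \<noteq> n)" by measurable
    qed
    note [measurable] = measurable_Least[OF Pm] Suc k(1)
    show ?case unfolding \<Psi>_Suc by measurable
  qed
  define c where "c x = \<Psi> (Suc (k x)) x" for x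
  have stable: "k x < i \<Longrightarrow> \<Psi> i x = c x" for i x
  proof (induction i)
    case (Suc i)
    then show ?case by (cases "k x = i") (auto simp: c_def \<Psi>_Suc)
  qed simp
  let ?B = "\<lambda>x. (\<lambda>f. c (act f x)) ` {f \<in> V. k (act f x) < k x}"
  have c_eq: "c x = (LEAST n. n \<notin> ?B x)" for x
  proof -
    have "c x = (LEAST n. \<forall>f\<in>V. k (act f x) < k x \<longrightarrow> \<Psi> (k x) (act f x) \<noteq> n)"
      unfolding c_def \<Psi>_Suc by simp
    also have "\<dots> = (LEAST n. n \<notin> ?B x)"
      by (rule arg_cong[where f = Least]) (auto simp: stable fun_eq_iff)
    finally show ?thesis .
  qed
  have finB: "finite (?B x)" for x using V by auto
  have "c x < Suc (card V)" for x
  proof -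
    have "card (?B x) \<le> card {f \<in> V. k (act f x) < k x}" using V by (intro card_image_le) auto
    also have "\<dots> \<le> card V" using V by (intro card_mono) auto
    finally show ?thesis using Least_avoid_le_card(2)[OF finB, of x] c_eq[of x] by linarith
  qed
  moreover have "c \<in> measurable M (count_space UNIV)"
    unfolding c_def by (rule measurable_compose_countable[OF \<Psi>_meas]) (rule measurable_compose[OF k(1)], simp)
  moreover have "c (act f x) \<noteq> c x" if x: "x \<in> space M" and f: "f \<in> F" "f \<noteq> \<one>" for x f
  proof -
    have avoid: "c (act f x) \<noteq> c x" if "f \<in> V" "k (act f x) < k x" for f x
      using Least_avoid_le_card(1)[OF finB, of x] c_eq[of x] that by (metis (no_types, lifting) imageI mem_Collect_eq)
    have fc: "f \<in> carrier G" using f F by auto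
    have fV: "f \<in> V" "inv f \<in> V" using f fc by (auto simp: V_def)
    have ax: "act f x \<in> space M" "act (inv f) (act f x) = x" using act_space[OF fc x] act_inv[OF fc x] by auto
    have "k (act f x) \<noteq> k x" using k(2)[OF x fV(1) f(2)] .
    then show ?thesis using avoid[of f x] avoid[of "inv f" "act f x"] fV ax by (metis linorder_neqE_nat)
  qed
  ultimately show ?thesis using that by blast
qed

text \<open>A coloring of the space restricts along each orbit to a coloring \<omega> of
  \<open>G\<close>, and moving the point by \<open>s\<close> shifts it by \<open>s\<close>. The
  local rule thus becomes a map on the space with the same bound.\<close>

lemma marker_map:
  assumes K: "rule_bound K G" and S: "finite S" "S \<subseteq> carrier G"
  shows "\<exists>\<theta> B. finite B \<and> B \<subseteq> carrier G \<and> \<theta> \<in> measurable M M \<and>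
    (\<forall>x\<in>space M. \<exists>b\<in>B. \<theta> x = act b x) \<and> (\<forall>x\<in>space M. card (\<theta> ` (\<lambda>s. act s x) ` S) \<le> K)"
proof -
  obtain F where F: "finite F \<and> F \<subseteq> carrier G \<and> (\<forall>N. \<exists>B a. finite B \<and> B \<subseteq> carrier G \<and>
        range a \<subseteq> B \<and> local_fun G a \<and> (\<forall>\<omega>. proper_coloring G (carrier G) F N \<omega> \<longrightarrow>
           card ((\<lambda>s. a (shift G s \<omega>) \<otimes> s) ` S) \<le> K))"
    using K[unfolded rule_bound_def, THEN spec, THEN mp, OF conjI[OF S]] by (elim exE)
  obtain c :: "'x \<Rightarrow> nat" and N where c: "c \<in> measurable M (count_space UNIV)"
    "\<And>x. x \<in> space M \<Longrightarrow> c x < N"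
    "\<And>x f. x \<in> space M \<Longrightarrow> f \<in> F \<Longrightarrow> f \<noteq> \<one> \<Longrightarrow> c (act f x) \<noteq> c x"
    using finite_proper_coloring[of F] F by blast
  obtain B a where a_all: "finite B \<and> B \<subseteq> carrier G \<and> range a \<subseteq> B \<and> local_fun G a \<and>
    (\<forall>\<omega>. proper_coloring G (carrier G) F N \<omega> \<longrightarrow> card ((\<lambda>s. a (shift G s \<omega>) \<otimes> s) ` S) \<le> K)"
    using F[THEN conjunct2, THEN conjunct2, THEN spec, of N] by (elim exE)
  then have B: "finite B" "B \<subseteq> carrier G" "\<And>\<omega>. a \<omega> \<in> B" and a_local: "local_fun G a"
    by auto
  note a_bound = a_all[THEN conjunct2, THEN conjunct2, THEN conjunct2, THEN conjunct2, THEN spec, THEN mp]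
  obtain W where W: "finite W" "W \<subseteq> carrier G" "\<And>\<omega> \<omega>'. (\<forall>h\<in>W. \<omega> h = \<omega>' h) \<Longrightarrow> a \<omega> = a \<omega>'"
    using a_local unfolding local_fun_def by metis
  define \<omega> where "\<omega> x = (\<lambda>g. c (act g x))" for x
  have ac: "a \<eta> \<in> carrier G" for \<eta> using B(2,3) by auto
  define \<theta> where "\<theta> x = act (a (\<omega> x)) x" for x
  obtain ws where ws: "set ws = W" using W(1) finite_list by blast
  define D where "D x = map (\<lambda>g. c (act g x)) ws" for x
  have D_meas: "D \<in> measurable M (count_space UNIV)"
    unfolding D_def
  proof (rule measurable_map_list)
    fix g assume "g \<in> set ws"
    then have "g \<in> carrier G" using ws W(2) by auto
    then show "(\<lambda>x. c (act g x)) \<in> measurable M (count_space UNIV)"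
      by (rule measurable_compose[OF act_measurable c(1)])
  qed
  have a_D: "a (\<omega> x) = a (\<omega> y)" if "D x = D y" for x y
    by (rule W(3)) (use that ws in \<open>auto simp: D_def \<omega>_def map_eq_conv\<close>)
  \<comment> \<open>The element \<open>a (\<omega> x)\<close> depends only on the finite list
    \<open>D x\<close>, which takes values in a countable type; so \<theta> is one of countably many
    measurable maps on each of countably many measurable pieces.\<close>
  define h where "h l = (SOME b. b \<in> carrier G \<and> (\<forall>x. D x = l \<longrightarrow> b = a (\<omega> x)))" for l
  have h: "h l \<in> carrier G \<and> (\<forall>x. D x = l \<longrightarrow> h l = a (\<omega> x))" for l
  proof -
    have "\<exists>b. b \<in> carrier G \<and> (\<forall>x. D x = l \<longrightarrow> b = a (\<omega> x))"
    proof (cases "\<exists>x. D x = l")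
      case True
      then obtain x where "D x = l" by blast
      then show ?thesis by (intro exI[of _ "a (\<omega> x)"] conjI allI impI ac a_D) simp
    next
      case False
      then show ?thesis by (intro exI[of _ \<one>]) auto
    qed
    from someI_ex[OF this] show ?thesis unfolding h_def .
  qed
  have "(\<lambda>x. (\<lambda>l x. act (h l) x) (D x) x) \<in> measurable M M"
    by (rule measurable_compose_countable[OF _ D_meas]) (use h act_measurable in blast)
  moreover have "(\<lambda>x. (\<lambda>l x. act (h l) x) (D x) x) = \<theta>"
    using h unfolding \<theta>_def by (intro ext) metis
  ultimately have \<theta>_meas: "\<theta> \<in> measurable M M" by simp
  have "card (\<theta> ` (\<lambda>s. act s x) ` S) \<le> K" if x: "x \<in> space M" for x
  proof -
    have "proper_coloring G (carrier G) F N (\<omega> x)"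
      unfolding proper_coloring_def \<omega>_def
    proof (intro conjI ballI impI)
      fix g assume g: "g \<in> carrier G"
      show "c (act g x) < N" by (rule c(2)[OF act_space[OF g x]])
      fix f assume f: "f \<in> F" "f \<noteq> \<one>"
      then have "f \<in> carrier G" using F by auto
      then show "c (act (f \<otimes> g) x) \<noteq> c (act g x)" using c(3)[OF act_space[OF g x] f] act_mult g x by simp
    qed
    from a_bound[OF this] have bd: "card ((\<lambda>s. a (shift G s (\<omega> x)) \<otimes> s) ` S) \<le> K" .
    have "\<theta> (act s x) = act (a (shift G s (\<omega> x)) \<otimes> s) x" if s: "s \<in> S" for s
    proof -
      have sc: "s \<in> carrier G" using s S by auto
      have "a (\<omega> (act s x)) = a (shift G s (\<omega> x))"
        by (rule W(3)) (use W(2) sc x act_mult in \<open>auto simp: \<omega>_def shift_def subset_iff\<close>)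
      then show ?thesis using act_mult[OF ac sc x] by (simp add: \<theta>_def)
    qed
    then have "\<theta> ` (\<lambda>s. act s x) ` S = (\<lambda>b. act b x) ` (\<lambda>s. a (shift G s (\<omega> x)) \<otimes> s) ` S"
      by (auto simp: image_image)
    then have "card (\<theta> ` (\<lambda>s. act s x) ` S) \<le> card ((\<lambda>s. a (shift G s (\<omega> x)) \<otimes> s) ` S)"
      using card_image_le[of "(\<lambda>s. a (shift G s (\<omega> x)) \<otimes> s) ` S" "\<lambda>b. act b x"] S by simp
    then show ?thesis using bd by linarith
  qed
  moreover have "\<forall>x\<in>space M. \<exists>b\<in>B. \<theta> x = act b x" using B(3) by (auto simp: \<theta>_def)
  ultimately show ?thesis using B \<theta>_meas by blast
qed

end

section \<open>From collapsing maps to hyperfiniteness\<close>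

lemma equiv_kernel:
  assumes E: "equiv X E"
  shows "equiv X {(x, y) \<in> E. f x = f y}"
proof (rule equivI)
  show "{(x, y) \<in> E. f x = f y} \<subseteq> X \<times> X" using E by (auto simp: equiv_def)
  show "refl_on X {(x, y) \<in> E. f x = f y}" using E by (auto simp: equiv_def refl_on_def)
  show "sym {(x, y) \<in> E. f x = f y}"
    by (rule symI) (use E in \<open>auto simp: equiv_def dest: symD\<close>)
  show "trans {(x, y) \<in> E. f x = f y}"
    by (rule transI) (use E in \<open>auto simp: equiv_def dest: transD\<close>)
qed

context free_action
begin

text \<open>Composing marker maps for larger and larger windows makes their kernels increase, while at most
  \<open>K\<close> values survive in each orbit: the union of the kernels has finite index in the orbit relation.\<close>

lemma collapsing_maps:
  assumes K: "rule_bound K G"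
  shows "\<exists>(\<Theta> :: nat \<Rightarrow> 'x \<Rightarrow> 'x) D. (\<forall>n. \<Theta> n \<in> measurable M M \<and> finite (D n) \<and> D n \<subseteq> carrier G \<and>
      (\<forall>x\<in>space M. \<exists>d\<in>D n. \<Theta> n x = act d x) \<and>
      (\<forall>x y. \<Theta> n x = \<Theta> n y \<longrightarrow> \<Theta> (Suc n) x = \<Theta> (Suc n) y)) \<and>
    (\<forall>S x. finite S \<and> S \<subseteq> carrier G \<and> x \<in> space M \<longrightarrow> (\<exists>n. card (\<Theta> n ` (\<lambda>s. act s x) ` S) \<le> K))"
proof -
  define Q where "Q S \<theta> B \<longleftrightarrow> finite B \<and> B \<subseteq> carrier G \<and> \<theta> \<in> measurable M M \<and>
    (\<forall>x\<in>space M. \<exists>b\<in>B. \<theta> x = act b x) \<and> (\<forall>x\<in>space M. card (\<theta> ` (\<lambda>s. act s x) ` S) \<le> K)" for S \<theta> B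
  have "\<forall>S. \<exists>p. finite S \<and> S \<subseteq> carrier G \<longrightarrow> Q S (fst p) (snd p)"
    using marker_map[OF K] unfolding Q_def by (metis fst_conv snd_conv)
  then obtain p where p: "\<And>S. finite S \<Longrightarrow> S \<subseteq> carrier G \<Longrightarrow> Q S (fst (p S)) (snd (p S))" by metis
  have ne: "carrier G \<noteq> {}" using one_closed by blast
  define e where "e = from_nat_into (carrier G)"
  have e: "range e = carrier G" unfolding e_def by (rule range_from_nat_into[OF ne countable_G])
  have ec: "e i \<in> carrier G" for i using e by auto
  \<comment> \<open>The map \<Theta> of stage \<open>n\<close> moves points by elements of
    \<open>D n\<close> only. It thus sends the translates of \<open>x\<close> by the first
    \<open>n + 1\<close> group elements into the window \<open>S n\<close> at \<open>x\<close>,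
    which the next map compresses to at most \<open>K\<close> points.\<close>
  define next_S where "next_S D n = (\<lambda>(d, t). d \<otimes> t) ` (D \<times> e ` {..n})" for D and n :: nat
  define st where "st = rec_nat (id, {\<one>}) (\<lambda>n q. (fst (p (next_S (snd q) n)) \<circ> fst q,
     (\<lambda>(b, d). b \<otimes> d) ` (snd (p (next_S (snd q) n)) \<times> snd q)))"
  define \<Theta> where "\<Theta> n = fst (st n)" for n
  define D where "D n = snd (st n)" for n
  define S where "S n = next_S (D n) n" for n
  have zero: "\<Theta> 0 = id" "D 0 = {\<one>}" by (simp_all add: \<Theta>_def D_def st_def)
  have st_Suc: "\<Theta> (Suc n) = fst (p (S n)) \<circ> \<Theta> n" "D (Suc n) = (\<lambda>(b, d). b \<otimes> d) ` (snd (p (S n)) \<times> D n)" for n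
    by (simp_all add: \<Theta>_def D_def S_def st_def)
  have S_ok: "finite (S n) \<and> S n \<subseteq> carrier G" if "finite (D n)" "D n \<subseteq> carrier G" for n
    unfolding S_def next_S_def using that ec by auto
  have D: "finite (D n) \<and> D n \<subseteq> carrier G" for n
  proof (induction n)
    case 0 then show ?case by (simp add: zero)
  next
    case (Suc n)
    have "Q (S n) (fst (p (S n))) (snd (p (S n)))" using p S_ok Suc.IH by blast
    then have "finite (snd (p (S n)))" "snd (p (S n)) \<subseteq> carrier G" by (auto simp: Q_def)
    then show ?case using Suc.IH unfolding st_Suc(2) by auto
  qed
  have pS: "Q (S n) (fst (p (S n))) (snd (p (S n)))" for n using p S_ok D by blast
  have \<Theta>_meas: "\<Theta> n \<in> measurable M M" for n
  proof (induction n)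
    case 0 then show ?case by (simp add: zero)
  next
    case (Suc n)
    then show ?case unfolding st_Suc(1) using pS[of n] by (auto simp: Q_def intro: measurable_comp)
  qed
  have \<Theta>_D: "\<exists>d\<in>D n. \<Theta> n x = act d x" if x: "x \<in> space M" for n x
  proof (induction n)
    case 0 then show ?case using act_one[OF x] by (simp add: zero)
  next
    case (Suc n)
    then obtain d where d: "d \<in> D n" "\<Theta> n x = act d x" by blast
    have "act d x \<in> space M" using d D[of n] act_space[OF _ x] by blast
    then obtain b where b: "b \<in> snd (p (S n))" "fst (p (S n)) (act d x) = act b (act d x)"
      using pS[of n] unfolding Q_def by blast
    then have "b \<in> carrier G" "d \<in> carrier G" using pS[of n] D[of n] d unfolding Q_def by auto
    then have "\<Theta> (Suc n) x = act (b \<otimes> d) x" using b d act_mult x by (simp add: st_Suc(1))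
    then show ?case using b d unfolding st_Suc(2) by force
  qed
  have bound: "\<exists>n. card (\<Theta> n ` (\<lambda>s. act s x) ` R) \<le> K" if R: "finite R" "R \<subseteq> carrier G" and x: "x \<in> space M" for R x
  proof -
    obtain I where I: "finite I" "R = e ` I"
      using finite_subset_image[OF R(1), of e UNIV] R(2) e by blast
    define n where "n = (if I = {} then 0 else Max I)"
    have In: "I \<subseteq> {..n}" using I(1) by (auto simp: n_def)
    have "\<Theta> (Suc n) ` (\<lambda>s. act s x) ` R \<subseteq> fst (p (S n)) ` (\<lambda>s. act s x) ` S n"
    proof
      fix z assume "z \<in> \<Theta> (Suc n) ` (\<lambda>s. act s x) ` R"
      then obtain r where r: "r \<in> R" "z = \<Theta> (Suc n) (act r x)" by blast
      have rc: "r \<in> carrier G" using r R by auto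
      obtain d where d: "d \<in> D n" "\<Theta> n (act r x) = act d (act r x)" using \<Theta>_D[OF act_space[OF rc x]] by blast
      have "d \<otimes> r \<in> S n" using d r I In by (auto simp: S_def next_S_def)
      moreover have "act d (act r x) = act (d \<otimes> r) x" using act_mult[of d r x] d D[of n] rc x by auto
      ultimately show "z \<in> fst (p (S n)) ` (\<lambda>s. act s x) ` S n" using r d by (simp add: st_Suc(1))
    qed
    then have "card (\<Theta> (Suc n) ` (\<lambda>s. act s x) ` R) \<le> card (fst (p (S n)) ` (\<lambda>s. act s x) ` S n)"
      using S_ok D by (intro card_mono) auto
    also have "\<dots> \<le> K" using pS[of n] x by (simp add: Q_def)
    finally show ?thesis by blast
  qed
  show ?thesis
  proof (intro exI[of _ \<Theta>] exI[of _ D] conjI allI ballI impI)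
    fix n show "\<Theta> n \<in> measurable M M" "finite (D n)" "D n \<subseteq> carrier G" using \<Theta>_meas D by auto
    fix x assume "x \<in> space M" then show "\<exists>d\<in>D n. \<Theta> n x = act d x" by (rule \<Theta>_D)
  next
    fix n x y assume "\<Theta> n x = \<Theta> n y" then show "\<Theta> (Suc n) x = \<Theta> (Suc n) y" by (simp add: st_Suc(1))
  next
    fix R x assume R: "finite R \<and> R \<subseteq> carrier G \<and> x \<in> space M"
    show "\<exists>n. card (\<Theta> n ` (\<lambda>s. act s x) ` R) \<le> K"
      by (rule bound[OF R[THEN conjunct1] R[THEN conjunct2, THEN conjunct1] R[THEN conjunct2, THEN conjunct2]])
  qed
qed

text \<open>Equality of the two finite images unfolds into finitely many equality tests, so that no
  Borel structure on finite subsets has to be set up.\<close>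

lemma measurable_image_eq:
  assumes \<Theta>: "\<Theta> \<in> measurable M M" and P: "finite P" "P \<subseteq> carrier G" "finite P'" "P' \<subseteq> carrier G"
    and g: "g \<in> carrier G"
  shows "Measurable.pred M (\<lambda>x. (\<lambda>p. \<Theta> (act p x)) ` P = (\<lambda>p. \<Theta> (act p (act g x))) ` P')"
proof -
  have eq: "(\<lambda>x. (\<lambda>p. \<Theta> (act p x)) ` P = (\<lambda>p. \<Theta> (act p (act g x))) ` P') =
    (\<lambda>x. (\<forall>p\<in>P. \<exists>q\<in>P'. \<Theta> (act p x) = \<Theta> (act q (act g x))) \<and> (\<forall>q\<in>P'. \<exists>p\<in>P. \<Theta> (act q (act g x)) = \<Theta> (act p x)))"
    by (simp only: set_eq_subset image_subset_iff image_iff)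
  have 1: "(\<lambda>x. \<Theta> (act p x)) \<in> measurable M M" if "p \<in> carrier G" for p
    by (rule measurable_compose[OF act_measurable[OF that] \<Theta>])
  have 2: "(\<lambda>x. \<Theta> (act p (act g x))) \<in> measurable M M" if "p \<in> carrier G" for p
    by (rule measurable_compose[OF act_measurable[OF g] 1[OF that]])
  have "Measurable.pred M (\<lambda>x. \<forall>p\<in>P. \<exists>q\<in>P'. \<Theta> (act p x) = \<Theta> (act q (act g x)))"
    by (intro pred_intros_finite(3,4) P separating_eq_measurable[OF sep] 1 2) (use P in auto)
  moreover have "Measurable.pred M (\<lambda>x. \<forall>q\<in>P'. \<exists>p\<in>P. \<Theta> (act q (act g x)) = \<Theta> (act p x))"
    by (intro pred_intros_finite(3,4) P separating_eq_measurable[OF sep] 1 2) (use P in auto)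
  ultimately show ?thesis unfolding eq by (rule pred_intros_logic)
qed

text \<open>Passing from the union of the kernels to the orbit relation: \<open>A n x\<close> is the image of a finite set
  that meets all classes in the orbit of \<open>x\<close>, so points of one orbit eventually have the same \<open>A n\<close>.\<close>

theorem free_hyperfinite:
  assumes K: "rule_bound K G"
  shows "hyperfinite M {(x, y). x \<in> space M \<and> y \<in> space M \<and> (\<exists>g\<in>carrier G. act g x = y)}"
proof -
  obtain \<Theta> :: "nat \<Rightarrow> 'x \<Rightarrow> 'x" and D where all:
    "(\<forall>n. \<Theta> n \<in> measurable M M \<and> finite (D n) \<and> D n \<subseteq> carrier G \<and>
      (\<forall>x\<in>space M. \<exists>d\<in>D n. \<Theta> n x = act d x) \<and>
      (\<forall>x y. \<Theta> n x = \<Theta> n y \<longrightarrow> \<Theta> (Suc n) x = \<Theta> (Suc n) y)) \<and>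
    (\<forall>S x. finite S \<and> S \<subseteq> carrier G \<and> x \<in> space M \<longrightarrow> (\<exists>n. card (\<Theta> n ` (\<lambda>s. act s x) ` S) \<le> K))"
    using collapsing_maps[OF K] by (elim exE)
  note all1 = all[THEN conjunct1, THEN spec]
  note \<Theta> = all1[THEN conjunct1] and D = all1[THEN conjunct2, THEN conjunct1] all1[THEN conjunct2, THEN conjunct2, THEN conjunct1]
    and \<Theta>_D = all1[THEN conjunct2, THEN conjunct2, THEN conjunct2, THEN conjunct1, THEN bspec]
    and \<Theta>_Suc = all1[THEN conjunct2, THEN conjunct2, THEN conjunct2, THEN conjunct2, THEN spec, THEN spec, THEN mp]
    and bound = all[THEN conjunct2, THEN spec, THEN spec, THEN mp, OF conjI, OF _ conjI]
  let ?E = "{(x, y). x \<in> space M \<and> y \<in> space M \<and> (\<exists>g\<in>carrier G. act g x = y)}"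
  have ne: "carrier G \<noteq> {}" using one_closed by blast
  define e where "e = from_nat_into (carrier G)"
  have e: "range e = carrier G" unfolding e_def by (rule range_from_nat_into[OF ne countable_G])
  have ec: "e i \<in> carrier G" for i using e by auto
  have \<Theta>_mono: "n \<le> n' \<Longrightarrow> \<Theta> n x = \<Theta> n y \<Longrightarrow> \<Theta> n' x = \<Theta> n' y" for n n' x y
    by (induction n' rule: dec_induct) (auto intro: \<Theta>_Suc)
  \<comment> \<open>The element \<open>\<one>\<close> guarantees that \<open>\<Theta> n y\<close>
    itself belongs to \<open>A n y\<close>, from which finiteness of the classes follows.\<close>
  define P where "P m = insert \<one> (e ` {..m})" for m
  have P: "finite (P m)" "P m \<subseteq> carrier G" for m using ec by (auto simp: P_def)
  define full where "full m x \<longleftrightarrow> (\<forall>g\<in>carrier G. \<exists>p\<in>P m. \<exists>n. \<Theta> n (act g x) = \<Theta> n (act p x))" for m x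
  have full_ex: "\<exists>m. full m x" if x: "x \<in> space M" for x
  proof -
    \<comment> \<open>Sets of translations whose points are never merged. Their size is at most
      \<open>K\<close>, and a maximal one meets every class in the orbit.\<close>
    define ind where "ind S \<longleftrightarrow> finite S \<and> S \<subseteq> carrier G \<and>
      (\<forall>s\<in>S. \<forall>t\<in>S. s \<noteq> t \<longrightarrow> (\<forall>n. \<Theta> n (act s x) \<noteq> \<Theta> n (act t x)))" for S
    have le: "card S \<le> K" if S: "ind S" for S
    proof -
      obtain n where n: "card (\<Theta> n ` (\<lambda>s. act s x) ` S) \<le> K" using bound[of S x] S x by (auto simp: ind_def)
      have "inj_on (\<lambda>s. \<Theta> n (act s x)) S" using S by (auto simp: ind_def inj_on_def)
      then show ?thesis using n by (simp add: image_image card_image)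
    qed
    have "ind {}" by (simp add: ind_def)
    then obtain S where S: "ind S" "\<And>S'. ind S' \<Longrightarrow> card S' \<le> card S"
      using ex_has_greatest_nat[of ind "{}" card "Suc K"] le by (metis less_Suc_eq_le)
    have Sf: "finite S" "S \<subseteq> carrier G" using S by (auto simp: ind_def)
    obtain I where I: "finite I" "S = e ` I" using finite_subset_image[OF Sf(1), of e UNIV] Sf(2) e by blast
    obtain m where m: "I \<subseteq> {..m}" using finite_nat_iff_bounded_le[of I] I by blast
    have "full m x" unfolding full_def
    proof
      fix g assume g: "g \<in> carrier G"
      have "\<exists>s\<in>S. \<exists>n. \<Theta> n (act g x) = \<Theta> n (act s x)"
      proof (rule ccontr)
        assume no: "\<not> (\<exists>s\<in>S. \<exists>n. \<Theta> n (act g x) = \<Theta> n (act s x))"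
        then have "g \<notin> S" by blast
        moreover have "ind (insert g S)" using S(1) g no unfolding ind_def by (metis finite_insert insert_iff insert_subset)
        ultimately show False using S(2)[of "insert g S"] Sf by simp
      qed
      then show "\<exists>p\<in>P m. \<exists>n. \<Theta> n (act g x) = \<Theta> n (act p x)" using I m by (auto simp: P_def)
    qed
    then show ?thesis by blast
  qed
  define m where "m x = (LEAST m. full m x)" for x
  have m: "full (m x) x" if "x \<in> space M" for x unfolding m_def by (rule LeastI_ex[OF full_ex[OF that]])
  have act_\<Theta>: "(\<lambda>x. \<Theta> n (act g x)) \<in> measurable M M" if "g \<in> carrier G" for g n
    by (rule measurable_compose[OF act_measurable[OF that] \<Theta>])
  have "Measurable.pred M (full k)" for k
    unfolding full_def
    by (intro measurable_pred_countable(1)[OF countable_G] pred_intros_finite(4) pred_intros_countable(2)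
        separating_eq_measurable[OF sep] act_\<Theta> P(1)) (use P in auto)
  then have m_meas: "m \<in> measurable M (count_space UNIV)"
    unfolding m_def by (rule measurable_Least)
  define A where "A n x = (\<lambda>p. \<Theta> n (act p x)) ` P (m x)" for n x
  define F where "F n = {(x, y) \<in> ?E. A n x = A n y}" for n
  note E_equiv = orbit_equiv
  have F_equiv: "equiv (space M) (F n)" for n
    unfolding F_def by (rule equiv_kernel[OF E_equiv])
  have A_Suc: "A (Suc n) x = A (Suc n) y" if eq: "A n x = A n y" for n x y
  proof -
    have "A (Suc n) x \<subseteq> A (Suc n) y" if eq: "A n x = A n y" for x y
    proof
      fix z assume "z \<in> A (Suc n) x"
      then obtain p where p: "p \<in> P (m x)" "z = \<Theta> (Suc n) (act p x)" by (auto simp: A_def)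
      then have "\<Theta> n (act p x) \<in> A n y" using eq by (auto simp: A_def)
      then obtain q where q: "q \<in> P (m y)" "\<Theta> n (act p x) = \<Theta> n (act q y)" by (auto simp: A_def)
      show "z \<in> A (Suc n) y" unfolding A_def p(2) \<Theta>_Suc[OF q(2)] using q(1) by (rule imageI)
    qed
    then show ?thesis using eq by (metis subset_antisym)
  qed
  have "F n \<subseteq> F (Suc n)" for n
    using A_Suc[of n] unfolding F_def by blast
  then have "incseq F" by (rule incseq_SucI)
  moreover have "finite_equiv_rel (space M) (F n)" for n
    unfolding finite_equiv_rel_def
  proof (intro conjI ballI)
    fix C assume "C \<in> space M // F n"
    then obtain x where x: "x \<in> space M" "C = F n `` {x}" by (auto elim: quotientE)
    \<comment> \<open>A point \<open>y\<close> of the class is recovered from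
      \<open>\<Theta> n y\<close>, a member of the finite set \<open>A n x\<close>, by the inverse
      of one of the finitely many elements of \<open>D n\<close>.\<close>
    have "C \<subseteq> (\<lambda>(d, z). act (inv d) z) ` (D n \<times> A n x)"
    proof
      fix y assume "y \<in> C"
      then have y: "y \<in> space M" "A n x = A n y" using x by (auto simp: F_def)
      obtain d where d: "d \<in> D n" "\<Theta> n y = act d y" using \<Theta>_D[OF y(1)] by blast
      have "d \<in> carrier G" using d D by auto
      then have "act (inv d) (\<Theta> n y) = y" using act_inv y d by simp
      moreover have "\<Theta> n y \<in> A n y"
        unfolding A_def by (rule image_eqI[of _ _ \<one>]) (simp_all add: act_one[OF y(1)] P_def)
      then have "\<Theta> n y \<in> A n x" using y(2) by simp
      ultimately show "y \<in> (\<lambda>(d, z). act (inv d) z) ` (D n \<times> A n x)"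
        using d(1) by (intro image_eqI[of _ _ "(d, \<Theta> n y)"]) auto
    qed
    moreover have "finite (D n \<times> A n x)" using D P by (simp add: A_def)
    ultimately show "finite C" using finite_surj by blast
  qed (rule F_equiv)
  moreover have "F n \<in> sets (M \<Otimes>\<^sub>M M)" for n
  proof -
    have pred: "Measurable.pred M (\<lambda>x. A n x = A n (act g x))" if g: "g \<in> carrier G" for g
    proof -
      have mg: "(\<lambda>x. m (act g x)) \<in> measurable M (count_space UNIV)"
        by (rule measurable_compose[OF act_measurable[OF g] m_meas])
      have "Measurable.pred M (\<lambda>x. (\<lambda>p. \<Theta> n (act p x)) ` P a = (\<lambda>p. \<Theta> n (act p (act g x))) ` P b)" for a b
        by (rule measurable_image_eq[OF \<Theta> P P g])
      then have "Measurable.pred M (\<lambda>x. (\<lambda>p. \<Theta> n (act p x)) ` P (m x) = (\<lambda>p. \<Theta> n (act p (act g x))) ` P b)" for b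
        by (rule measurable_compose_countable[where f = "\<lambda>a x. (\<lambda>p. \<Theta> n (act p x)) ` P a = (\<lambda>p. \<Theta> n (act p (act g x))) ` P b", OF _ m_meas])
      from measurable_compose_countable[where f = "\<lambda>b x. (\<lambda>p. \<Theta> n (act p x)) ` P (m x) = (\<lambda>p. \<Theta> n (act p (act g x))) ` P b", OF this mg]
      show ?thesis unfolding A_def .
    qed
    have gr: "{z \<in> space (M \<Otimes>\<^sub>M M). act g (fst z) = snd z \<and> A n (fst z) = A n (act g (fst z))} \<in> sets (M \<Otimes>\<^sub>M M)"
      if g: "g \<in> carrier G" for g
    proof -
      have "Measurable.pred (M \<Otimes>\<^sub>M M) (\<lambda>z. act g (fst z) = snd z)"
        by (rule separating_eq_measurable[OF sep measurable_compose[OF measurable_fst act_measurable[OF g]] measurable_snd])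
      moreover have "Measurable.pred (M \<Otimes>\<^sub>M M) (\<lambda>z. A n (fst z) = A n (act g (fst z)))"
        by (rule measurable_compose[OF measurable_fst pred[OF g]])
      ultimately have "Measurable.pred (M \<Otimes>\<^sub>M M) (\<lambda>z. act g (fst z) = snd z \<and> A n (fst z) = A n (act g (fst z)))"
        by (rule pred_intros_logic)
      then show ?thesis by (simp add: pred_def)
    qed
    \<comment> \<open>The orbit relation is covered by the graphs of countably many maps, and on
      each graph the condition depends on the first coordinate alone.\<close>
    have "F n = (\<Union>g\<in>carrier G. {z \<in> space (M \<Otimes>\<^sub>M M). act g (fst z) = snd z \<and> A n (fst z) = A n (act g (fst z))})"
      by (auto simp: F_def space_pair_measure)
    then show ?thesis using gr countable_G by (auto intro!: sets.countable_UN')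
  qed
  moreover have "?E = (\<Union>n. F n)"
  proof
    show "(\<Union>n. F n) \<subseteq> ?E" by (auto simp: F_def)
    show "?E \<subseteq> (\<Union>n. F n)"
    proof
      fix z assume "z \<in> ?E"
      then obtain x y g where z: "z = (x, y)" "x \<in> space M" "y \<in> space M" "g \<in> carrier G" "act g x = y" by blast
      \<comment> \<open>Each of the finitely many points representing \<open>x\<close> is eventually
        merged with one representing \<open>y\<close>, and merged points remain merged.\<close>
      have half: "\<exists>N. \<forall>n\<ge>N. A n x \<subseteq> A n y" if xy: "x \<in> space M" "y \<in> space M" "g \<in> carrier G" "act g x = y" for x y g
      proof -
        have "\<forall>p\<in>P (m x). \<exists>n. \<exists>q\<in>P (m y). \<Theta> n (act p x) = \<Theta> n (act q y)"
        proof
          fix p assume "p \<in> P (m x)"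
          then have p: "p \<in> carrier G" using P by auto
          have "act p x = act (p \<otimes> inv g) y" using act_mult[of p "inv g" y] act_inv[of g x] xy p by auto
          moreover have "\<exists>q\<in>P (m y). \<exists>n. \<Theta> n (act (p \<otimes> inv g) y) = \<Theta> n (act q y)"
            using m[OF xy(2)] xy p unfolding full_def by simp
          ultimately show "\<exists>n. \<exists>q\<in>P (m y). \<Theta> n (act p x) = \<Theta> n (act q y)" by metis
        qed
        then obtain nn where nn: "\<And>p. p \<in> P (m x) \<Longrightarrow> \<exists>q\<in>P (m y). \<Theta> (nn p) (act p x) = \<Theta> (nn p) (act q y)" by metis
        have "A n x \<subseteq> A n y" if n: "Max (nn ` P (m x)) \<le> n" for n
        proof
          fix w assume "w \<in> A n x"
          then obtain p where p: "p \<in> P (m x)" "w = \<Theta> n (act p x)" by (auto simp: A_def)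
          obtain q where q: "q \<in> P (m y)" "\<Theta> (nn p) (act p x) = \<Theta> (nn p) (act q y)" using nn[OF p(1)] by blast
          have "nn p \<le> n" using p P n by (meson Max_ge finite_imageI imageI order_trans)
          show "w \<in> A n y" unfolding A_def p(2) \<Theta>_mono[OF \<open>nn p \<le> n\<close> q(2)] using q(1) by (rule imageI)
        qed
        then show ?thesis by blast
      qed
      obtain N1 where N1: "\<And>n. n \<ge> N1 \<Longrightarrow> A n x \<subseteq> A n y" using half z by blast
      have "act (inv g) y = x" using act_inv z by auto
      then obtain N2 where N2: "\<And>n. n \<ge> N2 \<Longrightarrow> A n y \<subseteq> A n x" using half[of y x "inv g"] z by auto
      have "A (max N1 N2) x = A (max N1 N2) y" using N1[of "max N1 N2"] N2[of "max N1 N2"] by auto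
      then have "z \<in> F (max N1 N2)" using z by (auto simp: F_def)
      then show "z \<in> (\<Union>n. F n)" by blast
    qed
  qed
  ultimately show ?thesis
    unfolding hyperfinite_def Borel_equiv_rel_def using E_equiv F_equiv by blast
qed

end

section \<open>Arbitrary actions\<close>

context measurable_action
begin

definition stab :: "'x \<Rightarrow> 'a set" where
  "stab x = {g \<in> carrier G. act g x = x}"

definition stratum :: "'a set \<Rightarrow> 'x set" where
  "stratum L = {x \<in> space M. stab x = L}"

lemma stab_subgroup:
  assumes x: "x \<in> space M" shows "subgroup (stab x) G"
proof (rule subgroupI)
  show "stab x \<noteq> {}" using act_one[OF x] by (auto simp: stab_def)
  fix g assume "g \<in> stab x"
  then show "inv g \<in> stab x" using act_inv[of g x] x by (auto simp: stab_def)
next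
  fix g h assume "g \<in> stab x" "h \<in> stab x"
  then show "g \<otimes> h \<in> stab x" using act_mult[of g h x] x by (auto simp: stab_def)
qed (auto simp: stab_def)

lemma stab_conj:
  assumes x: "x \<in> space M" and g: "g \<in> carrier G" and l: "l \<in> carrier G"
  shows "g \<otimes> l \<otimes> inv g \<in> stab (act g x) \<longleftrightarrow> l \<in> stab x"
proof -
  have "act (g \<otimes> l \<otimes> inv g) (act g x) = act g (act l x)"
    using x g l by (simp add: act_mult act_space act_inv)
  moreover have "act g (act l x) = act g x \<longleftrightarrow> act l x = x"
    using act_inv[OF g] act_space x l by metis
  ultimately show ?thesis using g l by (simp add: stab_def)
qed

lemma stratum_measurable:
  assumes "subgroup L G"
  shows "stratum L \<in> sets M"
proof -
  have L: "L \<subseteq> carrier G" using assms subgroup.subset by blast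
  have "Measurable.pred M (\<lambda>x. act g x = x)" if "g \<in> carrier G" for g
    using separating_eq_measurable[OF sep act_measurable[OF that], of "\<lambda>x. x"] by simp
  then have "Measurable.pred M (\<lambda>x. (act g x = x) = (g \<in> L))" if "g \<in> carrier G" for g
    using that by measurable
  then have "Measurable.pred M (\<lambda>x. \<forall>g\<in>carrier G. (act g x = x) = (g \<in> L))"
    by (intro measurable_pred_countable(1)[OF countable_G])
  moreover have "stratum L = {x \<in> space M. \<forall>g\<in>carrier G. (act g x = x) = (g \<in> L)}"
    unfolding stratum_def stab_def using L by blast
  ultimately show ?thesis by (simp add: pred_def)
qed

text \<open>An element carrying one point with stabilizer \<open>L\<close> to another normalizes
  \<open>L\<close>. On the stratum the orbit relation is therefore that of the normalizer modulo
  \<open>L\<close>, which acts freely there.\<close>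

lemma stratum_hyperfinite:
  assumes L: "subgroup L G"
    and K: "\<And>N. subgroup N G \<Longrightarrow> L \<lhd> G\<lparr>carrier := N\<rparr> \<Longrightarrow> \<exists>K. rule_bound K ((G\<lparr>carrier := N\<rparr>) Mod L)"
  shows "hyperfinite (restrict_space M (stratum L))
    {(x, y). x \<in> stratum L \<and> y \<in> stratum L \<and> (\<exists>g\<in>carrier G. act g x = y)}"
proof -
  \<comment> \<open>The equivalence expresses that conjugation maps \<open>L\<close> onto itself;
    for infinite \<open>L\<close>, mapping into \<open>L\<close> would be weaker and need not define
    a group.\<close>
  define N where "N = {g \<in> carrier G. \<forall>l\<in>carrier G. g \<otimes> l \<otimes> inv g \<in> L \<longleftrightarrow> l \<in> L}"
  have Nc: "N \<subseteq> carrier G" and Lc: "L \<subseteq> carrier G" using L subgroup.subset by (auto simp: N_def)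
  have N: "subgroup N G"
  proof (rule subgroupI)
    show "N \<noteq> {}"
    proof -
      have "\<one> \<in> N" by (simp add: N_def)
      then show ?thesis by blast
    qed
    fix g assume g: "g \<in> N"
    then have gc: "g \<in> carrier G" using Nc by blast
    have "inv g \<otimes> l \<otimes> inv (inv g) \<in> L \<longleftrightarrow> l \<in> L" if l: "l \<in> carrier G" for l
    proof -
      have "g \<otimes> (inv g \<otimes> l \<otimes> g) \<otimes> inv g = l"
      proof -
        have "g \<otimes> (inv g \<otimes> l \<otimes> g) \<otimes> inv g = (g \<otimes> inv g) \<otimes> l \<otimes> (g \<otimes> inv g)"
          using gc l by (simp only: m_assoc m_closed inv_closed)
        then show ?thesis using gc l by simp
      qed
      moreover have "inv g \<otimes> l \<otimes> g \<in> carrier G" using gc l by simp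
      moreover have "g \<otimes> (inv g \<otimes> l \<otimes> g) \<otimes> inv g \<in> L \<longleftrightarrow> inv g \<otimes> l \<otimes> g \<in> L"
        using g calculation(2) unfolding N_def by blast
      ultimately show ?thesis using gc by simp
    qed
    then show "inv g \<in> N" using gc by (simp add: N_def)
  next
    fix g h assume gh: "g \<in> N" "h \<in> N"
    then have c: "g \<in> carrier G" "h \<in> carrier G" using Nc by auto
    have "(g \<otimes> h) \<otimes> l \<otimes> inv (g \<otimes> h) \<in> L \<longleftrightarrow> l \<in> L" if l: "l \<in> carrier G" for l
    proof -
      have "(g \<otimes> h) \<otimes> l \<otimes> inv (g \<otimes> h) = g \<otimes> (h \<otimes> l \<otimes> inv h) \<otimes> inv g"
        using c l by (simp add: inv_mult_group m_assoc)
      moreover have "h \<otimes> l \<otimes> inv h \<in> carrier G" using c l by simp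
      ultimately show ?thesis using gh l unfolding N_def by auto
    qed
    then show "g \<otimes> h \<in> N" using c by (simp add: N_def)
  qed (rule Nc)
  have LN: "L \<subseteq> N"
  proof
    fix g assume g: "g \<in> L"
    then have gc: "g \<in> carrier G" using Lc by blast
    have "g \<otimes> l \<otimes> inv g \<in> L \<longleftrightarrow> l \<in> L" if l: "l \<in> carrier G" for l
    proof
      assume "g \<otimes> l \<otimes> inv g \<in> L"
      then have "inv g \<otimes> (g \<otimes> l \<otimes> inv g) \<otimes> g \<in> L"
        using g L by (simp add: subgroup.m_closed subgroup.m_inv_closed)
      moreover have "inv g \<otimes> (g \<otimes> l \<otimes> inv g) \<otimes> g = (inv g \<otimes> g) \<otimes> l \<otimes> (inv g \<otimes> g)"
        using gc l by (simp only: m_assoc m_closed inv_closed)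
      ultimately show "l \<in> L" using gc l by simp
    next
      assume "l \<in> L"
      then show "g \<otimes> l \<otimes> inv g \<in> L" using g L by (simp add: subgroup.m_closed subgroup.m_inv_closed)
    qed
    then show "g \<in> N" using gc by (simp add: N_def)
  qed
  let ?\<Lambda> = "G\<lparr>carrier := N\<rparr>"
  interpret \<Lambda>: group ?\<Lambda> by (rule subgroup_imp_group[OF N])
  have L_normal: "L \<lhd> ?\<Lambda>"
  proof (rule \<Lambda>.normal_invI)
    show "subgroup L ?\<Lambda>" by (rule subgroup_incl[OF L N LN])
    fix g l assume "g \<in> carrier ?\<Lambda>" "l \<in> L"
    then show "g \<otimes>\<^bsub>?\<Lambda>\<^esub> l \<otimes>\<^bsub>?\<Lambda>\<^esub> inv\<^bsub>?\<Lambda>\<^esub> g \<in> L"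
      using m_inv_consistent[OF N, of g] Lc by (auto simp: N_def)
  qed
  interpret L: normal L ?\<Lambda> by (rule L_normal)
  let ?Q = "?\<Lambda> Mod L"
  interpret Q: group ?Q by (rule L.factorgroup_is_group)
  let ?Y = "stratum L"
  let ?MY = "restrict_space M ?Y"
  have Y: "?Y \<in> sets M" "?Y \<subseteq> space M" using stratum_measurable[OF L] by (auto simp: stratum_def)
  have space_MY: "space ?MY = ?Y" using Y by (simp add: space_restrict_space2)
  have N_act: "act g x \<in> ?Y" if "g \<in> N" "x \<in> ?Y" for g x
  proof -
    have c: "g \<in> carrier G" "x \<in> space M" using that Nc Y by auto
    have "l \<in> stab (act g x) \<longleftrightarrow> l \<in> L" if l: "l \<in> carrier G" for l
    proof -
      let ?k = "inv g \<otimes> l \<otimes> g"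
      have k: "?k \<in> carrier G" "g \<otimes> ?k \<otimes> inv g = l"
      proof -
        have "g \<otimes> ?k \<otimes> inv g = (g \<otimes> inv g) \<otimes> l \<otimes> (g \<otimes> inv g)"
          using c l by (simp only: m_assoc m_closed inv_closed)
        then show "g \<otimes> ?k \<otimes> inv g = l" using c l by simp
      qed (use c l in simp)
      have "l \<in> stab (act g x) \<longleftrightarrow> ?k \<in> stab x" using stab_conj[OF c(2,1) k(1)] k(2) by simp
      also have "\<dots> \<longleftrightarrow> ?k \<in> L" using \<open>x \<in> ?Y\<close> by (simp add: stratum_def)
      also have "\<dots> \<longleftrightarrow> g \<otimes> ?k \<otimes> inv g \<in> L" using \<open>g \<in> N\<close> k(1) unfolding N_def by blast
      also have "g \<otimes> ?k \<otimes> inv g = l" by (rule k(2))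
      finally show ?thesis .
    qed
    then have "stab (act g x) = L" using Lc by (auto simp: stab_def)
    then show ?thesis using act_space[OF c] by (simp add: stratum_def)
  qed
  \<comment> \<open>Any representative serves, because elements of \<open>L\<close> fix the points
    of the stratum.\<close>
  define rep where "rep Z = (SOME g. g \<in> Z)" for Z :: "'a set"
  define qact where "qact Z = act (rep Z)" for Z
  have carQ: "carrier ?Q = (\<lambda>g. L #>\<^bsub>?\<Lambda>\<^esub> g) ` N" by (simp add: carrier_FactGroup)
  have rep: "rep (L #>\<^bsub>?\<Lambda>\<^esub> g) \<in> N" "\<exists>l\<in>L. rep (L #>\<^bsub>?\<Lambda>\<^esub> g) = l \<otimes> g" if g: "g \<in> N" for g
  proof -
    have "g \<in> L #>\<^bsub>?\<Lambda>\<^esub> g" using \<Lambda>.rcos_self[of g L] g L.subgroup_axioms by simp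
    then have "rep (L #>\<^bsub>?\<Lambda>\<^esub> g) \<in> L #>\<^bsub>?\<Lambda>\<^esub> g" unfolding rep_def by (rule someI)
    then show ex: "\<exists>l\<in>L. rep (L #>\<^bsub>?\<Lambda>\<^esub> g) = l \<otimes> g" by (auto simp: r_coset_def)
    then show "rep (L #>\<^bsub>?\<Lambda>\<^esub> g) \<in> N" using LN g subgroup.m_closed[OF N] by auto
  qed
  have qact: "qact (L #>\<^bsub>?\<Lambda>\<^esub> g) x = act g x" if g: "g \<in> N" and x: "x \<in> ?Y" for g x
  proof -
    obtain l where l: "l \<in> L" "rep (L #>\<^bsub>?\<Lambda>\<^esub> g) = l \<otimes> g" using rep[OF g] by blast
    have c: "l \<in> carrier G" "g \<in> carrier G" "x \<in> space M" using l g x Lc Nc Y by auto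
    have "l \<in> stab (act g x)" using N_act[OF g x] l by (simp add: stratum_def)
    then have "act l (act g x) = act g x" by (simp add: stab_def)
    then show ?thesis using l act_mult[OF c] by (simp add: qact_def)
  qed
  have free: "free_action ?Q ?MY qact (\<lambda>i. U i \<inter> ?Y)"
  proof
    show "countable (carrier ?Q)" unfolding carQ using countable_subset[OF Nc countable_G] by simp
  next
    fix Z assume "Z \<in> carrier ?Q"
    then obtain g where g: "g \<in> N" "Z = L #>\<^bsub>?\<Lambda>\<^esub> g" using carQ by auto
    have "act g \<in> measurable ?MY M" using g Nc by (intro measurable_restrict_space1 act_measurable) auto
    then have "act g \<in> measurable ?MY ?MY"
      using N_act[OF g(1)] space_MY Y by (intro measurable_restrict_space2) auto
    then show "qact Z \<in> measurable ?MY ?MY"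
      using measurable_cong[of ?MY "qact Z" "act g" ?MY] qact g space_MY by simp
  next
    fix x assume "x \<in> space ?MY"
    then have x: "x \<in> ?Y" using space_MY by simp
    have one: "\<one> \<in> N" using subgroup.one_closed[OF N] .
    have "\<one>\<^bsub>?Q\<^esub> = L #>\<^bsub>?\<Lambda>\<^esub> \<one>" using \<Lambda>.coset_mult_one[OF L.subset] by simp
    then show "qact \<one>\<^bsub>?Q\<^esub> x = x" using qact[OF one x] act_one x Y by auto
  next
    fix Z Z' x assume as: "Z \<in> carrier ?Q" "Z' \<in> carrier ?Q" "x \<in> space ?MY"
    then have x: "x \<in> ?Y" using space_MY by simp
    obtain g where g: "g \<in> N" "Z = L #>\<^bsub>?\<Lambda>\<^esub> g" using carQ as by auto
    obtain h where h: "h \<in> N" "Z' = L #>\<^bsub>?\<Lambda>\<^esub> h" using carQ as by auto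
    have c: "g \<in> carrier G" "h \<in> carrier G" "x \<in> space M" "g \<otimes> h \<in> N"
      using g h x Nc Y subgroup.m_closed[OF N] by auto
    have "Z \<otimes>\<^bsub>?Q\<^esub> Z' = L #>\<^bsub>?\<Lambda>\<^esub> (g \<otimes> h)" using L.rcos_sum[of g h] g h by simp
    then show "qact (Z \<otimes>\<^bsub>?Q\<^esub> Z') x = qact Z (qact Z' x)"
      using qact[OF c(4) x] qact[OF h(1) x] qact[OF g(1) N_act[OF h(1) x]] g h act_mult[OF c(1-3)] by simp
  next
    show "separating ?MY (\<lambda>i. U i \<inter> ?Y)"
      using sep Y space_MY unfolding separating_def by (auto simp: sets_restrict_space_iff) (metis subsetD)
  next
    fix Z x assume as: "Z \<in> carrier ?Q" "x \<in> space ?MY" "qact Z x = x"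
    then have x: "x \<in> ?Y" using space_MY by simp
    obtain g where g: "g \<in> N" "Z = L #>\<^bsub>?\<Lambda>\<^esub> g" using carQ as by auto
    have "g \<in> stab x" using qact[OF g(1) x] as g Nc by (auto simp: stab_def)
    then have "g \<in> L" using x by (simp add: stratum_def)
    then show "Z = \<one>\<^bsub>?Q\<^esub>" using \<Lambda>.coset_join2[of g L] L.subgroup_axioms g by simp
  qed
  obtain k where "rule_bound k ?Q" using K[OF N L_normal] by blast
  from free_action.free_hyperfinite[OF free this]
  have "hyperfinite ?MY {(x, y). x \<in> ?Y \<and> y \<in> ?Y \<and> (\<exists>Z\<in>carrier ?Q. qact Z x = y)}"
    by (simp only: space_MY)
  moreover have "(\<exists>Z\<in>carrier ?Q. qact Z x = y) \<longleftrightarrow> (\<exists>g\<in>carrier G. act g x = y)"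
    if x: "x \<in> ?Y" and y: "y \<in> ?Y" for x y
  proof
    assume "\<exists>Z\<in>carrier ?Q. qact Z x = y"
    then obtain g where "g \<in> N" "qact (L #>\<^bsub>?\<Lambda>\<^esub> g) x = y" using carQ by auto
    then show "\<exists>g\<in>carrier G. act g x = y" using qact[OF _ x] Nc by auto
  next
    assume "\<exists>g\<in>carrier G. act g x = y"
    then obtain g where g: "g \<in> carrier G" "act g x = y" by blast
    have "g \<otimes> l \<otimes> inv g \<in> L \<longleftrightarrow> l \<in> L" if "l \<in> carrier G" for l
      using stab_conj[of x g l] x y g that by (simp add: stratum_def)
    then have "g \<in> N" using g by (simp add: N_def)
    then show "\<exists>Z\<in>carrier ?Q. qact Z x = y" using qact[OF _ x] g carQ by auto
  qed
  then have "{(x, y). x \<in> ?Y \<and> y \<in> ?Y \<and> (\<exists>Z\<in>carrier ?Q. qact Z x = y)} =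
    {(x, y). x \<in> ?Y \<and> y \<in> ?Y \<and> (\<exists>g\<in>carrier G. act g x = y)}" by blast
  ultimately show ?thesis by simp
qed

end

lemma sets_pair_restrict_space:
  assumes Y: "Y \<in> sets M" and F: "F \<in> sets (restrict_space M Y \<Otimes>\<^sub>M restrict_space M Y)"
  shows "F \<in> sets (M \<Otimes>\<^sub>M M)"
proof -
  have sp: "space (restrict_space M Y) = Y" using Y by (simp add: space_restrict_space2)
  have "F \<in> sigma_sets (Y \<times> Y) {a \<times> b | a b. a \<in> sets (restrict_space M Y) \<and> b \<in> sets (restrict_space M Y)}"
    using F by (simp add: sets_pair_measure sp)
  then show ?thesis
  proof (induction rule: sigma_sets.induct)
    case (Basic A)
    then obtain a b where "A = a \<times> b" "a \<in> sets M" "b \<in> sets M" using Y by (auto simp: sets_restrict_space_iff)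
    then show ?case by simp
  next
    case (Compl A)
    have "Y \<times> Y \<in> sets (M \<Otimes>\<^sub>M M)" using Y by simp
    then show ?case using Compl.IH by (rule sets.Diff)
  next
    case (Union A)
    then show ?case by (intro sets.countable_UN) auto
  qed simp
qed

section \<open>Gluing the strata\<close>

context measurable_action
begin

text \<open>Strata are not invariant: moving a point conjugates its stabilizer, so an orbit meets
  several of them. Each orbit is assigned the first stratum it meets, and each point is moved there
  by the first group element that achieves this.\<close>

lemma hyperfinite_strata:
  assumes subgroups: "countable {L. subgroup L G}"
    and strata: "\<And>L. subgroup L G \<Longrightarrow> hyperfinite (restrict_space M (stratum L))
      {(x, y). x \<in> stratum L \<and> y \<in> stratum L \<and> (\<exists>g\<in>carrier G. act g x = y)}"
  shows "hyperfinite M {(x, y). x \<in> space M \<and> y \<in> space M \<and> (\<exists>g\<in>carrier G. act g x = y)}"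
proof -
  let ?E = "{(x, y). x \<in> space M \<and> y \<in> space M \<and> (\<exists>g\<in>carrier G. act g x = y)}"
  define R where "R L = {(x, y). x \<in> stratum L \<and> y \<in> stratum L \<and> (\<exists>g\<in>carrier G. act g x = y)}" for L
  have "carrier G \<noteq> {}" using one_closed by blast
  define e where "e = from_nat_into (carrier G)"
  have e: "range e = carrier G" unfolding e_def by (rule range_from_nat_into) (use one_closed countable_G in blast)+
  have ec: "e j \<in> carrier G" for j using e by auto
  have "{L. subgroup L G} \<noteq> {}" using subgroup_self by blast
  define Ls where "Ls = from_nat_into {L. subgroup L G}"
  have Ls: "range Ls = {L. subgroup L G}" unfolding Ls_def by (rule range_from_nat_into) (use subgroup_self subgroups in blast)+
  have Ls_sub: "subgroup (Ls i) G" for i using Ls by auto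
  have "\<forall>i. \<exists>F :: nat \<Rightarrow> ('x \<times> 'x) set. incseq F \<and>
    (\<forall>n. Borel_equiv_rel (restrict_space M (stratum (Ls i))) (F n) \<and> finite_equiv_rel (space (restrict_space M (stratum (Ls i)))) (F n)) \<and>
    R (Ls i) = (\<Union>n. F n)"
    using strata[OF Ls_sub] unfolding hyperfinite_def R_def by blast
  then obtain F :: "nat \<Rightarrow> nat \<Rightarrow> ('x \<times> 'x) set" where F_all: "\<And>i. incseq (F i) \<and>
    (\<forall>n. Borel_equiv_rel (restrict_space M (stratum (Ls i))) (F i n) \<and> finite_equiv_rel (space (restrict_space M (stratum (Ls i)))) (F i n)) \<and>
    R (Ls i) = (\<Union>n. F i n)" by metis
  have st_meas: "stratum (Ls i) \<in> sets M" for i by (rule stratum_measurable[OF Ls_sub])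
  have sp: "space (restrict_space M (stratum (Ls i))) = stratum (Ls i)" for i using st_meas by (simp add: space_restrict_space2)
  have F_inc: "incseq (F i)" and F_UN: "R (Ls i) = (\<Union>n. F i n)" for i using F_all by blast+
  have F_equiv: "equiv (stratum (Ls i)) (F i n)" and F_sets: "F i n \<in> sets (M \<Otimes>\<^sub>M M)"
    and F_fin: "C \<in> stratum (Ls i) // F i n \<Longrightarrow> finite C" for i n C
    using F_all[of i] sets_pair_restrict_space[OF st_meas, of "F i n" i]
    unfolding Borel_equiv_rel_def finite_equiv_rel_def sp by blast+
  define idx where "idx x = (LEAST i. \<exists>j. act (e j) x \<in> stratum (Ls i))" for x
  define \<gamma> where "\<gamma> x = (LEAST j. act (e j) x \<in> stratum (Ls (idx x)))" for x
  define p where "p x = act (e (\<gamma> x)) x" for x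
  have idx_ex: "\<exists>i j. act (e j) x \<in> stratum (Ls i)" if x: "x \<in> space M" for x
  proof -
    obtain i where "Ls i = stab x" using stab_subgroup[OF x] Ls by (metis mem_Collect_eq rangeE)
    moreover obtain j where "e j = \<one>" using e by (metis one_closed rangeE)
    ultimately have "act (e j) x \<in> stratum (Ls i)" using x act_one[OF x] by (simp add: stratum_def)
    then show ?thesis by blast
  qed
  have p: "p x \<in> stratum (Ls (idx x))" if x: "x \<in> space M" for x
  proof -
    have "\<exists>j. act (e j) x \<in> stratum (Ls (idx x))" unfolding idx_def by (rule LeastI_ex[OF idx_ex[OF x]])
    then show ?thesis unfolding p_def \<gamma>_def by (rule LeastI_ex)
  qed
  have idx_act: "idx (act g x) = idx x" if x: "x \<in> space M" and g: "g \<in> carrier G" for x g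
  proof -
    have "(\<exists>j. act (e j) (act g x) \<in> A) \<longleftrightarrow> (\<exists>j. act (e j) x \<in> A)" for A
    proof
      assume "\<exists>j. act (e j) (act g x) \<in> A"
      then obtain j where j: "act (e j) (act g x) \<in> A" by blast
      obtain j' where "e j' = e j \<otimes> g" using e ec g by (metis m_closed rangeE)
      then show "\<exists>j. act (e j) x \<in> A" using j act_mult[OF ec g x] by metis
    next
      assume "\<exists>j. act (e j) x \<in> A"
      then obtain j where j: "act (e j) x \<in> A" by blast
      obtain j' where j': "e j' = e j \<otimes> inv g" using e ec g by (metis inv_closed m_closed rangeE)
      have "act (e j') (act g x) = act (e j) x"
        using j' act_mult[OF ec inv_closed[OF g] act_space[OF g x]] act_inv[OF g x] by simp
      then show "\<exists>j. act (e j) (act g x) \<in> A" using j by metis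
    qed
    then show ?thesis unfolding idx_def by simp
  qed
  \<comment> \<open>The map \<open>p\<close> may send infinitely many points to one. The cutoff
    \<open>\<gamma> \<le> n\<close> leaves finitely many over each value, and the points beyond it
    form singleton classes until \<open>n\<close> is large enough.\<close>
  define H where "H n = {(x, y) \<in> space M \<times> space M. x = y \<or>
    (\<gamma> x \<le> n \<and> \<gamma> y \<le> n \<and> idx x = idx y \<and> (p x, p y) \<in> F (idx x) n)}" for n
  have H_equiv: "equiv (space M) (H n)" for n
  proof (rule equivI)
    show "H n \<subseteq> space M \<times> space M" by (auto simp: H_def)
    show "refl_on (space M) (H n)" by (auto simp: H_def refl_on_def)
    have sy: "sym (F i n)" and tr: "trans (F i n)" for i using F_equiv[of i n] by (auto simp: equiv_def)
    show "sym (H n)" by (rule symI) (auto simp: H_def dest: symD[OF sy])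
    show "trans (H n)" by (rule transI) (auto simp: H_def dest: transD[OF tr])
  qed
  have F_mono: "F i n \<subseteq> F i (Suc n)" for i n using F_inc[of i] by (rule incseq_SucD)
  have "H n \<subseteq> H (Suc n)" for n
    unfolding H_def using F_mono[of _ n] by auto
  then have "incseq H" by (rule incseq_SucI)
  moreover have "finite_equiv_rel (space M) (H n)" for n
    unfolding finite_equiv_rel_def
  proof (intro conjI ballI)
    fix C assume "C \<in> space M // H n"
    then obtain x where x: "x \<in> space M" "C = H n `` {x}" by (auto elim: quotientE)
    let ?D = "F (idx x) n `` {p x}"
    have "?D \<in> stratum (Ls (idx x)) // F (idx x) n" using p[OF x(1)] by (rule quotientI)
    then have fin: "finite ?D" by (rule F_fin)
    have "C \<subseteq> insert x ((\<lambda>(j, z). act (inv (e j)) z) ` ({..n} \<times> ?D))"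
    proof
      fix y assume "y \<in> C"
      then have "(x, y) \<in> H n" using x by simp
      then consider "y = x" | "y \<in> space M" "\<gamma> y \<le> n" "p y \<in> ?D" by (auto simp: H_def)
      then show "y \<in> insert x ((\<lambda>(j, z). act (inv (e j)) z) ` ({..n} \<times> ?D))"
      proof cases
        case 2
        have "y = act (inv (e (\<gamma> y))) (p y)" using act_inv[OF ec 2(1)] by (simp add: p_def)
        then show ?thesis using 2 by (intro insertI2 image_eqI[of _ _ "(\<gamma> y, p y)"]) auto
      qed simp
    qed
    moreover have "finite (insert x ((\<lambda>(j, z). act (inv (e j)) z) ` ({..n} \<times> ?D)))" using fin by auto
    ultimately show "finite C" by (rule finite_subset)
  qed (rule H_equiv)
  moreover have "H n \<in> sets (M \<Otimes>\<^sub>M M)" for n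
  proof -
    have P: "Measurable.pred M (\<lambda>x. act (e j) x \<in> stratum (Ls i))" for i j
      using act_measurable[OF ec] st_meas by measurable
    have idx_meas: "idx \<in> measurable M (count_space UNIV)"
      unfolding idx_def by (rule measurable_Least) (rule pred_intros_countable(2)[OF P])
    have "Measurable.pred M (\<lambda>x. act (e j) x \<in> stratum (Ls (idx x)))" for j
      by (rule measurable_compose_countable[where f = "\<lambda>i x. act (e j) x \<in> stratum (Ls i)", OF P idx_meas])
    then have \<gamma>_meas: "\<gamma> \<in> measurable M (count_space UNIV)"
      unfolding \<gamma>_def by (rule measurable_Least)
    have p_meas: "p \<in> measurable M M"
      unfolding p_def
      by (rule measurable_compose_countable[where f = "\<lambda>j x. act (e j) x", OF act_measurable[OF ec] \<gamma>_meas])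
    have "(\<lambda>z. (p (fst z), p (snd z))) \<in> measurable (M \<Otimes>\<^sub>M M) (M \<Otimes>\<^sub>M M)"
      using p_meas by measurable
    then have "Measurable.pred (M \<Otimes>\<^sub>M M) (\<lambda>z. (p (fst z), p (snd z)) \<in> F i n)" for i
      using F_sets[of i n] by measurable
    from measurable_compose_countable[where f = "\<lambda>i z. (p (fst z), p (snd z)) \<in> F i n",
        OF this measurable_compose[OF measurable_fst idx_meas]]
    have F_pred: "Measurable.pred (M \<Otimes>\<^sub>M M) (\<lambda>z. (p (fst z), p (snd z)) \<in> F (idx (fst z)) n)" .
    have diag: "Measurable.pred (M \<Otimes>\<^sub>M M) (\<lambda>z. fst z = snd z)"
      by (rule separating_eq_measurable[OF sep measurable_fst measurable_snd])
    have "Measurable.pred M (\<lambda>x. \<gamma> x \<le> n)" by (rule measurable_compose[OF \<gamma>_meas]) simp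
    note \<gamma>_pred = measurable_compose[OF measurable_fst this] measurable_compose[OF measurable_snd this]
    have "Measurable.pred M (\<lambda>x. i = idx x)" for i by (rule measurable_compose[OF idx_meas]) simp
    from measurable_compose_countable[where f = "\<lambda>i z. i = idx (snd z)",
        OF measurable_compose[OF measurable_snd this] measurable_compose[OF measurable_fst idx_meas]]
    have idx_pred: "Measurable.pred (M \<Otimes>\<^sub>M M) (\<lambda>z. idx (fst z) = idx (snd z))" .
    have "Measurable.pred (M \<Otimes>\<^sub>M M) (\<lambda>z. fst z = snd z \<or>
      (\<gamma> (fst z) \<le> n \<and> \<gamma> (snd z) \<le> n \<and> idx (fst z) = idx (snd z) \<and> (p (fst z), p (snd z)) \<in> F (idx (fst z)) n))"
      by (intro pred_intros_logic diag \<gamma>_pred idx_pred F_pred)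
    moreover have "H n = {z \<in> space (M \<Otimes>\<^sub>M M). fst z = snd z \<or>
      (\<gamma> (fst z) \<le> n \<and> \<gamma> (snd z) \<le> n \<and> idx (fst z) = idx (snd z) \<and> (p (fst z), p (snd z)) \<in> F (idx (fst z)) n)}"
      by (auto simp: H_def space_pair_measure)
    ultimately show ?thesis by (simp add: pred_def)
  qed
  moreover have "?E = (\<Union>n. H n)"
  proof
    show "?E \<subseteq> (\<Union>n. H n)"
    proof
      fix z assume "z \<in> ?E"
      then obtain x y g where z: "z = (x, y)" "x \<in> space M" "y \<in> space M" "g \<in> carrier G" "act g x = y" by blast
      have i: "idx y = idx x" using idx_act z by blast
      have pp: "p x \<in> stratum (Ls (idx x))" "p y \<in> stratum (Ls (idx x))" using p z i by metis+
      have "act (e (\<gamma> y) \<otimes> g \<otimes> inv (e (\<gamma> x))) (p x) = p y"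
        using z ec act_space act_inv by (simp add: p_def act_mult)
      moreover have "e (\<gamma> y) \<otimes> g \<otimes> inv (e (\<gamma> x)) \<in> carrier G" using z ec by simp
      ultimately have "(p x, p y) \<in> R (Ls (idx x))" using pp unfolding R_def by blast
      then obtain k where k: "(p x, p y) \<in> F (idx x) k" using F_UN by blast
      let ?n = "max k (max (\<gamma> x) (\<gamma> y))"
      have "(p x, p y) \<in> F (idx x) ?n" using k incseqD[OF F_inc, of k ?n "idx x"] by auto
      then have "z \<in> H ?n" using z i by (auto simp: H_def)
      then show "z \<in> (\<Union>n. H n)" by blast
    qed
    show "(\<Union>n. H n) \<subseteq> ?E"
    proof
      fix z assume "z \<in> (\<Union>n. H n)"
      then obtain n where "z \<in> H n" by blast
      moreover obtain x y where "z = (x, y)" by (cases z)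
      ultimately have z: "z = (x, y)" "(x, y) \<in> H n" by auto
      then have xy: "x \<in> space M" "y \<in> space M" by (auto simp: H_def)
      show "z \<in> ?E"
      proof (cases "x = y")
        case True
        then show ?thesis using z xy orbit_equiv by (auto simp: equiv_def refl_on_def)
      next
        case False
        then have "(p x, p y) \<in> F (idx x) n" using z by (auto simp: H_def)
        then have "(p x, p y) \<in> R (Ls (idx x))" using F_UN by blast
        then obtain g where g: "g \<in> carrier G" "act g (p x) = p y" by (auto simp: R_def)
        have "act (inv (e (\<gamma> y)) \<otimes> g \<otimes> e (\<gamma> x)) x = y"
          using g xy ec act_inv[OF ec xy(2)] by (simp add: act_mult act_space p_def)
        moreover have "inv (e (\<gamma> y)) \<otimes> g \<otimes> e (\<gamma> x) \<in> carrier G" using g ec by simp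
        ultimately show ?thesis using z xy by blast
      qed
    qed
  qed
  ultimately show ?thesis
    unfolding hyperfinite_def Borel_equiv_rel_def using orbit_equiv H_equiv by blast
qed

end

theorem corollary1p9:
  fixes G :: "('g, 'b) monoid_scheme"
    and X :: "'x measure"
    and \<phi> :: "'g \<Rightarrow> 'x \<Rightarrow> 'x"
  assumes "polycyclic_group G"
    and "standard_Borel_space X"
    and "Borel_action G X \<phi>"
  shows "hyperfinite X (orbit_equiv_rel G (space X) \<phi>)"
proof -
  have G: "group G" using assms(1) by (simp add: polycyclic_group_def)
  interpret group G by (rule G)
  interpret A: group_action G "space X" \<phi> using assms(3) by (simp add: Borel_action_def)
  \<comment> \<open>Countability of \<open>G\<close> and of its set of subgroups: the first allows
    countable unions over group elements, the second over stabilizers.\<close>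
  note sub = noetherian_countable_subgroups[OF polycyclic_noetherian[OF assms(1)]]
  obtain U where U: "separating X U" using standard_Borel_separating[OF assms(2)] by blast
  have meas: "\<phi> g \<in> measurable X X" if "g \<in> carrier G" for g
  proof -
    have "(\<lambda>x. (\<lambda>(g, x). \<phi> g x) (g, x)) \<in> measurable X X"
      by (rule measurable_compose[OF measurable_Pair1']) (use assms(3) that in \<open>auto simp: Borel_action_def\<close>)
    then show ?thesis by simp
  qed
  interpret B: measurable_action G X \<phi> U
  proof
    show "countable (carrier G)" by (rule sub(1))
    show "\<phi> \<one>\<^bsub>G\<^esub> x = x" if "x \<in> space X" for x using A.id_eq_one that by (metis restrict_apply')
  qed (use meas A.composition_rule U in auto)
  show ?thesis
    unfolding orbit_equiv_rel_def
    by (rule B.hyperfinite_strata[OF sub(2) B.stratum_hyperfinite])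
      (use polycyclic_subquotient_rule_bound[OF assms(1)] in auto)
qed

end
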